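(* Let $D\subset\mathbb{R}^2$ be a bounded region with analytic boundary $\partial D$. Then the set of transmission eigenvalues $k\in\mathbb{C}_+$ (of the clamped transmission eigenvalue problem for $D$) is at most a discrete subset of the real line.
   Context: Let $\mathbb{C}_+ := \{z\in\mathbb{C} : \mathrm{Re}(z)>0 \text{ and } \mathrm{Re}(z^2)>0\}$. Let $\nu$ denote the outward unit normal vector on $\partial D$, and let $X(D)$ be the complex Hilbert space $$X(D)=\{(v,w)\in H^1(D)\times H^1(\mathbb{R}^2\setminus\overline{D}) : (v+w)|_{\partial D}=0\}$$ with the standard product inner product (boundary values are traces). A number $k\in\mathbb{C}_+$ is called a (clamped) transmission eigenvalue if there exists a nontrivial pair $(v,w)\in X(D)$ such that $$\Delta v+k^2v=0 \ \text{ in } D,\qquad \Delta w-k^2w=0\ \text{ in } \mathbb{R}^2\setminus\overline{D},$$ $$v+w=0,\quad \partial_\nu(v+w)=0\ \text{ on }\partial D,\qquad \lim_{r\to\infty}\sqrt{r}\,(\partial_r w-\mathrm{i}kw)=0,\quad r=|x|,$$ where the equations are understood in the weak sense, the normal derivatives in the sense of $H^{-1/2}(\partial D)$, and the radiation condition is uniform in $x/|x|$. (For $k\in\mathbb{C}_+$ and $w\in H^1(\mathbb{R}^2\setminus\overline D)$ the radiation condition is redundant.) Equivalently, $(v,w)\in X(D)\setminus\{0\}$ satisfies $$\int_D \nabla v\cdot\nabla\overline{\psi_1}\,dx+\int_{\mathbb{R}^2\setminus\overline D}\nabla w\cdot\nabla\overline{\psi_2}+k^2w\overline{\psi_2}\,dx-k^2\int_D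 v\overline{\psi_1}\,dx=0\quad\text{for all }(\psi_1,\psi_2)\in X(D).$$ "At most discrete" means that the set is possibly empty and has no accumulation point in $\mathbb{C}_+$. *)

theory Defs
  imports "HOL-Analysis.Analysis"
begin

definition partial_deriv :: "2 \<Rightarrow> (real^2 \<Rightarrow> complex) \<Rightarrow> real^2 \<Rightarrow> complex" where
  "partial_deriv i \<phi> x = frechet_derivative \<phi> (at x) (axis i 1)"

primrec C_k :: "nat \<Rightarrow> (real^2 \<Rightarrow> complex) \<Rightarrow> bool" where
  "C_k 0 \<phi> \<longleftrightarrow> continuous_on UNIV \<phi>"
| "C_k (Suc n) \<phi> \<longleftrightarrow> (\<forall>x. \<phi> differentiable (at x)) \<and> (\<forall>i. C_k n (partial_deriv i \<phi>))"

definition test_function :: "(real^2) set \<Rightarrow> (real^2 \<Rightarrow> complex) \<Rightarrow> bool" where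
  "test_function \<Omega> \<phi> \<longleftrightarrow> (\<forall>n. C_k n \<phi>) \<and>
     compact (closure {x. \<phi> x \<noteq> 0}) \<and> closure {x. \<phi> x \<noteq> 0} \<subseteq> \<Omega>"

text \<open>Elements of the function spaces over \<open>\<Omega>\<close> are represented by total functions on the plane, of which
  only the values almost everywhere on \<open>\<Omega>\<close> matter.\<close>

definition L2 :: "(real^2) set \<Rightarrow> (real^2 \<Rightarrow> 'b::euclidean_space) \<Rightarrow> bool" where
  "L2 \<Omega> u \<longleftrightarrow> u \<in> borel_measurable (lebesgue_on \<Omega>) \<and>
     integrable (lebesgue_on \<Omega>) (\<lambda>x. (norm (u x))\<^sup>2)"

definition has_weak_gradient ::
  "(real^2) set \<Rightarrow> (real^2 \<Rightarrow> complex) \<Rightarrow> (real^2 \<Rightarrow> complex^2) \<Rightarrow> bool" where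
  "has_weak_gradient \<Omega> u g \<longleftrightarrow> (\<forall>\<phi> i. test_function \<Omega> \<phi> \<longrightarrow>
     (LINT x|lebesgue_on \<Omega>. u x * partial_deriv i \<phi> x)
       = - (LINT x|lebesgue_on \<Omega>. g x $ i * \<phi> x))"

definition H1 :: "(real^2) set \<Rightarrow> (real^2 \<Rightarrow> complex) \<Rightarrow> bool" where
  "H1 \<Omega> u \<longleftrightarrow> L2 \<Omega> u \<and> (\<exists>g. L2 \<Omega> g \<and> has_weak_gradient \<Omega> u g)"

text \<open>The choice is immaterial: the weak gradient is unique almost everywhere on \<open>\<Omega>\<close>.\<close>

definition weak_grad :: "(real^2) set \<Rightarrow> (real^2 \<Rightarrow> complex) \<Rightarrow> real^2 \<Rightarrow> complex^2" where
  "weak_grad \<Omega> u = (SOME g. L2 \<Omega> g \<and> has_weak_gradient \<Omega> u g)"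

definition H1_norm :: "(real^2) set \<Rightarrow> (real^2 \<Rightarrow> complex) \<Rightarrow> real" where
  "H1_norm \<Omega> u = sqrt ((LINT x|lebesgue_on \<Omega>. (norm (u x))\<^sup>2)
     + (LINT x|lebesgue_on \<Omega>. (norm (weak_grad \<Omega> u x))\<^sup>2))"

text \<open>Arc length on the boundary curves is one-dimensional Hausdorff measure.\<close>

definition hausdorff_outer :: "(real^2) set \<Rightarrow> ennreal" where
  "hausdorff_outer A = (SUP \<delta>\<in>{0<..}.
     INF U\<in>{U :: nat \<Rightarrow> (real^2) set.
              (\<forall>i. bounded (U i) \<and> diameter (U i) \<le> \<delta>) \<and> A \<subseteq> (\<Union>i. U i)}.
       (\<Sum>i. ennreal (diameter (U i))))"

definition arc_length_on :: "(real^2) set \<Rightarrow> (real^2) measure" where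
  "arc_length_on \<Gamma> = restrict_space (measure_of UNIV (sets borel) hausdorff_outer) \<Gamma>"

text \<open>The trace operator is the continuous extension to \<open>H\<^sup>1(\<Omega>)\<close> of the restriction of smooth functions
  to the boundary \<open>\<Gamma>\<close> of \<open>\<Omega>\<close>, with values in \<open>L\<^sup>2(\<Gamma>)\<close>. The boundary is a separate
  argument since the interior and the exterior of a region are used with the same \<open>\<Gamma>\<close>.\<close>

definition has_trace ::
  "(real^2) set \<Rightarrow> (real^2) set \<Rightarrow> (real^2 \<Rightarrow> complex) \<Rightarrow> (real^2 \<Rightarrow> complex) \<Rightarrow> bool" where
  "has_trace \<Gamma> \<Omega> u g \<longleftrightarrow> H1 \<Omega> u \<and> g \<in> borel_measurable (arc_length_on \<Gamma>) \<and>
     (\<exists>\<phi> :: nat \<Rightarrow> real^2 \<Rightarrow> complex.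
        (\<forall>n. test_function UNIV (\<phi> n)) \<and>
        (\<lambda>n. H1_norm \<Omega> (\<lambda>x. \<phi> n x - u x)) \<longlonglongrightarrow> 0 \<and>
        (\<lambda>n. \<integral>\<^sup>+ x. ennreal ((norm (\<phi> n x - g x))\<^sup>2) \<partial>arc_length_on \<Gamma>) \<longlonglongrightarrow> 0)"

definition X_space :: "(real^2) set \<Rightarrow> ((real^2 \<Rightarrow> complex) \<times> (real^2 \<Rightarrow> complex)) set" where
  "X_space D = {(v, w). H1 D v \<and> H1 (- closure D) w \<and>
     (\<exists>g h. has_trace (frontier D) D v g \<and> has_trace (frontier D) (- closure D) w h \<and>
        (AE x in arc_length_on (frontier D). g x + h x = 0))}"

definition has_weak_laplacian ::
  "(real^2) set \<Rightarrow> (real^2 \<Rightarrow> complex) \<Rightarrow> (real^2 \<Rightarrow> complex) \<Rightarrow> bool" where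
  "has_weak_laplacian \<Omega> u f \<longleftrightarrow> H1 \<Omega> u \<and> L2 \<Omega> f \<and> (\<forall>\<phi>. test_function \<Omega> \<phi> \<longrightarrow>
     (LINT x|lebesgue_on \<Omega>. (\<Sum>i\<in>UNIV. weak_grad \<Omega> u x $ i * partial_deriv i \<phi> x))
       = - (LINT x|lebesgue_on \<Omega>. f x * \<phi> x))"

text \<open>The derivative of \<open>u\<close> along the unit normal on \<open>\<Gamma>\<close> pointing out of \<open>\<Omega>\<close>, as the functional
  \<open>l\<close> in \<open>H\<^sup>-\<^sup>1\<^sup>/\<^sup>2(\<Gamma>)\<close> given by Green's first identity: its value at the trace of \<open>\<psi>\<close> is the integral
  of \<open>\<nabla>u \<cdot> \<nabla>\<psi> + (\<Delta>u) \<psi>\<close> over \<open>\<Omega>\<close>. Here \<open>H\<^sup>1\<^sup>/\<^sup>2(\<Gamma>)\<close> is the space of traces of \<open>H\<^sup>1(\<Omega>)\<close>; the values of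
  \<open>l\<close> outside it carry no meaning, and linearity and boundedness of \<open>l\<close> on it are automatic.\<close>

definition has_normal_derivative ::
  "(real^2) set \<Rightarrow> (real^2) set \<Rightarrow> (real^2 \<Rightarrow> complex) \<Rightarrow> ((real^2 \<Rightarrow> complex) \<Rightarrow> complex) \<Rightarrow> bool" where
  "has_normal_derivative \<Gamma> \<Omega> u l \<longleftrightarrow> (\<exists>f. has_weak_laplacian \<Omega> u f \<and>
     (\<forall>\<psi> g. has_trace \<Gamma> \<Omega> \<psi> g \<longrightarrow>
        l g = (LINT x|lebesgue_on \<Omega>. (\<Sum>i\<in>UNIV. weak_grad \<Omega> u x $ i * weak_grad \<Omega> \<psi> x $ i))
              + (LINT x|lebesgue_on \<Omega>. f x * \<psi> x)))"

text \<open>With \<open>\<nu>\<close> the unit normal pointing out of \<open>D\<close>, the functional \<open>m\<close> below is \<open>- \<partial>\<^sub>\<nu> w\<close>, as the normal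
  pointing out of the exterior is \<open>- \<nu>\<close>.\<close>

definition normal_derivs_cancel ::
  "(real^2) set \<Rightarrow> (real^2 \<Rightarrow> complex) \<Rightarrow> (real^2 \<Rightarrow> complex) \<Rightarrow> bool" where
  "normal_derivs_cancel D v w \<longleftrightarrow> (\<exists>l m.
     has_normal_derivative (frontier D) D v l \<and>
     has_normal_derivative (frontier D) (- closure D) w m \<and>
     (\<forall>\<psi> g. has_trace (frontier D) D \<psi> g \<longrightarrow> l g + (- m g) = 0))"

text \<open>A weak solution \<open>w\<close> has a smooth representative \<open>w'\<close> in the exterior, to which the pointwise
  radiation condition refers. The direction of \<open>x\<close> is \<open>sgn x\<close>.\<close>

definition radiating :: "(real^2) set \<Rightarrow> complex \<Rightarrow> (real^2 \<Rightarrow> complex) \<Rightarrow> bool" where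
  "radiating D k w \<longleftrightarrow> (\<exists>w'. (AE x in lebesgue_on (- closure D). w' x = w x) \<and>
     (\<forall>x\<in>- closure D. w' differentiable (at x)) \<and>
     (\<forall>\<epsilon>>0. \<exists>R. \<forall>x\<in>- closure D. norm x \<ge> R \<longrightarrow>
        norm (complex_of_real (sqrt (norm x))
          * (frechet_derivative w' (at x) (sgn x) - \<i> * k * w' x)) < \<epsilon>))"

definition C_plus :: "complex set" where
  "C_plus = {z. Re z > 0 \<and> Re (z\<^sup>2) > 0}"

definition transmission_eigenvalue :: "(real^2) set \<Rightarrow> complex \<Rightarrow> bool" where
  "transmission_eigenvalue D k \<longleftrightarrow> k \<in> C_plus \<and> (\<exists>v w. (v, w) \<in> X_space D \<and>
     \<not> ((AE x in lebesgue_on D. v x = 0) \<and> (AE x in lebesgue_on (- closure D). w x = 0)) \<and>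
     has_weak_laplacian D v (\<lambda>x. - k\<^sup>2 * v x) \<and>
     has_weak_laplacian (- closure D) w (\<lambda>x. k\<^sup>2 * w x) \<and>
     normal_derivs_cancel D v w \<and>
     radiating D k w)"

text \<open>Intended for open \<open>S\<close>.\<close>

definition real_analytic_on :: "(real \<Rightarrow> real) \<Rightarrow> real set \<Rightarrow> bool" where
  "real_analytic_on f S \<longleftrightarrow> (\<forall>s\<in>S. \<exists>a. \<exists>\<epsilon>>0. \<forall>t. \<bar>t - s\<bar> < \<epsilon> \<longrightarrow>
     (\<lambda>n. a n * (t - s) ^ n) sums f t)"

text \<open>Near each boundary point, in suitable orthonormal coordinates centred there, \<open>D\<close> is the
  set above the graph of an analytic function.\<close>

definition analytic_boundary :: "(real^2) set \<Rightarrow> bool" where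
  "analytic_boundary D \<longleftrightarrow> (\<forall>p\<in>frontier D. \<exists>r>0. \<exists>e n \<gamma>.
     norm e = 1 \<and> norm n = 1 \<and> e \<bullet> n = 0 \<and> real_analytic_on \<gamma> {-r<..<r} \<and>
     D \<inter> ball p r = {x \<in> ball p r. \<gamma> ((x - p) \<bullet> e) < (x - p) \<bullet> n})"

end

theory Submission imports Defs
begin

text \<open>
  Let \<open>E\<close> be the exterior of \<open>D\<close>. For two eigenmodes \<open>(v, w)\<close> and \<open>(v', w')\<close> with eigenvalues \<open>k\<close> and \<open>k'\<close>,
  Green's formula and the boundary conditions give \<open>a = k\<^sup>2 b\<close> (lemma \<open>eigenmode_Green\<close>), where \<open>a\<close> is the
  Dirichlet form \<open>\<integral>\<^sub>D \<nabla>v \<cdot> cnj \<nabla>v' + \<integral>\<^sub>E \<nabla>w \<cdot> cnj \<nabla>w'\<close> and \<open>b\<close> is the indefinite mass form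
  \<open>\<integral>\<^sub>D v cnj v' - \<integral>\<^sub>E w cnj w'\<close>. Both forms are Hermitian.

  For a single mode, \<open>a\<close> is positive and \<open>b\<close> is real, so \<open>k\<^sup>2\<close> is real, hence so is \<open>k\<close>, and \<open>b\<close> is positive
  (\<open>eigenmode_real\<close>). Modes for different eigenvalues are orthogonal with respect to both forms
  (\<open>eigenmodes_orthogonal\<close>). So for every linear combination \<open>(U, W)\<close> of modes with eigenvalues at most \<open>R\<close>,
  the gradient of \<open>U\<close> is controlled by \<open>U\<close> itself:
  \<open>\<integral>\<^sub>D \<bar>\<nabla>U\<bar>\<^sup>2 \<le> a \<le> R\<^sup>2 b \<le> R\<^sup>2 \<integral>\<^sub>D \<bar>U\<bar>\<^sup>2\<close>. On the other hand the embedding of \<open>H\<^sup>1(D)\<close> into \<open>L\<^sup>2(D)\<close> is compact: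
  there are finitely many test functions such that \<open>\<integral>\<^sub>D \<bar>U\<bar>\<^sup>2 \<le> \<epsilon> (\<integral>\<^sub>D \<bar>U\<bar>\<^sup>2 + \<integral>\<^sub>D \<bar>\<nabla>U\<bar>\<^sup>2)\<close> whenever \<open>U\<close> is orthogonal to
  all of them (\<open>compactness_inequality\<close>). If there were more modes than test functions, some nontrivial
  combination would be orthogonal to the test functions and so have \<open>U = 0\<close>, although \<open>b\<close> is positive on it.
  Thus every disc contains only finitely many eigenvalues (\<open>finitely_many_bounded_eigenvalues\<close>), which
  excludes accumulation points.

  Compactness is obtained from a single estimate: translating a function by \<open>h\<close> changes it in \<open>L\<^sup>2\<close> by at
  most \<open>\<bar>h\<bar>\<close> times the norm of its weak gradient (\<open>translation_estimate\<close>). It yields the Poincare inequality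
  on boxes, hence compactness on compact subsets of \<open>D\<close>. It also allows the part of \<open>D\<close> near the boundary to
  be pushed inward along the normals of the boundary charts, which is the one place where the regularity
  of the boundary is used. The trace operator enters only through Green's formula.
\<close>

section \<open>Smooth functions with compact support\<close>

text \<open>
  The function \<open>flat 0\<close> is the classical smooth function that vanishes on the negative half line. The powers of
  \<open>1 / t\<close> make the family closed under differentiation up to linear combinations, so all members can be
  shown to be smooth in one induction.
\<close>

definition flat :: "nat \<Rightarrow> real \<Rightarrow> real" where
  "flat m t = (if t > 0 then (1 / t) ^ m * exp (- (1 / t)) else 0)"

lemma flat_tendsto_0: "(flat m \<longlongrightarrow> 0) (at 0)"
proof -
  have "((\<lambda>t::real. (1/t)^m / exp (1/t)) \<longlongrightarrow> 0) (at_right 0)"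
    using filterlim_compose[OF tendsto_power_div_exp_0[of m] filterlim_inverse_at_top_right]
    by (simp add: inverse_eq_divide)
  then have r: "(flat m \<longlongrightarrow> 0) (at_right 0)"
    by (rule Lim_transform_eventually)
       (auto simp: flat_def exp_minus field_simps eventually_at_right_less
             intro!: eventually_at_rightI[of 0 1])
  have l: "(flat m \<longlongrightarrow> 0) (at_left 0)"
    by (rule Lim_transform_eventually[OF tendsto_const])
       (auto simp: flat_def intro!: eventually_at_leftI[of "-1"])
  show ?thesis using l r by (simp add: filterlim_split_at)
qed

text \<open>
  The critical point is \<open>t = 0\<close>: there the difference quotient of \<open>flat m\<close> is \<open>flat (Suc m)\<close>, which tends to
  \<open>0\<close> because the exponential beats every power.
\<close>

lemma flat_has_derivative:
  "(flat m has_real_derivative (flat (m + 2) t - real m * flat (m + 1) t)) (at t)"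
proof -
  consider "t > 0" | "t < 0" | "t = 0" by linarith
  then show ?thesis
  proof cases
    case 1
    have "((\<lambda>t. (1 / t) ^ m * exp (- (1 / t))) has_real_derivative
            (flat (m + 2) t - real m * flat (m + 1) t)) (at t)"
    proof -
      have "((\<lambda>t. 1 / t) has_real_derivative (- (1 / t) * (1 / t))) (at t)"
        using 1 by (auto intro!: derivative_eq_intros)
      from DERIV_mult[OF DERIV_power[OF this, of m] DERIV_chain2[where f = exp, OF DERIV_exp DERIV_minus[OF this]]]
      have "((\<lambda>t. (1 / t) ^ m * exp (- (1 / t))) has_real_derivative
         (1 / t) ^ m * (exp (- (1 / t)) * (1 / t * (1 / t)))
           + real m * (1 / t) ^ (m - 1) * (- (1 / t) * (1 / t)) * exp (- (1 / t))) (at t)"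
        by (rule DERIV_cong) (simp add: algebra_simps)
      moreover have "(1 / t) ^ m * (exp (- (1 / t)) * (1 / t * (1 / t)))
           + real m * (1 / t) ^ (m - 1) * (- (1 / t) * (1 / t)) * exp (- (1 / t))
         = flat (m + 2) t - real m * flat (m + 1) t"
        using 1 by (cases m) (simp_all add: flat_def algebra_simps add_divide_distrib del: power_one_over power_divide)
      ultimately show ?thesis by simp
    qed
    then show ?thesis
      by (rule has_field_derivative_transform_within_open[of _ _ _ "{0<..}"])
         (use 1 in \<open>auto simp: flat_def\<close>)
  next
    case 2
    have "((\<lambda>t. 0::real) has_real_derivative (flat (m + 2) t - real m * flat (m + 1) t)) (at t)"
      using 2 by (auto simp: flat_def)
    then show ?thesis
      by (rule has_field_derivative_transform_within_open[of _ _ _ "{..<0}"])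
         (use 2 in \<open>auto simp: flat_def\<close>)
  next
    case 3
    have "((\<lambda>h. (flat m (0 + h) - flat m 0) / h) \<longlongrightarrow> 0) (at 0)"
      by (rule Lim_transform_eventually[OF flat_tendsto_0[of "Suc m"]])
         (auto simp: flat_def field_simps intro!: always_eventually)
    then have "(flat m has_real_derivative 0) (at 0)" unfolding DERIV_def .
    moreover have "flat (m + 2) t - real m * flat (m + 1) t = 0" using 3 by (simp add: flat_def)
    ultimately show ?thesis using 3 by simp
  qed
qed

lemma flat_0_nonneg: "0 \<le> flat 0 t" and flat_0_le_1: "flat 0 t \<le> 1"
  by (auto simp: flat_def)

lemma differentiable_frechet:
  "\<phi> differentiable at x \<Longrightarrow> (\<phi> has_derivative frechet_derivative \<phi> (at x)) (at x)"
  by (simp add: frechet_derivative_works)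

lemma partial_deriv_eqI:
  "(\<phi> has_derivative \<phi>') (at x) \<Longrightarrow> partial_deriv i \<phi> x = \<phi>' (axis i 1)"
  unfolding partial_deriv_def by (metis frechet_derivative_at)

lemma C_k_continuous: "C_k n \<phi> \<Longrightarrow> continuous_on UNIV \<phi>"
  by (cases n) (auto intro!: continuous_at_imp_continuous_on differentiable_imp_continuous_within)

lemma C_k_mono_Suc: "C_k (Suc n) \<phi> \<Longrightarrow> C_k n \<phi>"
proof (induction n arbitrary: \<phi>)
  case 0 then show ?case using C_k_continuous[of "Suc 0"] by simp
next
  case (Suc n) then show ?case by (auto simp del: C_k.simps(2) simp: C_k.simps(2)[of "Suc n"] C_k.simps(2)[of n])
qed

lemma partial_deriv_const: "partial_deriv i (\<lambda>x. c) = (\<lambda>x. 0)"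
  by (rule ext, rule partial_deriv_eqI[THEN trans]) (auto intro!: derivative_eq_intros)

lemma C_k_const: "C_k n (\<lambda>x. c)"
  by (induction n arbitrary: c) (auto simp: partial_deriv_const)

lemma partial_deriv_add:
  assumes "\<phi> differentiable at x" "\<psi> differentiable at x"
  shows "partial_deriv i (\<lambda>x. \<phi> x + \<psi> x) x = partial_deriv i \<phi> x + partial_deriv i \<psi> x"
  by (rule partial_deriv_eqI[THEN trans])
     (auto intro!: derivative_eq_intros assms[THEN differentiable_frechet] simp: partial_deriv_def)

lemma partial_deriv_mult:
  assumes "\<phi> differentiable at x" "\<psi> differentiable at x"
  shows "partial_deriv i (\<lambda>x. \<phi> x * \<psi> x) x =
    \<phi> x * partial_deriv i \<psi> x + partial_deriv i \<phi> x * \<psi> x"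
  by (rule partial_deriv_eqI[THEN trans])
     (auto intro!: derivative_eq_intros assms[THEN differentiable_frechet] simp: partial_deriv_def)

lemma C_k_add: "C_k n \<phi> \<Longrightarrow> C_k n \<psi> \<Longrightarrow> C_k n (\<lambda>x. \<phi> x + \<psi> x)"
proof (induction n arbitrary: \<phi> \<psi>)
  case 0 then show ?case by (auto intro!: continuous_intros)
next
  case (Suc n)
  then have "partial_deriv i (\<lambda>x. \<phi> x + \<psi> x) = (\<lambda>x. partial_deriv i \<phi> x + partial_deriv i \<psi> x)" for i
    by (intro ext partial_deriv_add) auto
  with Suc show ?case by (auto intro!: derivative_intros)
qed

lemma C_k_mult: "C_k n \<phi> \<Longrightarrow> C_k n \<psi> \<Longrightarrow> C_k n (\<lambda>x. \<phi> x * \<psi> x)"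
proof (induction n arbitrary: \<phi> \<psi>)
  case 0 then show ?case by (auto intro!: continuous_intros)
next
  case (Suc n)
  then have "partial_deriv i (\<lambda>x. \<phi> x * \<psi> x) =
      (\<lambda>x. \<phi> x * partial_deriv i \<psi> x + partial_deriv i \<phi> x * \<psi> x)" for i
    by (intro ext partial_deriv_mult) auto
  with Suc C_k_mono_Suc[OF Suc.prems(1)] C_k_mono_Suc[OF Suc.prems(2)]
  show ?case by (auto intro!: derivative_intros C_k_add)
qed

lemma C_k_prod: "(\<And>j. j \<in> J \<Longrightarrow> C_k n (\<phi> j)) \<Longrightarrow> C_k n (\<lambda>x. \<Prod>j\<in>J. \<phi> j x)"
  by (induction J rule: infinite_finite_induct) (auto intro!: C_k_mult C_k_const)

lemma partial_deriv_cnj: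
  assumes "\<phi> differentiable at x"
  shows "partial_deriv i (\<lambda>x. cnj (\<phi> x)) x = cnj (partial_deriv i \<phi> x)"
  by (rule partial_deriv_eqI[THEN trans])
     (auto intro!: derivative_eq_intros assms[THEN differentiable_frechet] simp: partial_deriv_def)

lemma C_k_cnj: "C_k n \<phi> \<Longrightarrow> C_k n (\<lambda>x. cnj (\<phi> x))"
proof (induction n arbitrary: \<phi>)
  case 0 then show ?case by (auto intro!: continuous_intros)
next
  case (Suc n)
  then have "partial_deriv i (\<lambda>x. cnj (\<phi> x)) = (\<lambda>x. cnj (partial_deriv i \<phi> x))" for i
    by (intro ext partial_deriv_cnj) auto
  moreover have "(\<lambda>x. cnj (\<phi> x)) differentiable at x" for x
    using bounded_linear.has_derivative[OF bounded_linear_cnj, OF differentiable_frechet, of \<phi> x] Suc.prems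
    by (auto intro: differentiableI)
  ultimately show ?case using Suc by auto
qed

lemma translate_has_derivative:
  assumes "\<phi> differentiable at (x - a)"
  shows "((\<lambda>x. \<phi> (x - a)) has_derivative frechet_derivative \<phi> (at (x - a))) (at x)"
proof -
  have "((\<lambda>x. x - a) has_derivative (\<lambda>h. h)) (at x)" by (auto intro!: derivative_eq_intros)
  from has_derivative_compose[OF this differentiable_frechet[OF assms]] show ?thesis .
qed

lemma C_k_translate: "C_k n \<phi> \<Longrightarrow> C_k n (\<lambda>x. \<phi> (x - a))"
proof (induction n arbitrary: \<phi>)
  case 0 then show ?case
    by (auto intro!: continuous_on_compose2[of UNIV \<phi>] continuous_intros)
next
  case (Suc n)
  then have *: "partial_deriv i (\<lambda>x. \<phi> (x - a)) = (\<lambda>x. partial_deriv i \<phi> (x - a))" for i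
    by (intro ext) (simp add: partial_deriv_eqI[OF translate_has_derivative], simp add: partial_deriv_def)
  have "(\<lambda>x. \<phi> (x - a)) differentiable at x" for x
    using Suc.prems translate_has_derivative[of \<phi> x a] by (auto intro: differentiableI)
  with Suc show ?case by (auto simp: *)
qed

text \<open>
  The induction on \<open>n\<close> must range over all \<open>m\<close>, because a derivative of \<open>flat m\<close> involves \<open>flat (m + 1)\<close> and
  \<open>flat (m + 2)\<close>.
\<close>

lemma C_k_flat: "C_k n (\<lambda>x. of_real (flat m (c * x $ i + d)))"
proof (induction n arbitrary: m)
  case 0
  have "continuous_on UNIV (flat m)"
    using flat_has_derivative by (auto intro!: continuous_at_imp_continuous_on DERIV_isCont)
  then show ?case by (auto intro!: continuous_on_compose2[of UNIV "flat m"] continuous_intros)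
next
  case (Suc n)
  have D: "((\<lambda>x. complex_of_real (flat m (c * x $ i + d))) has_derivative
     (\<lambda>h. of_real ((flat (m + 2) (c * x $ i + d) - real m * flat (m + 1) (c * x $ i + d)) * (c * h $ i)))) (at x)"
    for x :: "real^2"
  proof -
    have "((\<lambda>x::real^2. c * x $ i + d) has_derivative (\<lambda>h. c * h $ i)) (at x)"
      by (auto intro!: derivative_eq_intros bounded_linear.has_derivative[OF bounded_linear_vec_nth])
    from has_derivative_compose[OF this flat_has_derivative[unfolded has_field_derivative_def]]
    have "((\<lambda>x. flat m (c * x $ i + d)) has_derivative
     (\<lambda>h. (flat (m + 2) (c * x $ i + d) - real m * flat (m + 1) (c * x $ i + d)) * (c * h $ i))) (at x)" .
    from has_derivative_compose[OF this has_derivative_of_real[OF has_derivative_ident]] show ?thesis .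
  qed
  then have "partial_deriv j (\<lambda>x. complex_of_real (flat m (c * x $ i + d))) =
     (\<lambda>x. of_real (c * axis j 1 $ i) * (of_real (flat (m + 2) (c * x $ i + d))
        + of_real (- real m) * of_real (flat (m + 1) (c * x $ i + d))))" for j
    by (intro ext) (subst partial_deriv_eqI, assumption, simp add: algebra_simps)
  moreover have "(\<lambda>x. complex_of_real (flat m (c * x $ i + d))) differentiable at x" for x :: "real^2"
    using D by (rule differentiableI)
  moreover have "C_k n (\<lambda>x. of_real (c * axis j 1 $ i) * (of_real (flat (m + 2) (c * x $ i + d))
        + of_real (- real m) * of_real (flat (m + 1) (c * x $ i + d))))" for j :: 2
    by (intro C_k_mult C_k_add C_k_const Suc)
  ultimately show ?case by simp
qed

lemma test_functionI:
  assumes "\<And>n. C_k n \<phi>" "compact S" "S \<subseteq> \<Omega>" "\<And>x. x \<notin> S \<Longrightarrow> \<phi> x = 0"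
  shows "test_function \<Omega> \<phi>"
proof -
  have "closure {x. \<phi> x \<noteq> 0} \<subseteq> S"
    using assms by (intro closure_minimal compact_imp_closed) auto
  moreover from this have "compact (closure {x. \<phi> x \<noteq> 0})"
    using compact_Int_closed[OF assms(2) closed_closure, of "{x. \<phi> x \<noteq> 0}"] by (simp add: Int_absorb1)
  ultimately show ?thesis using assms by (auto simp: test_function_def)
qed

lemma test_functionE:
  assumes "test_function \<Omega> \<phi>"
  obtains S where "compact S" "S \<subseteq> \<Omega>" "\<And>x. x \<notin> S \<Longrightarrow> \<phi> x = 0"
  using that[of "closure {x. \<phi> x \<noteq> 0}"] assms
    closure_subset[of "{x. \<phi> x \<noteq> 0}"] unfolding test_function_def by blast

lemma test_function_C_k: "test_function \<Omega> \<phi> \<Longrightarrow> C_k n \<phi>"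
  by (simp add: test_function_def)

lemma test_function_continuous: "test_function \<Omega> \<phi> \<Longrightarrow> continuous_on UNIV \<phi>"
  using C_k_continuous test_function_C_k by blast

lemma test_function_differentiable: "test_function \<Omega> \<phi> \<Longrightarrow> \<phi> differentiable at x"
  using test_function_C_k[of \<Omega> \<phi> "Suc 0"] by simp

lemma test_function_mono: "test_function A \<phi> \<Longrightarrow> A \<subseteq> B \<Longrightarrow> test_function B \<phi>"
  by (auto simp: test_function_def)

lemma test_function_zero: "test_function \<Omega> (\<lambda>x. 0)"
  by (rule test_functionI[of _ "{}"]) (auto intro: C_k_const)

lemma test_function_add:
  assumes "test_function \<Omega> \<phi>" "test_function \<Omega> \<psi>"
  shows "test_function \<Omega> (\<lambda>x. \<phi> x + \<psi> x)"
proof -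
  obtain S T where "compact S" "S \<subseteq> \<Omega>" "\<And>x. x \<notin> S \<Longrightarrow> \<phi> x = 0"
    "compact T" "T \<subseteq> \<Omega>" "\<And>x. x \<notin> T \<Longrightarrow> \<psi> x = 0"
    using assms by (metis test_functionE)
  with assms show ?thesis
    by (intro test_functionI[of _ "S \<union> T"]) (auto intro: C_k_add test_function_C_k)
qed

lemma test_function_mult:
  assumes "test_function \<Omega> \<phi>" "\<And>n. C_k n \<psi>"
  shows "test_function \<Omega> (\<lambda>x. \<psi> x * \<phi> x)"
  using assms(1)
  by (rule test_functionE)
     (auto intro!: test_functionI C_k_mult assms test_function_C_k[OF assms(1)])

lemma test_function_scale: "test_function \<Omega> \<phi> \<Longrightarrow> test_function \<Omega> (\<lambda>x. c * \<phi> x)"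
  by (intro test_function_mult C_k_const)

lemma test_function_cnj: "test_function \<Omega> \<phi> \<Longrightarrow> test_function \<Omega> (\<lambda>x. cnj (\<phi> x))"
proof (rule test_functionE[of \<Omega> \<phi>])
  fix S assume S: "compact S" "S \<subseteq> \<Omega>" "\<And>x. x \<notin> S \<Longrightarrow> \<phi> x = 0" and t: "test_function \<Omega> \<phi>"
  show ?thesis using S(3) by (intro test_functionI[OF _ S(1,2)] C_k_cnj test_function_C_k[OF t]) auto
qed

lemma test_function_translate:
  assumes "test_function K \<phi>" "\<And>x. x \<in> K \<Longrightarrow> x + a \<in> \<Omega>"
  shows "test_function \<Omega> (\<lambda>x. \<phi> (x - a))"
proof -
  obtain S where S: "compact S" "S \<subseteq> K" "\<And>x. x \<notin> S \<Longrightarrow> \<phi> x = 0"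
    using assms by (metis test_functionE)
  show ?thesis
  proof (rule test_functionI)
    show "compact ((\<lambda>x. x + a) ` S)" using S by (intro compact_continuous_image continuous_intros)
    show "(\<lambda>x. x + a) ` S \<subseteq> \<Omega>" using S assms by auto
    show "\<phi> (x - a) = 0" if "x \<notin> (\<lambda>x. x + a) ` S" for x
      using that by (intro S(3)) (metis diff_add_cancel image_eqI)
  qed (auto intro!: C_k_translate test_function_C_k[OF assms(1)])
qed

lemma test_function_partial_deriv:
  assumes "test_function \<Omega> \<phi>"
  shows "test_function \<Omega> (partial_deriv i \<phi>)"
proof (rule test_functionE[OF assms])
  fix S assume S: "compact S" "S \<subseteq> \<Omega>" "\<And>x. x \<notin> S \<Longrightarrow> \<phi> x = 0"
  show ?thesis
  proof (rule test_functionI[OF _ S(1,2)])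
    show "C_k n (partial_deriv i \<phi>)" for n
      using test_function_C_k[OF assms, of "Suc n"] by simp
    fix x assume "x \<notin> S"
    have "((\<lambda>x. 0) has_derivative (\<lambda>h. 0)) (at x)" by simp
    then have "(\<phi> has_derivative (\<lambda>h. 0)) (at x)"
      by (rule has_derivative_transform_within_open[of _ _ _ _ "- S"])
         (use S \<open>x \<notin> S\<close> in \<open>auto intro: compact_imp_closed\<close>)
    then show "partial_deriv i \<phi> x = 0" by (rule partial_deriv_eqI)
  qed
qed

text \<open>
  Subtracting \<open>1\<close> in the arguments keeps the support at distance \<open>1 / Suc j\<close> from the faces of the box,
  hence compact inside the open box; the factor \<open>Suc j\<close> makes the bumps tend to the indicator of the
  box.
\<close>

definition box_bump :: "real^2 \<Rightarrow> real^2 \<Rightarrow> nat \<Rightarrow> real^2 \<Rightarrow> real" where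
  "box_bump a b j x = (\<Prod>i\<in>UNIV. flat 0 (real (Suc j) * (x $ i - a $ i) - 1) *
                                   flat 0 (real (Suc j) * (b $ i - x $ i) - 1))"

lemma box_bump_range: "0 \<le> box_bump a b j x" "box_bump a b j x \<le> 1"
  unfolding box_bump_def
  by (auto intro!: prod_nonneg prod_le_1 mult_nonneg_nonneg mult_le_one flat_0_nonneg flat_0_le_1)

lemma box_bump_test_function: "test_function (box a b) (\<lambda>x. of_real (box_bump a b j x))"
proof (rule test_functionI)
  define d :: "real^2" where "d = (\<chi> i. 1 / real (Suc j))"
  show "compact (cbox (a + d) (b - d))" by (rule compact_cbox)
  show "cbox (a + d) (b - d) \<subseteq> box a b"
  proof
    fix x assume "x \<in> cbox (a + d) (b - d)"
    then have "a $ i + d $ i \<le> x $ i \<and> x $ i \<le> b $ i - d $ i" "d $ i > 0" for i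
      by (auto simp: mem_box_cart d_def)
    then show "x \<in> box a b" unfolding mem_box_cart by (smt (verit, best))
  qed
  show "complex_of_real (box_bump a b j x) = 0" if "x \<notin> cbox (a + d) (b - d)" for x
  proof -
    obtain i where "x $ i < a $ i + d $ i \<or> x $ i > b $ i - d $ i"
      using \<open>x \<notin> _\<close> by (auto simp: mem_box_cart not_le)
    then have "real (Suc j) * (x $ i - a $ i) - 1 \<le> 0 \<or> real (Suc j) * (b $ i - x $ i) - 1 \<le> 0"
      by (auto simp: d_def field_simps)
    then show ?thesis unfolding box_bump_def
      by (auto simp: flat_def intro!: exI[of _ i])
  qed
  fix n
  have eq: "complex_of_real (box_bump a b j x) =
     (\<Prod>i\<in>UNIV. of_real (flat 0 (real (Suc j) * x $ i + (- real (Suc j) * a $ i - 1))) *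
                of_real (flat 0 (- real (Suc j) * x $ i + (real (Suc j) * b $ i - 1))))" for x
    unfolding box_bump_def of_real_prod of_real_mult
    by (intro prod.cong refl arg_cong2[where f="(*)"] arg_cong[where f=of_real] arg_cong[where f="flat 0"])
       (auto simp: algebra_simps)
  show "C_k n (\<lambda>x. complex_of_real (box_bump a b j x))"
    unfolding eq by (intro C_k_prod C_k_mult C_k_flat)
qed

lemma flat_0_tendsto_indicator:
  "(\<lambda>j. flat 0 (real (Suc j) * t - 1)) \<longlonglongrightarrow> indicator {0<..} t"
proof (cases "t > 0")
  case True
  have top: "filterlim (\<lambda>j. real (Suc j) * t - 1) at_top sequentially"
  proof -
    have "filterlim (\<lambda>j. real (Suc j)) at_top sequentially"
      by (rule filterlim_compose[OF filterlim_real_sequentially filterlim_Suc])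
    from filterlim_tendsto_pos_mult_at_top[OF tendsto_const[of t] True this]
    have "filterlim (\<lambda>j. - 1 + t * real (Suc j)) at_top sequentially"
      by (rule filterlim_tendsto_add_at_top[OF tendsto_const])
    then show ?thesis by (simp add: algebra_simps)
  qed
  have "(\<lambda>j. exp (- (1 / (real (Suc j) * t - 1)))) \<longlonglongrightarrow> exp (- 0)"
    by (intro tendsto_intros tendsto_divide_0[OF tendsto_const]
          filterlim_at_top_imp_at_infinity top)
  moreover have "eventually (\<lambda>j. real (Suc j) * t - 1 > 0) sequentially"
    using top unfolding filterlim_at_top_dense by blast
  then have "eventually (\<lambda>j. exp (- (1 / (real (Suc j) * t - 1))) = flat 0 (real (Suc j) * t - 1)) sequentially"
    by eventually_elim (simp add: flat_def)
  ultimately show ?thesis using True by (auto intro: Lim_transform_eventually)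
next
  case False
  then have "flat 0 (real (Suc j) * t - 1) = 0" for j
    using mult_nonneg_nonpos[of "real (Suc j)" t] by (simp add: flat_def)
  then show ?thesis using False by simp
qed

lemma box_bump_tendsto: "(\<lambda>j. box_bump a b j x) \<longlonglongrightarrow> indicator (box a b) x"
proof -
  have "(\<lambda>j. box_bump a b j x) \<longlonglongrightarrow>
    (\<Prod>i\<in>UNIV. indicator {0<..} (x $ i - a $ i) * indicator {0<..} (b $ i - x $ i))"
    unfolding box_bump_def by (intro tendsto_prod tendsto_mult flat_0_tendsto_indicator)
  also have "(\<Prod>i\<in>UNIV. indicator {0<..} (x $ i - a $ i) * indicator {0<..} (b $ i - x $ i))
     = (indicator (box a b) x :: real)"
    by (cases "x \<in> box a b") (auto simp: mem_box_cart indicator_def)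
  finally show ?thesis .
qed

text \<open>
  An open set is a countable union of boxes \<open>B\<^sub>n\<close>. The function \<open>1 - \<Prod>n<j. (1 - b\<^sub>n)\<close>, where \<open>b\<^sub>n\<close> is the \<open>j\<close>-th bump
  of \<open>B\<^sub>n\<close>, is smooth, is supported in the first \<open>j\<close> boxes, and dominates each \<open>b\<^sub>n\<close> with \<open>n < j\<close>; so it tends
  to the indicator of the union without any need to make the boxes disjoint.
\<close>

lemma open_indicator_test_functions:
  assumes "open U"
  obtains \<phi> where "\<And>j::nat. test_function U (\<lambda>x. of_real (\<phi> j x))" "\<And>j x. 0 \<le> \<phi> j x"
    "\<And>j x. \<phi> j x \<le> 1" "\<And>x. (\<lambda>j. \<phi> j x) \<longlonglongrightarrow> indicator U x"
proof -
  obtain \<D> where D: "countable \<D>" "\<D> \<subseteq> Pow U" "\<And>X. X \<in> \<D> \<Longrightarrow> \<exists>a b. X = box a b" "\<Union>\<D> = U"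
    using open_countable_Union_open_box[OF assms] by metis
  have "\<exists>a b. from_nat_into (insert {} \<D>) n = box a b" for n
  proof -
    have "from_nat_into (insert {} \<D>) n \<in> insert {} \<D>" by (rule from_nat_into) simp
    moreover have "\<exists>a b. {} = (box a b :: (real^2) set)" by (rule exI[of _ 0], rule exI[of _ 0]) simp
    ultimately show ?thesis using D(3) by (metis insert_iff)
  qed
  then obtain a b where ab: "\<And>n. from_nat_into (insert {} \<D>) n = box (a n) (b n)" by metis
  have rng: "range (from_nat_into (insert {} \<D>)) = insert {} \<D>"
    using D(1) by (intro range_from_nat_into) auto
  then have U: "(\<Union>n. box (a n) (b n)) = U" unfolding ab[symmetric] using D(4) by auto
  define \<phi> where "\<phi> j x = 1 - (\<Prod>n<j. 1 - box_bump (a n) (b n) j x)" for j x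
  show ?thesis
  proof
    fix j
    have "test_function U (\<lambda>x. of_real (1 - (\<Prod>n<N. 1 - box_bump (a n) (b n) j x)))" for N
    proof (induction N)
      case 0 then show ?case by (simp add: test_function_zero)
    next
      case (Suc N)
      have bump: "test_function U (\<lambda>x. of_real (box_bump (a N) (b N) j x))"
        using U by (intro test_function_mono[OF box_bump_test_function]) auto
      have "\<And>n. C_k n (\<lambda>x. complex_of_real (1 - (\<Prod>n<N. 1 - box_bump (a n) (b n) j x)))"
        using test_function_C_k Suc by blast
      from C_k_add[OF C_k_const[of _ 1] C_k_mult[OF C_k_const[of _ "-1"] this]]
      have "test_function U (\<lambda>x. (1 + (- 1) * complex_of_real (1 - (\<Prod>n<N. 1 - box_bump (a n) (b n) j x)))
             * of_real (box_bump (a N) (b N) j x))"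
        by (intro test_function_mult bump)
      from test_function_add[OF Suc this] show ?case
        by (simp add: algebra_simps)
    qed
    then show "test_function U (\<lambda>x. of_real (\<phi> j x))" unfolding \<phi>_def .
    show "0 \<le> \<phi> j x" for x unfolding \<phi>_def
      using prod_le_1[of "{..<j}" "\<lambda>n. 1 - box_bump (a n) (b n) j x"] box_bump_range by simp
    show "\<phi> j x \<le> 1" for x unfolding \<phi>_def
      using box_bump_range by (simp add: prod_nonneg)
  next
    fix x
    show "(\<lambda>j. \<phi> j x) \<longlonglongrightarrow> indicator U x"
    proof (cases "x \<in> U")
      case True
      then obtain N where N: "x \<in> box (a N) (b N)" using U by auto
      have lim: "(\<lambda>j. box_bump (a N) (b N) j x) \<longlonglongrightarrow> 1"
        using box_bump_tendsto[of "a N" "b N" x] N by simp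
      have low: "box_bump (a N) (b N) j x \<le> \<phi> j x" if "j > N" for j
      proof -
        have "(\<Prod>n<j. 1 - box_bump (a n) (b n) j x) =
           (1 - box_bump (a N) (b N) j x) * (\<Prod>n\<in>{..<j} - {N}. 1 - box_bump (a n) (b n) j x)"
          using that by (subst prod.remove[of _ N]) auto
        also have "\<dots> \<le> (1 - box_bump (a N) (b N) j x) * 1"
          using box_bump_range by (intro mult_left_mono prod_le_1) auto
        finally show ?thesis by (simp add: \<phi>_def)
      qed
      have up: "\<phi> j x \<le> 1" for j unfolding \<phi>_def using box_bump_range by (simp add: prod_nonneg)
      have "(\<lambda>j. \<phi> j x) \<longlonglongrightarrow> 1"
      proof (rule tendsto_sandwich[OF _ _ lim tendsto_const])
        show "eventually (\<lambda>j. box_bump (a N) (b N) j x \<le> \<phi> j x) sequentially"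
          using eventually_gt_at_top[of N] by (rule eventually_mono) (rule low)
        show "eventually (\<lambda>j. \<phi> j x \<le> 1) sequentially" using up by simp
      qed
      then show ?thesis using True by simp
    next
      case False
      have "box_bump (a n) (b n) j x = 0" for n j
      proof -
        have "x \<notin> box (a n) (b n)" using False U by auto
        moreover obtain S where "S \<subseteq> box (a n) (b n)" "\<And>x. x \<notin> S \<Longrightarrow> complex_of_real (box_bump (a n) (b n) j x) = 0"
          using box_bump_test_function by (metis test_functionE)
        ultimately show ?thesis by auto
      qed
      then show ?thesis using False by (simp add: \<phi>_def)
    qed
  qed
qed

section \<open>Density of test functions in square integrable functions\<close>

definition sq_integrable :: "'a measure \<Rightarrow> ('a \<Rightarrow> 'b::euclidean_space) \<Rightarrow> bool" where
  "sq_integrable M f \<longleftrightarrow> f \<in> borel_measurable M \<and> integrable M (\<lambda>x. (norm (f x))\<^sup>2)"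

abbreviation sq_int :: "(real^2 \<Rightarrow> 'b::euclidean_space) \<Rightarrow> bool" where
  "sq_int \<equiv> sq_integrable lborel"

abbreviation sq_norm :: "'a measure \<Rightarrow> ('a \<Rightarrow> 'b::euclidean_space) \<Rightarrow> real" where
  "sq_norm M f \<equiv> (LINT x|M. (norm (f x))\<^sup>2)"

abbreviation sq_norm_on :: "(real^2) set \<Rightarrow> (real^2 \<Rightarrow> 'b::euclidean_space) \<Rightarrow> real" where
  "sq_norm_on A f \<equiv> (LINT x|lborel. indicator A x * (norm (f x))\<^sup>2)"

lemma sq_int_iff: "sq_int f \<longleftrightarrow> f \<in> borel_measurable borel \<and> integrable lborel (\<lambda>x. (norm (f x))\<^sup>2)"
  by (simp add: sq_integrable_def)

lemma sq_int_measurable [measurable_dest]: "sq_int f \<Longrightarrow> f \<in> borel_measurable borel"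
  by (simp add: sq_int_iff)

lemma sq_integrable_norm_sq: "sq_integrable M f \<Longrightarrow> integrable M (\<lambda>x. (norm (f x))\<^sup>2)"
  by (simp add: sq_integrable_def)

lemma norm_add_sq_le: "(norm (a + b :: 'a::real_normed_vector))\<^sup>2 \<le> 2 * (norm a)\<^sup>2 + 2 * (norm b)\<^sup>2"
proof -
  have "(norm (a + b))\<^sup>2 \<le> (norm a + norm b)\<^sup>2"
    by (intro power_mono norm_triangle_ineq norm_ge_zero)
  also have "\<dots> \<le> 2 * (norm a)\<^sup>2 + 2 * (norm b)\<^sup>2"
    using sum_squares_bound[of "norm a" "norm b"] by (simp add: power2_eq_square algebra_simps)
  finally show ?thesis .
qed

lemma sq_integrable_bound:
  assumes "f \<in> borel_measurable M" "integrable M h" "\<And>x. (norm (f x))\<^sup>2 \<le> h x"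
  shows "sq_integrable M f"
  unfolding sq_integrable_def
  by (intro conjI assms(1) Bochner_Integration.integrable_bound[OF assms(2)])
     (use assms in \<open>auto intro: order_trans[OF assms(3) abs_ge_self]\<close>)

lemma sq_integrable_add:
  "sq_integrable M f \<Longrightarrow> sq_integrable M g \<Longrightarrow> sq_integrable M (\<lambda>x. f x + g x)"
  by (rule sq_integrable_bound[where h = "\<lambda>x. 2 * (norm (f x))\<^sup>2 + 2 * (norm (g x))\<^sup>2"])
     (auto simp: sq_integrable_def norm_add_sq_le)

lemma sq_integrable_uminus: "sq_integrable M f \<Longrightarrow> sq_integrable M (\<lambda>x. - f x)"
  by (auto simp: sq_integrable_def)

lemma sq_integrable_diff:
  "sq_integrable M f \<Longrightarrow> sq_integrable M g \<Longrightarrow> sq_integrable M (\<lambda>x. f x - g x)"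
  using sq_integrable_add[of M f "\<lambda>x. - g x"] sq_integrable_uminus[of M g] by simp

lemma sq_integrable_scale:
  fixes f :: "'a \<Rightarrow> complex"
  shows "sq_integrable M f \<Longrightarrow> sq_integrable M (\<lambda>x. c * f x)"
  by (auto simp: sq_integrable_def norm_mult power_mult_distrib)

lemma sq_integrable_sum:
  "(\<And>j. j \<in> J \<Longrightarrow> sq_integrable M (f j)) \<Longrightarrow> sq_integrable M (\<lambda>x. \<Sum>j\<in>J. f j x)"
proof (induction J rule: infinite_finite_induct)
  case (insert j J)
  then show ?case by (simp add: sq_integrable_add)
qed (auto simp: sq_integrable_def)

lemma sq_integrable_cnj: "sq_integrable M f \<Longrightarrow> sq_integrable M (\<lambda>x. cnj (f x))"
  by (auto simp: sq_integrable_def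
      intro: measurable_compose[OF _ borel_measurable_continuous_onI[OF continuous_on_cnj[OF continuous_on_id]]])

lemma borel_measurable_vec_nth [measurable]: "(\<lambda>z :: complex^2. z $ i) \<in> borel_measurable borel"
  by (intro borel_measurable_continuous_onI linear_continuous_on bounded_linear_vec_nth)

lemma sq_integrable_component:
  fixes g :: "'a \<Rightarrow> complex^2"
  shows "sq_integrable M g \<Longrightarrow> sq_integrable M (\<lambda>x. g x $ i)"
  by (rule sq_integrable_bound[where h = "\<lambda>x. (norm (g x))\<^sup>2"])
     (auto simp: sq_integrable_def intro!: power_mono Finite_Cartesian_Product.norm_nth_le
        measurable_compose[OF _ borel_measurable_vec_nth])

lemma sq_integrable_mult:
  fixes f g :: "'a \<Rightarrow> complex"
  assumes "sq_integrable M f" "sq_integrable M g"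
  shows "integrable M (\<lambda>x. f x * g x)"
proof (rule Bochner_Integration.integrable_bound)
  show "integrable M (\<lambda>x. (norm (f x))\<^sup>2 + (norm (g x))\<^sup>2)"
    using assms by (auto simp: sq_integrable_def)
  show "(\<lambda>x. f x * g x) \<in> borel_measurable M" using assms by (auto simp: sq_integrable_def)
  have "norm (f x) * norm (g x) \<le> (norm (f x))\<^sup>2 + (norm (g x))\<^sup>2" for x
    using sum_squares_bound[of "norm (f x)" "norm (g x)"]
      mult_nonneg_nonneg[OF norm_ge_zero[of "f x"] norm_ge_zero[of "g x"]] by linarith
  then show "AE x in M. norm (f x * g x) \<le> norm ((norm (f x))\<^sup>2 + (norm (g x))\<^sup>2)"
    by (simp add: norm_mult)
qed

lemma sq_int_bound:
  assumes "f \<in> borel_measurable borel" "integrable lborel h" "\<And>x. (norm (f x))\<^sup>2 \<le> h x"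
  shows "sq_int f"
  using assms by (intro sq_integrable_bound[of f lborel h]) auto

lemma test_function_measurable: "test_function K \<phi> \<Longrightarrow> \<phi> \<in> borel_measurable borel"
  by (intro borel_measurable_continuous_onI test_function_continuous)

lemma test_function_bounded:
  assumes "test_function \<Omega> \<phi>"
  obtains B where "B \<ge> 0" "\<And>x. norm (\<phi> x) \<le> B"
proof (rule test_functionE[OF assms])
  fix S assume S: "compact S" "\<And>x. x \<notin> S \<Longrightarrow> \<phi> x = 0"
  have "bounded (\<phi> ` S)" using S test_function_continuous[OF assms]
    by (intro compact_imp_bounded compact_continuous_image) (auto intro: continuous_on_subset)
  then obtain B where B: "B > 0" "\<And>x. x \<in> S \<Longrightarrow> norm (\<phi> x) \<le> B" by (auto simp: bounded_pos)
  then have "norm (\<phi> x) \<le> B" for x using S(2)[of x] by (cases "x \<in> S") auto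
  with B that show ?thesis by (meson less_imp_le)
qed

lemma test_function_sq_int:
  assumes "test_function \<Omega> \<phi>"
  shows "sq_int \<phi>"
proof -
  obtain S where S: "compact S" "\<And>x. x \<notin> S \<Longrightarrow> \<phi> x = 0" using assms by (metis test_functionE)
  obtain B where B: "\<And>x. norm (\<phi> x) \<le> B" using test_function_bounded[OF assms] by metis
  show ?thesis
  proof (rule sq_int_bound[OF test_function_measurable[OF assms]])
    show "integrable lborel (\<lambda>x. indicator S x * B\<^sup>2)"
      using compact_imp_closed[OF S(1)] emeasure_compact_finite[OF S(1)]
      by (intro integrable_mult_left) (auto simp: integrable_indicator_iff)
    show "(norm (\<phi> x))\<^sup>2 \<le> indicator S x * B\<^sup>2" for x
      using B[of x] S(2)[of x] by (cases "x \<in> S") (auto intro: power_mono)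
  qed
qed

abbreviation sq_dist :: "(real^2 \<Rightarrow> complex) \<Rightarrow> (real^2 \<Rightarrow> complex) \<Rightarrow> ennreal" where
  "sq_dist f g \<equiv> (\<integral>\<^sup>+x. ennreal ((norm (f x - g x))\<^sup>2) \<partial>lborel)"

lemma sq_dist_triangle:
  assumes [measurable]: "f \<in> borel_measurable borel" "g \<in> borel_measurable borel" "h \<in> borel_measurable borel"
  shows "sq_dist f h \<le> 2 * sq_dist f g + 2 * sq_dist g h"
proof -
  have "sq_dist f h \<le> (\<integral>\<^sup>+x. 2 * ennreal ((norm (f x - g x))\<^sup>2) + 2 * ennreal ((norm (g x - h x))\<^sup>2) \<partial>lborel)"
  proof (rule nn_integral_mono)
    fix x
    have "(norm (f x - h x))\<^sup>2 \<le> 2 * (norm (f x - g x))\<^sup>2 + 2 * (norm (g x - h x))\<^sup>2"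
      using norm_add_sq_le[of "f x - g x" "g x - h x"] by simp
    then have "ennreal ((norm (f x - h x))\<^sup>2) \<le> ennreal (2 * (norm (f x - g x))\<^sup>2 + 2 * (norm (g x - h x))\<^sup>2)"
      by (rule ennreal_leI)
    then show "ennreal ((norm (f x - h x))\<^sup>2) \<le> 2 * ennreal ((norm (f x - g x))\<^sup>2) + 2 * ennreal ((norm (g x - h x))\<^sup>2)"
      by (simp add: ennreal_mult)
  qed
  also have "\<dots> = 2 * sq_dist f g + 2 * sq_dist g h"
    by (simp add: nn_integral_add nn_integral_cmult)
  finally show ?thesis .
qed

text \<open>
  Membership in the closure of the test functions. The distance is a nonnegative integral, which
  spares all integrability conditions in the closure properties below.
\<close>

definition approximable :: "(real^2) set \<Rightarrow> (real^2 \<Rightarrow> complex) \<Rightarrow> bool" where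
  "approximable K f \<longleftrightarrow> f \<in> borel_measurable borel \<and>
     (\<forall>\<epsilon>>0. \<exists>\<phi>. test_function K \<phi> \<and> sq_dist \<phi> f < ennreal \<epsilon>)"

lemma add_twice_less_ennreal:
  assumes "a < ennreal (\<epsilon> / 4)" "b < ennreal (\<epsilon> / 4)" "\<epsilon> > 0"
  shows "2 * a + 2 * b < ennreal \<epsilon>"
proof -
  have "2 * a + 2 * b < 2 * ennreal (\<epsilon> / 4) + 2 * ennreal (\<epsilon> / 4)"
    using assms(1,2) by (intro add_strict_mono ennreal_mult_strict_left_mono) auto
  also have "\<dots> = ennreal 2 * ennreal (\<epsilon> / 4) + ennreal 2 * ennreal (\<epsilon> / 4)" by simp
  also have "\<dots> = ennreal \<epsilon>"
    using assms(3) by (simp only: ennreal_mult[symmetric] ennreal_plus[symmetric]) simp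
  finally show ?thesis .
qed

lemma approximable_closed:
  assumes [measurable]: "f \<in> borel_measurable borel"
    and "\<And>\<epsilon>. \<epsilon> > 0 \<Longrightarrow> \<exists>g. approximable K g \<and> sq_dist g f < ennreal \<epsilon>"
  shows "approximable K f"
  unfolding approximable_def
proof (intro conjI allI impI assms(1))
  fix \<epsilon> :: real assume e: "\<epsilon> > 0"
  obtain g where g: "approximable K g" "sq_dist g f < ennreal (\<epsilon> / 4)" using assms(2)[of "\<epsilon> / 4"] e by auto
  then have [measurable]: "g \<in> borel_measurable borel" by (simp add: approximable_def)
  obtain \<phi> where \<phi>: "test_function K \<phi>" "sq_dist \<phi> g < ennreal (\<epsilon> / 4)"
    using g(1) e unfolding approximable_def by (meson divide_pos_pos zero_less_numeral)
  have [measurable]: "\<phi> \<in> borel_measurable borel" by (rule test_function_measurable) fact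
  have "sq_dist \<phi> f \<le> 2 * sq_dist \<phi> g + 2 * sq_dist g f" by (rule sq_dist_triangle) measurable
  also have "\<dots> < ennreal \<epsilon>" by (rule add_twice_less_ennreal) fact+
  finally show "\<exists>\<phi>. test_function K \<phi> \<and> sq_dist \<phi> f < ennreal \<epsilon>" using \<phi>(1) by blast
qed

lemma approximable_add:
  assumes f: "approximable K f" and g: "approximable K g"
  shows "approximable K (\<lambda>x. f x + g x)"
  unfolding approximable_def
proof (intro conjI allI impI)
  have [measurable]: "f \<in> borel_measurable borel" "g \<in> borel_measurable borel"
    using assms by (auto simp: approximable_def)
  show "(\<lambda>x. f x + g x) \<in> borel_measurable borel" by measurable
  fix \<epsilon> :: real assume e: "\<epsilon> > 0"
  then obtain \<phi> \<psi> where p: "test_function K \<phi>" "sq_dist \<phi> f < ennreal (\<epsilon> / 4)"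
      "test_function K \<psi>" "sq_dist \<psi> g < ennreal (\<epsilon> / 4)"
    using f g unfolding approximable_def by (meson divide_pos_pos zero_less_numeral)
  note [measurable] = test_function_measurable[OF p(1)] test_function_measurable[OF p(3)]
  have "sq_dist (\<lambda>x. \<phi> x + \<psi> x) (\<lambda>x. f x + g x)
    \<le> 2 * sq_dist (\<lambda>x. \<phi> x + \<psi> x) (\<lambda>x. f x + \<psi> x) + 2 * sq_dist (\<lambda>x. f x + \<psi> x) (\<lambda>x. f x + g x)"
    by (rule sq_dist_triangle) measurable
  also have "\<dots> = 2 * sq_dist \<phi> f + 2 * sq_dist \<psi> g" by simp
  also have "\<dots> < ennreal \<epsilon>" by (rule add_twice_less_ennreal) (intro p e)+
  finally show "\<exists>\<phi>. test_function K \<phi> \<and> sq_dist \<phi> (\<lambda>x. f x + g x) < ennreal \<epsilon>"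
    using test_function_add[OF p(1,3)] by blast
qed

lemma approximable_zero: "approximable K (\<lambda>x. 0)"
  unfolding approximable_def by (auto intro!: exI[of _ "\<lambda>x. 0"] test_function_zero)

lemma approximable_scale:
  assumes f: "approximable K f"
  shows "approximable K (\<lambda>x. c * f x)"
proof (cases "c = 0")
  case True then show ?thesis by (simp add: approximable_zero)
next
  case False
  have [measurable]: "f \<in> borel_measurable borel" using assms by (auto simp: approximable_def)
  show ?thesis unfolding approximable_def
  proof (intro conjI allI impI)
    show "(\<lambda>x. c * f x) \<in> borel_measurable borel" by measurable
    fix \<epsilon> :: real assume e: "\<epsilon> > 0"
    then obtain \<phi> where p: "test_function K \<phi>" "sq_dist \<phi> f < ennreal (\<epsilon> / (norm c)\<^sup>2)"
      using f False unfolding approximable_def by (meson divide_pos_pos zero_less_norm_iff zero_less_power)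
    note [measurable] = test_function_measurable[OF p(1)]
    have "sq_dist (\<lambda>x. c * \<phi> x) (\<lambda>x. c * f x) = (\<integral>\<^sup>+x. ennreal ((norm c)\<^sup>2) * ennreal ((norm (\<phi> x - f x))\<^sup>2) \<partial>lborel)"
      by (simp add: right_diff_distrib[symmetric] norm_mult power_mult_distrib ennreal_mult)
    also have "\<dots> = ennreal ((norm c)\<^sup>2) * sq_dist \<phi> f" by (rule nn_integral_cmult) measurable
    also have "\<dots> < ennreal ((norm c)\<^sup>2) * ennreal (\<epsilon> / (norm c)\<^sup>2)"
      using False p by (intro ennreal_mult_strict_left_mono) auto
    also have "\<dots> = ennreal \<epsilon>" using False e by (simp add: ennreal_mult[symmetric])
    finally show "\<exists>\<phi>. test_function K \<phi> \<and> sq_dist \<phi> (\<lambda>x. c * f x) < ennreal \<epsilon>"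
      using test_function_scale[OF p(1)] by blast
  qed
qed

lemma approximable_sum:
  "(\<And>j. j \<in> J \<Longrightarrow> approximable K (f j)) \<Longrightarrow> approximable K (\<lambda>x. \<Sum>j\<in>J. f j x)"
  by (induction J rule: infinite_finite_induct) (auto intro!: approximable_add approximable_zero)

lemma ennreal_tendsto_0_less:
  assumes "(X :: nat \<Rightarrow> ennreal) \<longlonglongrightarrow> 0" "\<epsilon> > 0"
  shows "\<exists>n. X n < ennreal \<epsilon>"
  using order_tendstoD(2)[OF assms(1), of "ennreal \<epsilon>"] assms(2)
  by (auto simp: eventually_sequentially)

text \<open>
  Dominated convergence, with the indicator of \<open>U\<close> as majorant: the approximating test functions vanish
  outside \<open>U\<close> and take values in \<open>[0, 1]\<close>.
\<close>

lemma approximable_indicator_open: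
  assumes U: "open U" "U \<subseteq> K" and fin: "emeasure lborel U < \<infinity>"
  shows "approximable K (indicator U)"
proof -
  obtain \<phi> where \<phi>: "\<And>j::nat. test_function U (\<lambda>x. of_real (\<phi> j x))" "\<And>j x. 0 \<le> \<phi> j x"
    "\<And>j x. \<phi> j x \<le> 1" "\<And>x. (\<lambda>j. \<phi> j x) \<longlonglongrightarrow> indicator U x"
    using open_indicator_test_functions[OF U(1)] by metis
  have [measurable]: "U \<in> sets borel" using U by simp
  have [measurable]: "(\<lambda>x. complex_of_real (\<phi> j x)) \<in> borel_measurable borel" for j
    by (rule test_function_measurable[OF \<phi>(1)])
  have out: "\<phi> j x = 0" if "x \<notin> U" for j x
    using \<phi>(1)[of j] that by (metis test_functionE of_real_eq_0_iff subset_iff)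
  have "(\<lambda>j. sq_dist (\<lambda>x. of_real (\<phi> j x)) (indicator U)) \<longlonglongrightarrow> (\<integral>\<^sup>+x. 0 \<partial>(lborel :: (real^2) measure))"
  proof (rule nn_integral_dominated_convergence)
    show "AE x in lborel. ennreal ((cmod (complex_of_real (\<phi> j x) - indicator U x))\<^sup>2) \<le> indicator U x" for j
    proof (rule AE_I2)
      fix x
      show "ennreal ((cmod (complex_of_real (\<phi> j x) - indicator U x))\<^sup>2) \<le> indicator U x"
      proof (cases "x \<in> U")
        case True
        have "complex_of_real (\<phi> j x) - indicator U x = of_real (\<phi> j x - 1)" using True by simp
        then have "(cmod (complex_of_real (\<phi> j x) - indicator U x))\<^sup>2 = \<bar>\<phi> j x - 1\<bar>\<^sup>2"
          by (simp only: norm_of_real)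
        also have "\<dots> \<le> 1\<^sup>2" using \<phi>(2)[of j x] \<phi>(3)[of j x] by (intro power_mono) auto
        finally have "ennreal ((cmod (complex_of_real (\<phi> j x) - indicator U x))\<^sup>2) \<le> ennreal 1"
          by (intro ennreal_leI) simp
        then show ?thesis using True by simp
      qed (simp add: out)
    qed
    show "AE x in lborel. (\<lambda>j. ennreal ((cmod (complex_of_real (\<phi> j x) - indicator U x))\<^sup>2)) \<longlonglongrightarrow> 0"
    proof (rule AE_I2)
      fix x
      have "(\<lambda>j. complex_of_real (\<phi> j x)) \<longlonglongrightarrow> of_real (indicator U x)" by (rule tendsto_of_real[OF \<phi>(4)])
      then have "(\<lambda>j. (cmod (complex_of_real (\<phi> j x) - indicator U x))\<^sup>2) \<longlonglongrightarrow> (cmod (of_real (indicator U x) - indicator U x))\<^sup>2"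
        by (intro tendsto_power tendsto_norm tendsto_diff tendsto_const)
      then have "(\<lambda>j. (cmod (complex_of_real (\<phi> j x) - indicator U x))\<^sup>2) \<longlonglongrightarrow> 0"
        by (simp only: of_real_indicator diff_self norm_zero power_zero_numeral)
      from tendsto_ennrealI[OF this]
      show "(\<lambda>j. ennreal ((cmod (complex_of_real (\<phi> j x) - indicator U x))\<^sup>2)) \<longlonglongrightarrow> 0" by simp
    qed
  qed (use fin in \<open>auto\<close>)
  then have lim: "(\<lambda>j. sq_dist (\<lambda>x. of_real (\<phi> j x)) (indicator U)) \<longlonglongrightarrow> 0" by simp
  show ?thesis unfolding approximable_def
  proof (intro conjI allI impI)
    show "(indicator U :: real^2 \<Rightarrow> complex) \<in> borel_measurable borel" by measurable
    fix \<epsilon> :: real assume "\<epsilon> > 0"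
    then obtain j where "sq_dist (\<lambda>x. of_real (\<phi> j x)) (indicator U) < ennreal \<epsilon>"
      using ennreal_tendsto_0_less[OF lim] by auto
    then show "\<exists>\<psi>. test_function K \<psi> \<and> sq_dist \<psi> (indicator U) < ennreal \<epsilon>"
      using test_function_mono[OF \<phi>(1)[of j] U(2)] by blast
  qed
qed

text \<open>
  Outer regularity of Lebesgue measure reduces Borel sets to open sets.
\<close>

lemma approximable_indicator:
  assumes K: "open K" and E: "E \<in> sets borel" "E \<subseteq> K" and fin: "emeasure lborel E < \<infinity>"
  shows "approximable K (indicator E)"
proof (rule approximable_closed)
  note [measurable] = E(1)
  show "(indicator E :: real^2 \<Rightarrow> complex) \<in> borel_measurable borel" by measurable
  fix \<epsilon> :: real assume e: "\<epsilon> > 0"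
  obtain U where U: "open U" "E \<subseteq> U" "emeasure lborel (U - E) < \<epsilon>"
    using outer_regular_lborel[OF E(1) e] by metis
  have [measurable]: "U \<inter> K \<in> sets borel" using U K by auto
  have le: "emeasure lborel (U \<inter> K - E) \<le> emeasure lborel (U - E)"
    using U K E by (intro emeasure_mono) auto
  have "emeasure lborel (U \<inter> K) \<le> emeasure lborel E + emeasure lborel (U \<inter> K - E)"
  proof -
    have "emeasure lborel (U \<inter> K) \<le> emeasure lborel (E \<union> (U \<inter> K - E))" by (intro emeasure_mono) auto
    also have "\<dots> \<le> emeasure lborel E + emeasure lborel (U \<inter> K - E)" by (intro emeasure_subadditive) auto
    finally show ?thesis .
  qed
  also have "\<dots> < \<infinity>" using fin le U(3) by (auto simp: less_top[symmetric] top_unique)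
  finally have "approximable K (indicator (U \<inter> K))"
    using U K by (intro approximable_indicator_open) auto
  moreover have "sq_dist (indicator (U \<inter> K)) (indicator E) = (\<integral>\<^sup>+x. indicator (U \<inter> K - E) x \<partial>lborel)"
    using U(2) E(2) by (intro nn_integral_cong) (auto simp: indicator_def)
  then have "sq_dist (indicator (U \<inter> K)) (indicator E) < ennreal \<epsilon>"
    using le U(3) by simp
  ultimately show "\<exists>g. approximable K g \<and> sq_dist g (indicator E) < ennreal \<epsilon>" by blast
qed

lemma approximable_simple:
  assumes K: "open K" and s: "simple_function lborel (s :: real^2 \<Rightarrow> complex)"
    and out: "\<And>x. x \<notin> K \<Longrightarrow> s x = 0" and fin: "(\<integral>\<^sup>+x. ennreal ((norm (s x))\<^sup>2) \<partial>lborel) < \<infinity>"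
  shows "approximable K s"
proof -
  have "finite (range s)" using s by (simp add: simple_function_def)
  have meas: "s -` {y} \<in> sets borel" for y
    using simple_functionD(2)[OF s, of "{y}"] by simp
  have "approximable K (\<lambda>x. y * indicator (s -` {y}) x)" for y
  proof (cases "y = 0")
    case True then show ?thesis by (simp add: approximable_zero)
  next
    case False
    note [measurable] = meas[of y]
    have "ennreal ((norm y)\<^sup>2) * emeasure lborel (s -` {y}) = (\<integral>\<^sup>+x. ennreal ((norm y)\<^sup>2) * indicator (s -` {y}) x \<partial>lborel)"
      by (subst nn_integral_cmult_indicator) auto
    also have "\<dots> \<le> (\<integral>\<^sup>+x. ennreal ((norm (s x))\<^sup>2) \<partial>lborel)"
      by (intro nn_integral_mono) (auto simp: indicator_def)
    also have "\<dots> < \<infinity>" by fact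
    finally have "emeasure lborel (s -` {y}) < \<infinity>"
      using False by (auto simp: less_top[symmetric] ennreal_mult_eq_top_iff)
    then show ?thesis using False out
      by (intro approximable_scale approximable_indicator K meas) auto
  qed
  then have "approximable K (\<lambda>x. \<Sum>y\<in>range s. y * indicator (s -` {y}) x)"
    by (intro approximable_sum)
  also have "(\<lambda>x. \<Sum>y\<in>range s. y * indicator (s -` {y}) x) = s"
  proof
    fix x
    have "(\<Sum>y\<in>range s. y * indicator (s -` {y}) x) = (\<Sum>y\<in>range s. if y = s x then y else 0)"
      by (intro sum.cong) (auto simp: indicator_def)
    then show "(\<Sum>y\<in>range s. y * indicator (s -` {y}) x) = s x" using \<open>finite (range s)\<close> by simp
  qed
  finally show ?thesis .
qed

lemma approximable_sq_int:
  assumes K: "open K" and f: "sq_int f" and out: "\<And>x. x \<notin> K \<Longrightarrow> f x = 0"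
  shows "approximable K f"
proof (rule approximable_closed)
  have [measurable]: "f \<in> borel_measurable borel" using f by measurable
  show "f \<in> borel_measurable borel" by measurable
  fix \<epsilon> :: real assume e: "\<epsilon> > 0"
  have "f \<in> borel_measurable lborel" by simp
  from borel_measurable_implies_sequence_metric[OF this, of 0] obtain s where
    s: "\<And>i. simple_function lborel (s i)" "\<And>x. (\<lambda>i. s i x) \<longlonglongrightarrow> f x" "\<And>i x. norm (s i x) \<le> 2 * norm (f x)"
    by auto
  have [measurable]: "s i \<in> borel_measurable borel" for i
    using borel_measurable_simple_function[OF s(1)[of i]] by simp
  have finf: "(\<integral>\<^sup>+x. ennreal ((norm (f x))\<^sup>2) \<partial>lborel) < \<infinity>"
    using sq_integrable_norm_sq[OF f] by (simp add: integrable_iff_bounded)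
  have fin9: "(\<integral>\<^sup>+x. ennreal (9 * (norm (f x))\<^sup>2) \<partial>lborel) < \<infinity>"
    using integrable_mult_right[OF sq_integrable_norm_sq[OF f], of 9]
    unfolding integrable_iff_bounded by (simp del: ennreal_mult'' add: abs_mult)
  have "(\<lambda>i. sq_dist (s i) f) \<longlonglongrightarrow> (\<integral>\<^sup>+x. 0 \<partial>(lborel :: (real^2) measure))"
  proof (rule nn_integral_dominated_convergence[where w = "\<lambda>x. ennreal (9 * (norm (f x))\<^sup>2)"])
    show "AE x in lborel. ennreal ((cmod (s i x - f x))\<^sup>2) \<le> ennreal (9 * (norm (f x))\<^sup>2)" for i
    proof (intro AE_I2 ennreal_leI)
      fix x
      have "cmod (s i x - f x) \<le> 3 * norm (f x)"
        using s(3)[of i x] norm_triangle_ineq4[of "s i x" "f x"] by simp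
      then have "(cmod (s i x - f x))\<^sup>2 \<le> (3 * norm (f x))\<^sup>2" by (rule power_mono) simp
      then show "(cmod (s i x - f x))\<^sup>2 \<le> 9 * (norm (f x))\<^sup>2" by (simp add: power_mult_distrib)
    qed
    show "AE x in lborel. (\<lambda>i. ennreal ((cmod (s i x - f x))\<^sup>2)) \<longlonglongrightarrow> 0"
    proof (rule AE_I2)
      fix x
      have "(\<lambda>i. (cmod (s i x - f x))\<^sup>2) \<longlonglongrightarrow> (cmod (f x - f x))\<^sup>2" by (intro tendsto_intros s(2))
      from tendsto_ennrealI[OF this] show "(\<lambda>i. ennreal ((cmod (s i x - f x))\<^sup>2)) \<longlonglongrightarrow> 0" by simp
    qed
  qed (use fin9 in auto)
  then have lim: "(\<lambda>i. sq_dist (s i) f) \<longlonglongrightarrow> 0" by simp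
  obtain i where i: "sq_dist (s i) f < ennreal \<epsilon>" using ennreal_tendsto_0_less[OF lim e] by auto
  have "approximable K (s i)"
  proof (rule approximable_simple[OF K s(1)])
    show "s i x = 0" if "x \<notin> K" for x using s(3)[of i x] out[OF that] by simp
    have "(\<integral>\<^sup>+x. ennreal ((norm (s i x))\<^sup>2) \<partial>lborel) \<le> (\<integral>\<^sup>+x. ennreal (9 * (norm (f x))\<^sup>2) \<partial>lborel)"
    proof (intro nn_integral_mono ennreal_leI)
      fix x
      have "(norm (s i x))\<^sup>2 \<le> (2 * norm (f x))\<^sup>2" by (intro power_mono s(3)) simp
      also have "\<dots> \<le> 9 * (norm (f x))\<^sup>2" by (simp add: power_mult_distrib)
      finally show "(norm (s i x))\<^sup>2 \<le> 9 * (norm (f x))\<^sup>2" .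
    qed
    from this fin9 show "(\<integral>\<^sup>+x. ennreal ((norm (s i x))\<^sup>2) \<partial>lborel) < \<infinity>" by (rule le_less_trans)
  qed
  with i show "\<exists>g. approximable K g \<and> sq_dist g f < ennreal \<epsilon>" by blast
qed

lemma sq_int_test_approx:
  assumes "open K" "sq_int f" "\<And>x. x \<notin> K \<Longrightarrow> f x = 0" "\<epsilon> > 0"
  shows "\<exists>\<phi>. test_function K \<phi> \<and> (LINT x|lborel. (norm (\<phi> x - f x))\<^sup>2) < \<epsilon>"
proof -
  obtain \<phi> where \<phi>: "test_function K \<phi>" "sq_dist \<phi> f < ennreal \<epsilon>"
    using approximable_sq_int[OF assms(1-3)] assms(4) unfolding approximable_def by blast
  have [measurable]: "f \<in> borel_measurable borel" "\<phi> \<in> borel_measurable borel"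
    using assms(2) test_function_measurable[OF \<phi>(1)] by (auto simp: sq_int_iff)
  have "(LINT x|lborel. (norm (\<phi> x - f x))\<^sup>2) = enn2real (sq_dist \<phi> f)"
    by (rule integral_eq_nn_integral) auto
  also have "\<dots> < \<epsilon>"
    using \<phi>(2) assms(4) by (cases "sq_dist \<phi> f") (auto simp: ennreal_less_iff)
  finally show ?thesis using \<phi>(1) by blast
qed

lemma norm_diff_cnj_sq: "(norm (z - cnj w))\<^sup>2 = (norm z)\<^sup>2 + (norm w)\<^sup>2 - 2 * Re (w * z)"
  unfolding cmod_power2 by (simp add: power2_eq_square algebra_simps)

text \<open>
  A bound for the norm of \<open>f\<close> from its pairings with test functions. It rests on the identity
  \<open>2 Re \<integral>f \<phi> - \<integral>\<bar>\<phi>\<bar>\<^sup>2 = \<integral>\<bar>f\<bar>\<^sup>2 - \<integral>\<bar>\<phi> - cnj f\<bar>\<^sup>2\<close>, whose last term is as small as desired for a suitable \<open>\<phi>\<close>. The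
  quadratic form of the hypothesis is what Young's inequality produces, and needs no square roots.
  With \<open>M = 0\<close> this is the fundamental lemma of the calculus of variations.
\<close>

lemma test_function_duality:
  assumes K: "open K" and f: "sq_int f" and out: "\<And>x. x \<notin> K \<Longrightarrow> f x = 0"
    and le: "\<And>\<phi>. test_function K \<phi> \<Longrightarrow>
      2 * Re (LINT x|lborel. f x * \<phi> x) \<le> M + sq_norm lborel \<phi>"
  shows "sq_norm lborel f \<le> M"
proof (rule field_le_epsilon)
  fix \<epsilon> :: real assume "\<epsilon> > 0"
  then obtain \<phi> where \<phi>: "test_function K \<phi>" "(LINT x|lborel. (norm (\<phi> x - cnj (f x)))\<^sup>2) < \<epsilon>"
    using sq_int_test_approx[OF K sq_integrable_cnj[OF f]] out by auto
  have i: "integrable lborel (\<lambda>x. (norm (\<phi> x))\<^sup>2)" "integrable lborel (\<lambda>x. (norm (f x))\<^sup>2)"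
    "integrable lborel (\<lambda>x. f x * \<phi> x)"
    using sq_integrable_norm_sq test_function_sq_int[OF \<phi>(1)] f sq_integrable_mult by auto
  have "(LINT x|lborel. (norm (\<phi> x - cnj (f x)))\<^sup>2)
     = sq_norm lborel \<phi> + sq_norm lborel f - 2 * Re (LINT x|lborel. f x * \<phi> x)"
    unfolding norm_diff_cnj_sq using i by (simp del: times_complex.sel)
  with \<phi>(2) le[OF \<phi>(1)] show "sq_norm lborel f \<le> M + \<epsilon>" by linarith
qed

section \<open>Translating a function along its weak gradient\<close>

text \<open>
  The analogue of \<^const>\<open>has_weak_gradient\<close> for Borel functions on the whole plane. Only the integrals over
  \<open>\<Omega>\<close> matter, as test functions vanish outside \<open>\<Omega>\<close>; this makes restriction to smaller sets trivial.
\<close>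

definition distr_gradient :: "(real^2) set \<Rightarrow> (real^2 \<Rightarrow> complex) \<Rightarrow> (real^2 \<Rightarrow> complex^2) \<Rightarrow> bool" where
  "distr_gradient \<Omega> U G \<longleftrightarrow> (\<forall>\<phi> i. test_function \<Omega> \<phi> \<longrightarrow>
     (LINT x|lborel. U x * partial_deriv i \<phi> x) = - (LINT x|lborel. G x $ i * \<phi> x))"

lemma distr_gradient_mono: "distr_gradient B U G \<Longrightarrow> A \<subseteq> B \<Longrightarrow> distr_gradient A U G"
  using test_function_mono unfolding distr_gradient_def by blast

lemma lborel_integral_translate:
  fixes f :: "'a::euclidean_space \<Rightarrow> 'b::{banach, second_countable_topology}"
  assumes [measurable]: "f \<in> borel_measurable borel"
  shows "(LINT x|lborel. f (x + h)) = (LINT x|lborel. f x)"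
proof -
  have "(LINT x|lborel. f x) = (LINT x|distr lborel borel ((+) h). f x)" by (simp add: lborel_distr_plus)
  also have "\<dots> = (LINT x|lborel. f (x + h))" by (subst integral_distr) (auto simp: add.commute)
  finally show ?thesis ..
qed

lemma lborel_integrable_translate:
  fixes f :: "'a::euclidean_space \<Rightarrow> 'b::{banach, second_countable_topology}"
  assumes [measurable]: "f \<in> borel_measurable borel" and "integrable lborel f"
  shows "integrable lborel (\<lambda>x. f (x + h))"
proof -
  have "integrable (distr lborel borel ((+) h)) f" using assms(2) by (simp add: lborel_distr_plus)
  then have "integrable lborel (\<lambda>x. f (h + x))" by (subst (asm) integrable_distr_eq) auto
  then show ?thesis by (simp add: add.commute)
qed

lemma sq_int_translate: "sq_int f \<Longrightarrow> sq_int (\<lambda>x. f (x + h))"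
  using lborel_integrable_translate[of "\<lambda>x. (norm (f x))\<^sup>2" h] unfolding sq_int_iff by auto

lemma frechet_derivative_eq_partial:
  assumes "\<phi> differentiable at x"
  shows "frechet_derivative \<phi> (at x) v = (\<Sum>i\<in>UNIV. of_real (v $ i) * partial_deriv i \<phi> x)"
proof -
  have lin: "linear (frechet_derivative \<phi> (at x))" by (rule linear_frechet_derivative) fact
  have "v = (\<Sum>i\<in>UNIV. v $ i *\<^sub>R axis i 1)"
    using basis_expansion[of v] by (simp add: scalar_mult_eq_scaleR)
  then have "frechet_derivative \<phi> (at x) v = frechet_derivative \<phi> (at x) (\<Sum>i\<in>UNIV. v $ i *\<^sub>R axis i 1)"
    by simp
  also have "\<dots> = (\<Sum>i\<in>UNIV. of_real (v $ i) * partial_deriv i \<phi> x)"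
    by (simp only: linear_sum[OF lin] linear_scale[OF lin] partial_deriv_def)
       (simp only: scaleR_conv_of_real)
  finally show ?thesis .
qed

lemma test_function_lipschitz:
  assumes "test_function \<Omega> \<phi>"
  obtains B where "B \<ge> 0" "\<And>x y. norm (\<phi> x - \<phi> y) \<le> B * norm (x - y)"
proof -
  have "\<exists>B\<ge>0. \<forall>x. norm (partial_deriv i \<phi> x) \<le> B" for i
    using test_function_bounded[OF test_function_partial_deriv[OF assms, of i]] by metis
  then obtain B where B: "\<And>i. B i \<ge> 0" "\<And>i x. norm (partial_deriv i \<phi> x) \<le> B i" by metis
  show ?thesis
  proof
    show "0 \<le> (\<Sum>i\<in>UNIV. B i)" using B by (intro sum_nonneg) auto
    fix x y
    show "norm (\<phi> x - \<phi> y) \<le> (\<Sum>i\<in>UNIV. B i) * norm (x - y)"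
    proof (rule differentiable_bound[of UNIV \<phi> "\<lambda>x. frechet_derivative \<phi> (at x)"])
      fix z
      show "(\<phi> has_derivative frechet_derivative \<phi> (at z)) (at z within UNIV)"
        using differentiable_frechet[OF test_function_differentiable[OF assms]] by simp
      show "onorm (frechet_derivative \<phi> (at z)) \<le> (\<Sum>i\<in>UNIV. B i)"
      proof (rule onorm_le)
        fix v
        have "norm (frechet_derivative \<phi> (at z) v) \<le> (\<Sum>i\<in>UNIV. norm (of_real (v $ i) * partial_deriv i \<phi> z))"
          unfolding frechet_derivative_eq_partial[OF test_function_differentiable[OF assms]] by (rule norm_sum)
        also have "\<dots> \<le> (\<Sum>i\<in>UNIV. norm v * B i)"
          unfolding norm_mult
          by (intro sum_mono mult_mono B norm_ge_zero) (simp add: component_le_norm_cart)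
        also have "\<dots> = (\<Sum>i\<in>UNIV. B i) * norm v" by (simp add: sum_distrib_left mult.commute)
        finally show "norm (frechet_derivative \<phi> (at z) v) \<le> (\<Sum>i\<in>UNIV. B i) * norm v" .
      qed
    qed auto
  qed
qed

text \<open>
  Differentiation under the integral sign. A test function is Lipschitz continuous, so the difference
  quotients are bounded, and for bounded increments they are supported in a fixed ball.
\<close>

lemma translated_pairing_has_derivative:
  assumes U: "sq_int U" and \<phi>: "test_function \<Omega> \<phi>"
  shows "((\<lambda>s. Re (LINT x|lborel. U x * \<phi> (x - s *\<^sub>R h))) has_real_derivative
      - Re (LINT x|lborel. U x * frechet_derivative \<phi> (at (x - s *\<^sub>R h)) h)) (at s)"
proof -
  have [measurable]: "U \<in> borel_measurable borel" "\<phi> \<in> borel_measurable borel"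
    using U test_function_measurable[OF \<phi>] by (auto simp: sq_int_iff)
  obtain B where B: "B \<ge> 0" "\<And>x y. norm (\<phi> x - \<phi> y) \<le> B * norm (x - y)"
    using test_function_lipschitz[OF \<phi>] by metis
  obtain S where S: "compact S" "\<And>x. x \<notin> S \<Longrightarrow> \<phi> x = 0" using \<phi> by (metis test_functionE)
  then obtain R where R: "\<And>x. x \<in> S \<Longrightarrow> norm x \<le> R" using compact_imp_bounded bounded_iff by metis
  define d where "d x = frechet_derivative \<phi> (at (x - s *\<^sub>R h)) h" for x
  define q where "q \<epsilon> x = (\<phi> (x - (s + \<epsilon>) *\<^sub>R h) - \<phi> (x - s *\<^sub>R h)) / of_real \<epsilon>" for \<epsilon> x
  have [measurable]: "q \<epsilon> \<in> borel_measurable borel" for \<epsilon> unfolding q_def by measurable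
  have "continuous_on UNIV (\<lambda>x. frechet_derivative \<phi> (at x) h)"
    unfolding frechet_derivative_eq_partial[OF test_function_differentiable[OF \<phi>]]
    by (intro continuous_intros test_function_continuous[OF test_function_partial_deriv[OF \<phi>]])
  then have [measurable]: "(\<lambda>x. frechet_derivative \<phi> (at x) h) \<in> borel_measurable borel"
    by (rule borel_measurable_continuous_onI)
  then have [measurable]: "d \<in> borel_measurable borel" unfolding d_def by measurable
  have int: "integrable lborel (\<lambda>x. U x * \<phi> (x - t *\<^sub>R h))" for t
    using sq_integrable_mult[OF U sq_int_translate[OF test_function_sq_int[OF \<phi>], of "- t *\<^sub>R h"]] by simp
  have main: "(\<lambda>n. LINT x|lborel. U x * q (\<epsilon> n) x) \<longlonglongrightarrow> (LINT x|lborel. U x * - d x)"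
    if \<epsilon>: "\<epsilon> \<longlonglongrightarrow> 0" "\<And>n. \<epsilon> n \<noteq> 0" for \<epsilon> :: "nat \<Rightarrow> real"
  proof -
    obtain c where c: "\<And>n. norm (\<epsilon> n) \<le> c" using convergent_imp_Bseq[OF convergentI[OF \<epsilon>(1)]] by (auto simp: Bseq_def)
    define R' where "R' = R + (\<bar>s\<bar> + c) * norm h"
    have c0: "c \<ge> 0" using c[of 0] norm_ge_zero order_trans by blast
    have qB: "norm (q (\<epsilon> n) x) \<le> indicator (cball 0 R') x * (B * norm h)" for n x
    proof (cases "x \<in> cball 0 R'")
      case True
      have "norm (\<phi> (x - (s + \<epsilon> n) *\<^sub>R h) - \<phi> (x - s *\<^sub>R h)) \<le> B * norm ((x - (s + \<epsilon> n) *\<^sub>R h) - (x - s *\<^sub>R h))"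
        by (rule B)
      also have "(x - (s + \<epsilon> n) *\<^sub>R h) - (x - s *\<^sub>R h) = - \<epsilon> n *\<^sub>R h" by (simp add: algebra_simps)
      finally have "norm (\<phi> (x - (s + \<epsilon> n) *\<^sub>R h) - \<phi> (x - s *\<^sub>R h)) \<le> (B * norm h) * \<bar>\<epsilon> n\<bar>" by (simp add: mult_ac)
      then show ?thesis using \<epsilon>(2)[of n] True by (simp add: q_def norm_divide pos_divide_le_eq)
    next
      case False
      have "x - t *\<^sub>R h \<notin> S" if "\<bar>t\<bar> \<le> \<bar>s\<bar> + c" for t
      proof
        assume "x - t *\<^sub>R h \<in> S"
        then have "norm (x - t *\<^sub>R h) \<le> R" by (rule R)
        moreover have "norm x \<le> norm (x - t *\<^sub>R h) + norm (t *\<^sub>R h)" using norm_triangle_ineq[of "x - t *\<^sub>R h" "t *\<^sub>R h"] by simp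
        moreover have "norm (t *\<^sub>R h) \<le> (\<bar>s\<bar> + c) * norm h" using that by (simp add: mult_right_mono)
        ultimately show False using False by (simp add: R'_def)
      qed
      from S(2)[OF this, of s] S(2)[OF this, of "s + \<epsilon> n"] show ?thesis
        using c0 c[of n] abs_triangle_ineq[of s "\<epsilon> n"] False B(1)
        by (simp add: q_def)
    qed
    show ?thesis
    proof (rule integral_dominated_convergence[where w = "\<lambda>x. norm (U x) * (indicator (cball 0 R') x * (B * norm h))"])
      have "sq_int (\<lambda>x::real^2. indicator (cball 0 R') x *\<^sub>R complex_of_real (B * norm h))"
      proof (rule sq_int_bound)
        show "integrable lborel (\<lambda>x::real^2. indicator (cball 0 R') x * (B * norm h)\<^sup>2)"
          by (intro integrable_mult_left) (auto simp: integrable_indicator_iff emeasure_bounded_finite[unfolded infinity_ennreal_def])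
      qed (auto simp: indicator_def norm_mult B(1))
      from integrable_norm[OF sq_integrable_mult[OF U this]]
      show "integrable lborel (\<lambda>x. norm (U x) * (indicator (cball 0 R') x * (B * norm h)))"
        using B(1) by (simp add: norm_mult mult_ac)
      show "AE x in lborel. norm (U x * q (\<epsilon> n) x) \<le> norm (U x) * (indicator (cball 0 R') x * (B * norm h))" for n
        unfolding norm_mult by (intro AE_I2 mult_left_mono qB norm_ge_zero)
      show "AE x in lborel. (\<lambda>n. U x * q (\<epsilon> n) x) \<longlonglongrightarrow> U x * - d x"
      proof (intro AE_I2 tendsto_mult tendsto_const)
        fix x
        have "((\<lambda>t. x - t *\<^sub>R h) has_derivative (\<lambda>t. - (t *\<^sub>R h))) (at s)"
          by (auto intro!: derivative_eq_intros)
        from has_derivative_compose[OF this differentiable_frechet[OF test_function_differentiable[OF \<phi>]]]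
        have "((\<lambda>t. \<phi> (x - t *\<^sub>R h)) has_derivative
            (\<lambda>t. frechet_derivative \<phi> (at (x - s *\<^sub>R h)) (- (t *\<^sub>R h)))) (at s)" .
        also have "(\<lambda>t. frechet_derivative \<phi> (at (x - s *\<^sub>R h)) (- (t *\<^sub>R h)))
          = (\<lambda>t. t *\<^sub>R (- d x))"
          using linear_frechet_derivative[OF test_function_differentiable[OF \<phi>], of "x - s *\<^sub>R h"]
          by (simp add: linear_neg linear_scale d_def)
        finally have "((\<lambda>\<epsilon>. norm (\<phi> (x - (s + \<epsilon>) *\<^sub>R h) - \<phi> (x - s *\<^sub>R h) - \<epsilon> *\<^sub>R (- d x))
            / norm \<epsilon>) \<longlongrightarrow> 0) (at 0)"
          unfolding has_derivative_at by simp
        moreover have "filterlim \<epsilon> (at 0) sequentially" using \<epsilon> by (auto simp: filterlim_at)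
        ultimately have "(\<lambda>n. norm (\<phi> (x - (s + \<epsilon> n) *\<^sub>R h) - \<phi> (x - s *\<^sub>R h)
            - \<epsilon> n *\<^sub>R (- d x)) / norm (\<epsilon> n)) \<longlonglongrightarrow> 0"
          by (rule filterlim_compose)
        moreover have "norm (\<phi> (x - (s + \<epsilon> n) *\<^sub>R h) - \<phi> (x - s *\<^sub>R h)
            - \<epsilon> n *\<^sub>R (- d x)) / norm (\<epsilon> n)
            = norm (q (\<epsilon> n) x - (- d x))" for n
        proof -
          have "q (\<epsilon> n) x - (- d x) = (\<phi> (x - (s + \<epsilon> n) *\<^sub>R h) - \<phi> (x - s *\<^sub>R h)
            - \<epsilon> n *\<^sub>R (- d x)) / of_real (\<epsilon> n)"
            using \<epsilon>(2)[of n] by (simp add: q_def scaleR_conv_of_real field_simps)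
          then show ?thesis by (simp only: norm_divide norm_of_real real_norm_def)
        qed
        ultimately have "(\<lambda>n. norm (q (\<epsilon> n) x - (- d x))) \<longlonglongrightarrow> 0"
          by (simp only:)
        then show "(\<lambda>n. q (\<epsilon> n) x) \<longlonglongrightarrow> - d x"
          by (rule LIM_zero_cancel[OF tendsto_norm_zero_cancel])
      qed
    qed measurable
  qed
  have "((\<lambda>\<epsilon>. (Re (LINT x|lborel. U x * \<phi> (x - (s + \<epsilon>) *\<^sub>R h)) - Re (LINT x|lborel. U x * \<phi> (x - s *\<^sub>R h))) / \<epsilon>)
     \<longlongrightarrow> - Re (LINT x|lborel. U x * d x)) (at 0)"
    unfolding tendsto_at_iff_sequentially comp_def
  proof (intro allI impI)
    fix \<epsilon> :: "nat \<Rightarrow> real" assume e: "\<forall>n. \<epsilon> n \<in> UNIV - {0}" "\<epsilon> \<longlonglongrightarrow> 0"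
    have "(LINT x|lborel. U x * q (\<epsilon> n) x) = ((LINT x|lborel. U x * \<phi> (x - (s + \<epsilon> n) *\<^sub>R h)) - (LINT x|lborel. U x * \<phi> (x - s *\<^sub>R h))) / of_real (\<epsilon> n)" for n
    proof -
      have "(LINT x|lborel. U x * q (\<epsilon> n) x) = (LINT x|lborel. (U x * \<phi> (x - (s + \<epsilon> n) *\<^sub>R h) - U x * \<phi> (x - s *\<^sub>R h)) / of_real (\<epsilon> n))"
        by (simp add: q_def right_diff_distrib)
      also have "\<dots> = (LINT x|lborel. (U x * \<phi> (x - (s + \<epsilon> n) *\<^sub>R h) - U x * \<phi> (x - s *\<^sub>R h))) / of_real (\<epsilon> n)" by simp
      also have "(LINT x|lborel. (U x * \<phi> (x - (s + \<epsilon> n) *\<^sub>R h) - U x * \<phi> (x - s *\<^sub>R h)))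
        = (LINT x|lborel. U x * \<phi> (x - (s + \<epsilon> n) *\<^sub>R h)) - (LINT x|lborel. U x * \<phi> (x - s *\<^sub>R h))"
        by (rule Bochner_Integration.integral_diff[OF int int])
      finally show ?thesis .
    qed
    then have "(Re (LINT x|lborel. U x * \<phi> (x - (s + \<epsilon> n) *\<^sub>R h)) - Re (LINT x|lborel. U x * \<phi> (x - s *\<^sub>R h))) / \<epsilon> n
      = Re (LINT x|lborel. U x * q (\<epsilon> n) x)" for n
      by (simp only: Re_divide_of_real minus_complex.sel)
    moreover have "(\<lambda>n. Re (LINT x|lborel. U x * q (\<epsilon> n) x)) \<longlonglongrightarrow> Re (LINT x|lborel. U x * - d x)"
      using e by (intro tendsto_Re main) auto
    ultimately show "(\<lambda>n. (Re (LINT x|lborel. U x * \<phi> (x - (s + \<epsilon> n) *\<^sub>R h)) - Re (LINT x|lborel. U x * \<phi> (x - s *\<^sub>R h))) / \<epsilon> n)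
      \<longlonglongrightarrow> - Re (LINT x|lborel. U x * d x)" by simp
  qed
  then show ?thesis unfolding DERIV_def d_def .
qed

lemma norm_dot_le:
  fixes h :: "real^2" and g :: "complex^2"
  shows "norm (\<Sum>i\<in>UNIV. of_real (h $ i) * g $ i) \<le> norm h * norm g"
proof -
  have "norm (\<Sum>i\<in>UNIV. of_real (h $ i) * g $ i) \<le> (\<Sum>i\<in>UNIV. norm (h $ i) * norm (g $ i))"
    by (rule order_trans[OF norm_sum]) (simp add: norm_mult)
  also have "\<dots> \<le> L2_set (\<lambda>i. norm (h $ i)) UNIV * L2_set (\<lambda>i. norm (g $ i)) UNIV"
    using L2_set_mult_ineq[of "\<lambda>i. norm (h $ i)" "\<lambda>i. norm (g $ i)" UNIV] by simp
  also have "\<dots> = norm h * norm g" by (simp only: norm_vec_def)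
  finally show ?thesis .
qed

lemma sq_int_indicator:
  "sq_int f \<Longrightarrow> A \<in> sets borel \<Longrightarrow> sq_int (\<lambda>x. indicator A x *\<^sub>R f x)"
  by (rule sq_int_bound[where h = "\<lambda>x. (norm (f x))\<^sup>2"]) (auto simp: sq_int_iff indicator_def)

lemma two_Re_mult_le: "2 * Re (a * b) \<le> (norm a)\<^sup>2 + (norm b)\<^sup>2"
  using norm_diff_cnj_sq[of b a] zero_le_power2[of "norm (b - cnj a)"] by simp

text \<open>
  For smooth \<open>U\<close> this is the fundamental theorem of calculus along segments. In general the translation is
  moved to a test function \<open>\<phi>\<close> supported in \<open>K\<close>: the function \<open>J s = Re \<integral>U(x) \<phi>(x - s h)\<close> has the derivative
  \<open>Re \<integral>(h \<cdot> G)(x) \<phi>(x - s h)\<close>, because the translates of \<open>\<phi>\<close> by \<open>s h\<close> are test functions on \<open>\<Omega>\<close>. The mean value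
  theorem for \<open>J\<close>, the inequality \<open>2 Re (a b) \<le> \<bar>a\<bar>\<^sup>2 + \<bar>b\<bar>\<^sup>2\<close> and duality give the claim.
\<close>

lemma translation_estimate:
  assumes K: "open K" and \<Omega>: "open \<Omega>" and U: "sq_int U" and G: "sq_int G"
    and grad: "distr_gradient \<Omega> U G"
    and seg: "\<And>x t. x \<in> K \<Longrightarrow> 0 \<le> t \<Longrightarrow> t \<le> 1 \<Longrightarrow> x + t *\<^sub>R h \<in> \<Omega>"
  shows "(LINT x|lborel. indicator K x * (norm (U (x + h) - U x))\<^sup>2)
    \<le> (norm h)\<^sup>2 * sq_norm_on \<Omega> G"
proof -
  define f where "f x = indicator K x *\<^sub>R (U (x + h) - U x)" for x
  define H where "H x = (\<Sum>i\<in>UNIV. of_real (h $ i) * G x $ i)" for x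
  have [measurable]: "K \<in> sets borel" "\<Omega> \<in> sets borel" using K \<Omega> by auto
  have f: "sq_int f" unfolding f_def by (intro sq_int_indicator sq_integrable_diff sq_int_translate U) simp
  have [measurable]: "U \<in> borel_measurable borel" "G \<in> borel_measurable borel" using U G by (auto simp: sq_int_iff)
  have Gi: "sq_int (\<lambda>x. of_real (h $ i) * G x $ i)" for i
    using sq_integrable_component[OF G, of i] by (auto simp: sq_int_iff norm_mult power_mult_distrib)
  have H: "sq_int H" unfolding H_def UNIV_2 using Gi[of 1] Gi[of 2] by (simp add: sq_integrable_add)
  have intG: "integrable lborel (\<lambda>x. indicator \<Omega> x * (norm (G x))\<^sup>2)"
    using sq_integrable_norm_sq[OF sq_int_indicator[OF G, of \<Omega>]]
    by (rule back_subst[of "integrable lborel"]) (auto simp: fun_eq_iff indicator_def)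
  have "sq_norm lborel f \<le> (norm h)\<^sup>2 * sq_norm_on \<Omega> G"
  proof (rule test_function_duality[OF K f])
    show "f x = 0" if "x \<notin> K" for x using that by (simp add: f_def)
    fix \<phi> assume \<phi>: "test_function K \<phi>"
    have [measurable]: "\<phi> \<in> borel_measurable borel" by (rule test_function_measurable[OF \<phi>])
    have out: "\<phi> x = 0" if "x \<notin> K" for x using \<phi> that by (metis test_functionE subset_iff)
    define J where "J s = Re (LINT x|lborel. U x * \<phi> (x - s *\<^sub>R h))" for s
    have "(LINT x|lborel. f x * \<phi> x) = (LINT x|lborel. U (x + h) * \<phi> x - U x * \<phi> x)"
      by (intro Bochner_Integration.integral_cong refl) (auto simp: f_def out indicator_def left_diff_distrib)
    also have "\<dots> = (LINT x|lborel. U (x + h) * \<phi> x) - (LINT x|lborel. U x * \<phi> x)"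
      by (intro Bochner_Integration.integral_diff sq_integrable_mult sq_int_translate U test_function_sq_int[OF \<phi>])
    also have "(LINT x|lborel. U (x + h) * \<phi> x) = (LINT x|lborel. U (x + h) * \<phi> ((x + h) - h))" by simp
    also have "\<dots> = (LINT x|lborel. U x * \<phi> (x - h))"
      by (rule lborel_integral_translate[of "\<lambda>x. U x * \<phi> (x - h)"]) measurable
    finally have J10: "Re (LINT x|lborel. f x * \<phi> x) = J 1 - J 0" by (simp add: J_def)
    obtain s where s: "0 < s" "s < 1" and Js: "J 1 - J 0 = (1 - 0) *
        - Re (LINT x|lborel. U x * frechet_derivative \<phi> (at (x - s *\<^sub>R h)) h)"
      using MVT2[of 0 1 J "\<lambda>s. - Re (LINT x|lborel. U x * frechet_derivative \<phi> (at (x - s *\<^sub>R h)) h)"]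
        translated_pairing_has_derivative[OF U \<phi>, of h] unfolding J_def by auto
    define \<psi> where "\<psi> x = \<phi> (x - s *\<^sub>R h)" for x
    have \<psi>: "test_function \<Omega> \<psi>" unfolding \<psi>_def
      using s seg by (intro test_function_translate[OF \<phi>]) auto
    have [measurable]: "\<psi> \<in> borel_measurable borel" by (rule test_function_measurable[OF \<psi>])
    have outp: "\<psi> x = 0" if "x \<notin> \<Omega>" for x using \<psi> that by (metis test_functionE subset_iff)
    have pd: "partial_deriv i \<psi> x = partial_deriv i \<phi> (x - s *\<^sub>R h)" for i x
      unfolding \<psi>_def
      using partial_deriv_eqI[OF translate_has_derivative[OF test_function_differentiable[OF \<phi>]]]
      by (simp add: partial_deriv_def)
    have "(LINT x|lborel. U x * frechet_derivative \<phi> (at (x - s *\<^sub>R h)) h)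
       = (LINT x|lborel. (\<Sum>i\<in>UNIV. of_real (h $ i) * (U x * partial_deriv i \<psi> x)))"
      unfolding frechet_derivative_eq_partial[OF test_function_differentiable[OF \<phi>]] pd
      by (simp add: sum_distrib_left mult_ac)
    also have "\<dots> = (\<Sum>i\<in>UNIV. of_real (h $ i) * (LINT x|lborel. U x * partial_deriv i \<psi> x))"
      by (subst Bochner_Integration.integral_sum)
         (auto intro!: integrable_mult_right sq_integrable_mult U
            test_function_sq_int[OF test_function_partial_deriv[OF \<psi>]])
    also have "\<dots> = (\<Sum>i\<in>UNIV. of_real (h $ i) * - (LINT x|lborel. G x $ i * \<psi> x))"
      using grad \<psi> by (simp add: distr_gradient_def)
    also have "\<dots> = - (\<Sum>i\<in>UNIV. (LINT x|lborel. of_real (h $ i) * (G x $ i * \<psi> x)))"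
      by (simp add: sum_negf)
    also have "\<dots> = - (LINT x|lborel. (\<Sum>i\<in>UNIV. of_real (h $ i) * (G x $ i * \<psi> x)))"
      by (subst Bochner_Integration.integral_sum)
         (auto intro!: integrable_mult_right sq_integrable_mult sq_integrable_component G
            test_function_sq_int[OF \<psi>])
    also have "\<dots> = - (LINT x|lborel. H x * \<psi> x)"
      by (simp add: H_def sum_distrib_left sum_distrib_right mult_ac)
    finally have "2 * Re (LINT x|lborel. f x * \<phi> x) = (LINT x|lborel. 2 * Re (H x * \<psi> x))"
      using J10 Js sq_integrable_mult[OF H test_function_sq_int[OF \<psi>]] by (simp del: times_complex.sel)
    also have "\<dots> \<le> (LINT x|lborel. (norm h)\<^sup>2 * (indicator \<Omega> x * (norm (G x))\<^sup>2) + (norm (\<psi> x))\<^sup>2)"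
    proof (rule integral_mono)
      show "integrable lborel (\<lambda>x. 2 * Re (H x * \<psi> x))"
        using sq_integrable_mult[OF H test_function_sq_int[OF \<psi>]] by (simp del: times_complex.sel)
      show "integrable lborel (\<lambda>x. (norm h)\<^sup>2 * (indicator \<Omega> x * (norm (G x))\<^sup>2) + (norm (\<psi> x))\<^sup>2)"
        using intG sq_integrable_norm_sq[OF test_function_sq_int[OF \<psi>]] by auto
      fix x
      show "2 * Re (H x * \<psi> x) \<le> (norm h)\<^sup>2 * (indicator \<Omega> x * (norm (G x))\<^sup>2) + (norm (\<psi> x))\<^sup>2"
      proof (cases "x \<in> \<Omega>")
        case True
        have "(norm (H x))\<^sup>2 \<le> (norm h * norm (G x))\<^sup>2" unfolding H_def by (intro power_mono norm_dot_le norm_ge_zero)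
        then show ?thesis using True two_Re_mult_le[of "H x" "\<psi> x"] by (simp add: power_mult_distrib)
      qed (simp add: outp)
    qed
    also have "\<dots> = (norm h)\<^sup>2 * sq_norm_on \<Omega> G + sq_norm lborel \<psi>"
      using intG sq_integrable_norm_sq[OF test_function_sq_int[OF \<psi>]] by simp
    also have "sq_norm lborel \<psi> = sq_norm lborel \<phi>"
      using lborel_integral_translate[of "\<lambda>x. (norm (\<phi> x))\<^sup>2" "- s *\<^sub>R h"] by (simp add: \<psi>_def)
    finally show "2 * Re (LINT x|lborel. f x * \<phi> x)
        \<le> (norm h)\<^sup>2 * sq_norm_on \<Omega> G + sq_norm lborel \<phi>" .
  qed
  also have "sq_norm lborel f = (LINT x|lborel. indicator K x * (norm (U (x + h) - U x))\<^sup>2)"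
    by (intro Bochner_Integration.integral_cong refl) (auto simp: f_def indicator_def)
  finally show ?thesis .
qed

section \<open>The Poincare inequality on boxes\<close>

lemma sq_int_Cauchy_Schwarz:
  fixes f g :: "real^2 \<Rightarrow> complex"
  assumes f: "sq_int f" and g: "sq_int g"
  shows "(norm (LINT x|lborel. f x * g x))\<^sup>2 \<le> sq_norm lborel f * sq_norm lborel g"
proof -
  have [measurable]: "f \<in> borel_measurable borel" "g \<in> borel_measurable borel" using f g by (auto simp: sq_int_iff)
  have "ennreal (norm (LINT x|lborel. f x * g x)) \<le> (\<integral>\<^sup>+x. norm (f x * g x) \<partial>lborel)"
    by (rule integral_norm_bound_ennreal[OF sq_integrable_mult[OF f g]])
  also have "\<dots> = (\<integral>\<^sup>+x. ennreal (norm (f x)) * ennreal (norm (g x)) \<partial>lborel)"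
    by (simp add: norm_mult ennreal_mult)
  finally have "(ennreal (norm (LINT x|lborel. f x * g x)))\<^sup>2 \<le> (\<integral>\<^sup>+x. ennreal (norm (f x)) * ennreal (norm (g x)) \<partial>lborel)\<^sup>2"
    by (rule power_mono) simp
  also have "\<dots> \<le> (\<integral>\<^sup>+x. (ennreal (norm (f x)))\<^sup>2 \<partial>lborel) * (\<integral>\<^sup>+x. (ennreal (norm (g x)))\<^sup>2 \<partial>lborel)"
    by (rule Cauchy_Schwarz_nn_integral) auto
  also have "\<dots> = ennreal (sq_norm lborel f) * ennreal (sq_norm lborel g)"
    by (simp add: ennreal_power nn_integral_eq_integral sq_integrable_norm_sq[OF f] sq_integrable_norm_sq[OF g])
  also have "\<dots> = ennreal (sq_norm lborel f * sq_norm lborel g)"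
    by (simp add: ennreal_mult)
  finally show ?thesis
    by (simp add: ennreal_power ennreal_le_iff integral_nonneg_AE)
qed

lemma sq_norm_on_eq: "sq_norm_on A f = (LINT x|lborel. (norm (indicator A x *\<^sub>R f x))\<^sup>2)"
  by (intro Bochner_Integration.integral_cong refl) (auto simp: indicator_def)

lemma sq_norm_on_integrable:
  "sq_int f \<Longrightarrow> A \<in> sets borel \<Longrightarrow> integrable lborel (\<lambda>x. indicator A x * (norm (f x))\<^sup>2)"
  using integrable_mult_indicator[of A lborel "\<lambda>x. (norm (f x))\<^sup>2"] by (simp add: sq_int_iff)

lemma sq_norm_on_nonneg: "sq_norm_on A f \<ge> 0"
  by (intro integral_nonneg_AE) auto

lemma lborel_nn_integral_translate:
  fixes f :: "'a::euclidean_space \<Rightarrow> ennreal"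
  assumes [measurable]: "f \<in> borel_measurable borel"
  shows "(\<integral>\<^sup>+x. f (h + x) \<partial>lborel) = (\<integral>\<^sup>+x. f x \<partial>lborel)"
proof -
  have "(\<integral>\<^sup>+x. f x \<partial>lborel) = (\<integral>\<^sup>+x. f x \<partial>distr lborel borel ((+) h))" by (simp add: lborel_distr_plus)
  also have "\<dots> = (\<integral>\<^sup>+x. f (h + x) \<partial>lborel)" by (subst nn_integral_distr) auto
  finally show ?thesis ..
qed

lemma sq_int_indicator_const:
  assumes "A \<in> sets borel" "emeasure lborel A < \<infinity>"
  shows "sq_int (indicator A :: real^2 \<Rightarrow> complex)"
proof (rule sq_int_bound)
  show "integrable lborel (indicator A :: real^2 \<Rightarrow> real)" using assms by (simp add: integrable_indicator_iff)
qed (use assms in \<open>auto simp: indicator_def\<close>)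

lemma norm_box_diff_le:
  fixes a b x y :: "real^2"
  assumes "x \<in> cbox a b" "y \<in> cbox a b"
  shows "norm (x - y) \<le> norm (b - a)"
proof (rule norm_le_componentwise_cart)
  fix i
  have "a $ i \<le> x $ i" "x $ i \<le> b $ i" "a $ i \<le> y $ i" "y $ i \<le> b $ i"
    using assms by (auto simp: mem_box_cart)
  then show "norm ((x - y) $ i) \<le> norm ((b - a) $ i)" by simp
qed

lemma box_measure_pos:
  fixes a b :: "real^2"
  assumes "box a b \<noteq> {}"
  shows "measure lborel (box a b) > 0"
proof -
  have "measure lborel (box a b) = (\<Prod>i\<in>Basis. (b - a) \<bullet> i)"
    using assms by (subst measure_lborel_box) (auto simp: box_ne_empty less_imp_le)
  also have "\<dots> > 0" using assms by (intro prod_pos) (auto simp: box_ne_empty inner_diff_left)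
  finally show ?thesis .
qed

text \<open>
  The set of differences of points of a box is a box with sides twice as long; its area enters the
  constant of the Poincare inequality.
\<close>

lemma box_difference_measure:
  fixes a b :: "real^2"
  assumes "box a b \<noteq> {}"
  shows "emeasure lborel (box (a - b) (b - a)) = ennreal (4 * measure lborel (box a b))"
proof -
  have le: "a \<bullet> i \<le> b \<bullet> i" if "i \<in> Basis" for i
    using assms that by (auto simp: box_ne_empty less_imp_le)
  have dbl: "((b - a) - (a - b)) \<bullet> i = 2 * ((b - a) \<bullet> i)" for i
  proof -
    have "(b - a) - (a - b) = 2 *\<^sub>R (b - a)" by (simp add: scaleR_2)
    then show ?thesis by (simp only: inner_scaleR_left)
  qed
  have "emeasure lborel (box (a - b) (b - a)) = (\<Prod>i\<in>Basis. ((b - a) - (a - b)) \<bullet> i)"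
    using le by (intro emeasure_lborel_box) (auto simp: inner_diff_left)
  also have "(\<Prod>i\<in>Basis. ((b - a) - (a - b)) \<bullet> i) = (\<Prod>i\<in>Basis. 2 * ((b - a) \<bullet> i))"
    by (rule prod.cong[OF refl dbl])
  also have "\<dots> = 4 * (\<Prod>i\<in>Basis. (b - a) \<bullet> i)"
    by (simp only: prod.distrib prod_constant) simp
  also have "(\<Prod>i\<in>Basis. (b - a) \<bullet> i) = measure lborel (box a b)"
    using le by (subst measure_lborel_box) auto
  finally show ?thesis .
qed

text \<open>
  With \<open>Q\<close> the box and \<open>m\<close> its area, \<open>2 m \<integral>\<^sub>Q\<bar>U\<bar>\<^sup>2 - 2 \<bar>\<integral>\<^sub>Q U\<bar>\<^sup>2\<close> is the double integral of \<open>\<bar>U(y) - U(x)\<bar>\<^sup>2\<close> over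
  \<open>Q \<times> Q\<close>. After the substitution \<open>y = x + z\<close> and an exchange of the integrals, the inner integral over
  \<open>x\<close> is bounded by the translation estimate, since \<open>Q\<close> is convex; and only \<open>z\<close> in a box of area \<open>4 m\<close>
  contribute.
\<close>

lemma box_Poincare:
  fixes U :: "real^2 \<Rightarrow> complex" and G :: "real^2 \<Rightarrow> complex^2"
  assumes ne: "box a b \<noteq> {}" and U: "sq_int U" and G: "sq_int G" and grad: "distr_gradient (box a b) U G"
  shows "sq_norm_on (box a b) U \<le> 2 * (norm (b - a))\<^sup>2 * sq_norm_on (box a b) G
    + (norm (LINT x|lborel. U x * indicator (box a b) x))\<^sup>2 / measure lborel (box a b)"
proof -
  define Q where "Q = box a b"
  define m where "m = measure lborel Q"
  define E where "E = sq_norm_on Q G"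
  define N where "N = sq_norm_on Q U"
  define I where "I = (LINT x|lborel. U x * indicator Q x)"
  define d where "d = norm (b - a)"
  have Qo [measurable]: "Q \<in> sets borel" by (simp add: Q_def)
  have [measurable]: "U \<in> borel_measurable borel" using U by (simp add: sq_int_iff)
  have Qfin: "emeasure lborel Q < \<infinity>" unfolding Q_def by (intro emeasure_bounded_finite) simp
  have m: "m > 0" unfolding m_def Q_def by (rule box_measure_pos[OF ne])
  have intU: "integrable lborel (\<lambda>x. U x * indicator Q x)"
    by (intro sq_integrable_mult U sq_int_indicator_const Qo Qfin)
  have intN: "integrable lborel (\<lambda>x. indicator Q x * (norm (U x))\<^sup>2)" by (intro sq_norm_on_integrable U Qo)
  have int1: "integrable lborel (indicator Q :: _ \<Rightarrow> real)" using Qfin by (simp add: integrable_indicator_iff)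
  have mm: "(LINT x|lborel. indicator Q x) = m" by (simp add: m_def)
  have intRe: "integrable lborel (\<lambda>y. 2 * Re (c * (U y * indicator Q y)))" for c
    using integrable_mult_right[OF intU, of c] by (simp del: times_complex.sel)
  define F where "F x y = indicator Q x * (indicator Q y * (norm (U y - U x))\<^sup>2)" for x y
  have expand: "F x y = indicator Q x * ((norm (U x))\<^sup>2 * indicator Q y + indicator Q y * (norm (U y))\<^sup>2
      - 2 * Re (cnj (U x) * (U y * indicator Q y)))" for x y
    using norm_diff_cnj_sq[of "U y" "cnj (U x)"] by (auto simp: F_def indicator_def algebra_simps)
  have intF: "integrable lborel (F x)" for x
    unfolding expand[abs_def]
    by (rule integrable_mult_right, rule Bochner_Integration.integrable_diff, rule Bochner_Integration.integrable_add)
       (use int1 intN intRe in \<open>auto intro!: integrable_mult_right simp del: times_complex.sel\<close>)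
  have inner: "(LINT y|lborel. F x y) = indicator Q x * ((norm (U x))\<^sup>2 * m + N - 2 * Re (cnj (U x) * I))" for x
  proof -
    have "(LINT y|lborel. F x y) = indicator Q x * (LINT y|lborel. ((norm (U x))\<^sup>2 * indicator Q y + indicator Q y * (norm (U y))\<^sup>2
      - 2 * Re (cnj (U x) * (U y * indicator Q y))))"
      unfolding expand by (rule integral_mult_right_zero)
    also have "(LINT y|lborel. ((norm (U x))\<^sup>2 * indicator Q y + indicator Q y * (norm (U y))\<^sup>2
      - 2 * Re (cnj (U x) * (U y * indicator Q y))))
      = (LINT y|lborel. (norm (U x))\<^sup>2 * indicator Q y) + (LINT y|lborel. indicator Q y * (norm (U y))\<^sup>2)
      - (LINT y|lborel. 2 * Re (cnj (U x) * (U y * indicator Q y)))"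
      using int1 intN intRe
      by (subst Bochner_Integration.integral_diff)
         (auto simp del: times_complex.sel intro!: Bochner_Integration.integral_add)
    also have "(LINT y|lborel. 2 * Re (cnj (U x) * (U y * indicator Q y))) = 2 * Re (cnj (U x) * I)"
      using integrable_mult_right[OF intU, of "cnj (U x)"] by (simp del: times_complex.sel add: I_def)
    also have "(LINT y|lborel. (norm (U x))\<^sup>2 * indicator Q y) = (norm (U x))\<^sup>2 * m" by (simp add: m_def)
    finally show ?thesis by (simp only: N_def)
  qed
  have outer_eq: "indicator Q x * ((norm (U x))\<^sup>2 * m + N - 2 * Re (cnj (U x) * I))
      = m * (indicator Q x * (norm (U x))\<^sup>2) + N * indicator Q x - 2 * Re (cnj I * (U x * indicator Q x))" for x
    by (cases "x \<in> Q") (auto simp: algebra_simps)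
  have intouter: "integrable lborel (\<lambda>x. LINT y|lborel. F x y)"
    unfolding inner outer_eq
    by (rule Bochner_Integration.integrable_diff, rule Bochner_Integration.integrable_add)
       (use int1 intN intRe in \<open>auto intro!: integrable_mult_right simp del: times_complex.sel\<close>)
  have outer: "(LINT x|lborel. LINT y|lborel. F x y) = 2 * m * N - 2 * (norm I)\<^sup>2"
  proof -
    have "(LINT x|lborel. LINT y|lborel. F x y) = (LINT x|lborel. m * (indicator Q x * (norm (U x))\<^sup>2))
       + (LINT x|lborel. N * indicator Q x) - (LINT x|lborel. 2 * Re (cnj I * (U x * indicator Q x)))"
      unfolding inner outer_eq
      using int1 intN intRe
      by (subst Bochner_Integration.integral_diff)
         (auto simp del: times_complex.sel intro!: Bochner_Integration.integral_add)
    also have "(LINT x|lborel. 2 * Re (cnj I * (U x * indicator Q x))) = 2 * Re (cnj I * I)"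
      using integrable_mult_right[OF intU, of "cnj I"] by (simp del: times_complex.sel add: I_def)
    also have "Re (cnj I * I) = (norm I)\<^sup>2" unfolding cmod_power2 by (simp add: power2_eq_square)
    also have "(LINT x|lborel. m * (indicator Q x * (norm (U x))\<^sup>2)) = m * N" by (simp add: N_def)
    also have "(LINT x|lborel. N * indicator Q x) = N * m" by (simp add: m_def)
    finally show ?thesis by simp
  qed
  have [measurable]: "(\<lambda>y. F x y) \<in> borel_measurable borel" for x unfolding F_def by measurable
  have "ennreal (2 * m * N - 2 * (norm I)\<^sup>2) = (\<integral>\<^sup>+x. ennreal (LINT y|lborel. F x y) \<partial>lborel)"
    unfolding outer[symmetric]
    by (rule nn_integral_eq_integral[symmetric, OF intouter]) (auto intro!: integral_nonneg_AE simp: F_def)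
  also have "\<dots> = (\<integral>\<^sup>+x. \<integral>\<^sup>+y. ennreal (F x y) \<partial>lborel \<partial>lborel)"
    by (intro nn_integral_cong nn_integral_eq_integral[symmetric, OF intF]) (simp add: F_def)
  also have "\<dots> = (\<integral>\<^sup>+x. \<integral>\<^sup>+z. ennreal (F x (x + z)) \<partial>lborel \<partial>lborel)"
    by (intro nn_integral_cong lborel_nn_integral_translate[symmetric]) measurable
  also have "\<dots> = (\<integral>\<^sup>+z. \<integral>\<^sup>+x. ennreal (F x (x + z)) \<partial>lborel \<partial>lborel)"
    by (rule lborel_pair.Fubini'[symmetric]) (unfold F_def, measurable)
  also have "\<dots> \<le> (\<integral>\<^sup>+z. ennreal (d\<^sup>2 * E) * indicator (box (a - b) (b - a)) z \<partial>lborel)"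
  proof (rule nn_integral_mono)
    fix z :: "real^2"
    define K where "K = Q \<inter> ((\<lambda>x. x + z) -` Q)"
    have Ko: "open K" unfolding K_def Q_def
      by (rule open_Int[OF open_box open_vimage[OF open_box]]) (intro continuous_intros)
    have FK: "F x (x + z) = indicator K x * (norm (U (x + z) - U x))\<^sup>2" for x
      by (auto simp: F_def K_def indicator_def)
    show "(\<integral>\<^sup>+x. ennreal (F x (x + z)) \<partial>lborel) \<le> ennreal (d\<^sup>2 * E) * indicator (box (a - b) (b - a)) z"
    proof (cases "K = {}")
      case True then show ?thesis by (simp add: FK)
    next
      case False
      then obtain x where x: "x \<in> box a b" "x + z \<in> box a b" by (auto simp: K_def Q_def)
      then have zin: "z \<in> box (a - b) (b - a)"
        by (auto simp: mem_box_cart) (smt (verit, best))+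
      have "norm ((x + z) - x) \<le> norm (b - a)"
        using x box_subset_cbox by (intro norm_box_diff_le) blast+
      then have "(norm z)\<^sup>2 \<le> d\<^sup>2" unfolding d_def by (intro power_mono) auto
      have "(LINT x|lborel. indicator K x * (norm (U (x + z) - U x))\<^sup>2) \<le> (norm z)\<^sup>2 * sq_norm_on Q G"
      proof (rule translation_estimate[OF Ko _ U G])
        show "open Q" unfolding Q_def by (rule open_box)
        show "distr_gradient Q U G" using grad by (simp add: Q_def)
        fix x t assume "x \<in> K" "0 \<le> (t::real)" "t \<le> 1"
        then have "(1 - t) *\<^sub>R x + t *\<^sub>R (x + z) \<in> Q"
          using convex_box(2)[of a b] unfolding K_def Q_def convex_alt by auto
        then show "x + t *\<^sub>R z \<in> Q" by (simp add: algebra_simps)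
      qed
      also have "\<dots> \<le> d\<^sup>2 * E" unfolding E_def using \<open>(norm z)\<^sup>2 \<le> d\<^sup>2\<close> by (intro mult_right_mono sq_norm_on_nonneg)
      finally have le: "(LINT x|lborel. indicator K x * (norm (U (x + z) - U x))\<^sup>2) \<le> d\<^sup>2 * E" .
      have "(\<integral>\<^sup>+x. ennreal (F x (x + z)) \<partial>lborel) = ennreal (LINT x|lborel. indicator K x * (norm (U (x + z) - U x))\<^sup>2)"
        unfolding FK using Ko
        by (intro nn_integral_eq_integral sq_norm_on_integrable sq_integrable_diff sq_int_translate U) auto
      with le zin show ?thesis by (simp add: ennreal_leI)
    qed
  qed
  also have "\<dots> = ennreal (d\<^sup>2 * E) * emeasure lborel (box (a - b) (b - a))"
    by (rule nn_integral_cmult_indicator) simp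
  also have "\<dots> = ennreal (d\<^sup>2 * E) * ennreal (4 * m)" by (simp add: box_difference_measure[OF ne] m_def Q_def)
  also have "\<dots> = ennreal (d\<^sup>2 * E * (4 * m))" using m by (simp add: ennreal_mult'')
  finally have "2 * m * N - 2 * (norm I)\<^sup>2 \<le> d\<^sup>2 * E * (4 * m)"
    using m sq_norm_on_nonneg[of Q G] by (subst (asm) ennreal_le_iff) (auto simp: E_def)
  then have "N * m \<le> (2 * d\<^sup>2 * E) * m + (norm I)\<^sup>2" by (simp add: algebra_simps)
  then have "N \<le> ((2 * d\<^sup>2 * E) * m + (norm I)\<^sup>2) / m" using m by (simp add: pos_le_divide_eq)
  then have "N \<le> 2 * d\<^sup>2 * E + (norm I)\<^sup>2 / m" using m by (simp add: add_divide_distrib)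
  then show ?thesis unfolding N_def E_def I_def m_def d_def Q_def .
qed

section \<open>The compactness inequality\<close>

text \<open>
  If \<open>U\<close> has zero pairing with a test function close to the indicator of \<open>Q\<close>, then the integral of \<open>U\<close> over
  \<open>Q\<close> is small. This turns the means in the Poincare inequality into pairings with test functions.
\<close>

lemma sq_int_indicator_diff_pairing:
  fixes U \<phi> :: "real^2 \<Rightarrow> complex"
  assumes U: "sq_int U" and Q: "Q \<in> sets borel" "emeasure lborel Q < \<infinity>" "Q \<subseteq> D" and D: "D \<in> sets borel"
    and \<phi>: "test_function D \<phi>" and zero: "(LINT x|lborel. U x * \<phi> x) = 0"
  shows "(norm (LINT x|lborel. U x * indicator Q x))\<^sup>2
     \<le> sq_norm_on D U * (LINT x|lborel. (norm (\<phi> x - indicator Q x))\<^sup>2)"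
proof -
  have out: "\<phi> x = 0" if "x \<notin> D" for x using \<phi> that by (metis test_functionE subset_iff)
  have i\<phi>: "sq_int \<phi>" by (rule test_function_sq_int[OF \<phi>])
  have iQ: "sq_int (indicator Q :: _ \<Rightarrow> complex)" by (rule sq_int_indicator_const[OF Q(1,2)])
  have "(LINT x|lborel. (indicator D x *\<^sub>R U x) * (\<phi> x - indicator Q x)) = (LINT x|lborel. U x * \<phi> x - U x * indicator Q x)"
    using Q(3) out by (intro Bochner_Integration.integral_cong refl) (auto simp: indicator_def algebra_simps)
  also have "\<dots> = (LINT x|lborel. U x * \<phi> x) - (LINT x|lborel. U x * indicator Q x)"
    by (intro Bochner_Integration.integral_diff sq_integrable_mult U i\<phi> iQ)
  finally have "norm (LINT x|lborel. U x * indicator Q x) = norm (LINT x|lborel. (indicator D x *\<^sub>R U x) * (\<phi> x - indicator Q x))"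
    using zero by simp
  then show ?thesis
    using sq_int_Cauchy_Schwarz[OF sq_int_indicator[OF U D] sq_integrable_diff[OF i\<phi> iQ]]
    by (simp only: sq_norm_on_eq)
qed

text \<open>
  The boxes are the interiors of those cells of a sufficiently fine division of a large square that
  meet \<open>F\<close>. Only the faces of the cells are lost, and they form a null set. Disjointness matters later:
  it keeps the sum of the gradient integrals over the boxes below the integral over \<open>D\<close>.
\<close>

lemma compact_small_box_cover:
  fixes F D :: "(real^2) set"
  assumes F: "compact F" "F \<subseteq> D" and D: "open D" and d: "d > 0"
  obtains P :: "(real^2) set set" where "finite P"
    "\<And>Q. Q \<in> P \<Longrightarrow> \<exists>a b. Q = box a b \<and> Q \<noteq> {} \<and> Q \<subseteq> D \<and> norm (b - a) \<le> d"
    "disjoint P" "AE x in lborel. x \<in> F \<longrightarrow> x \<in> \<Union>P"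
proof -
  obtain r where r: "r > 0" "\<And>x y. x \<in> F \<Longrightarrow> y \<notin> D \<Longrightarrow> r \<le> dist x y"
  proof -
    have "closed (- D)" "F \<inter> - D = {}" using D F(2) by auto
    from separate_compact_closed[OF F(1) this] show ?thesis using that by (metis ComplI)
  qed
  define e where "e = min d r / 2"
  have e: "e > 0" "2 * e \<le> d" "2 * e \<le> r" using d r by (auto simp: e_def)
  obtain c where c: "F \<subseteq> cbox (- c) c" using compact_imp_bounded[OF F(1)] bounded_subset_cbox_symmetric by metis
  have "gauge (\<lambda>x::real^2. ball x e)" using e by (intro gauge_ball) auto
  then obtain p where p: "p tagged_division_of (cbox (- c) c)" "(\<lambda>x. ball x e) fine p"
    using fine_division_exists by metis
  have div: "(snd ` p) division_of (cbox (- c) c)" by (rule division_of_tagged_division[OF p(1)])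
  define P where "P = interior ` {k \<in> snd ` p. k \<inter> F \<noteq> {} \<and> interior k \<noteq> {}}"
  have boxes: "\<exists>a b. k = cbox a b" "k \<noteq> {}" if "k \<in> snd ` p" for k
    using division_ofD[OF div] that by auto
  show ?thesis
  proof
    show "finite P" unfolding P_def using division_ofD(1)[OF div] by simp
    show "disjoint P"
    proof (rule disjointI)
      fix A B assume AB: "A \<in> P" "B \<in> P" "A \<noteq> B"
      obtain k where k: "k \<in> snd ` p" "A = interior k" using AB(1) unfolding P_def by fast
      obtain l where l: "l \<in> snd ` p" "B = interior l" using AB(2) unfolding P_def by fast
      have "k \<noteq> l" using k l AB(3) by blast
      then show "A \<inter> B = {}" using division_ofD(5)[OF div k(1) l(1)] k l by simp
    qed
    fix Q assume "Q \<in> P"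
    then obtain k where k0: "k \<in> snd ` p" and k': "k \<inter> F \<noteq> {}" "interior k \<noteq> {}" "Q = interior k"
      unfolding P_def by fast
    obtain t where "(t, k) \<in> p" using k0 by force
    note k = this k'
    obtain a b where ab: "k = cbox a b" using boxes[of k] k(1) by force
    have sub: "k \<subseteq> ball t e" using p(2) k(1) by (auto simp: fine_def)
    have Q: "Q = box a b" using k(4) ab interior_cbox by simp
    have small: "dist x y < 2 * e" if "x \<in> k" "y \<in> k" for x y
    proof -
      have "dist t x < e" "dist t y < e" using sub that by auto
      then show ?thesis using dist_triangle[of x y t] by (simp add: dist_commute)
    qed
    obtain y where y: "y \<in> k" "y \<in> F" using k(2) by blast
    have "k \<subseteq> D"
    proof
      fix x assume "x \<in> k"
      then have "dist y x < r" using small[OF y(1), of x] e by simp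
      then show "x \<in> D" using r(2)[OF y(2), of x] by force
    qed
    moreover have "norm (b - a) \<le> d"
    proof -
      have "cbox a b \<noteq> {}" using boxes(2)[OF k0] ab by simp
      then have "a \<in> k" "b \<in> k" unfolding ab by (auto simp: box_ne_empty mem_box)
      from small[OF this(2,1)] e show ?thesis by (simp add: dist_norm)
    qed
    ultimately show "\<exists>a b. Q = box a b \<and> Q \<noteq> {} \<and> Q \<subseteq> D \<and> norm (b - a) \<le> d"
      using Q k(3,4) interior_subset by blast
  next
    define N where "N = (\<Union>k\<in>snd ` p. frontier k)"
    have "negligible (frontier k)" if "k \<in> snd ` p" for k
      using boxes(1)[OF that] negligible_frontier_interval by (auto simp: frontier_cbox)
    then have "negligible N" unfolding N_def
      using division_ofD(1)[OF div] by (intro negligible_Union) auto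
    moreover have "closed N" unfolding N_def using division_ofD(1)[OF div] by (intro closed_UN) auto
    ultimately have "N \<in> null_sets lborel"
      by (simp add: negligible_iff_null_sets null_sets_completion_iff)
    then have "AE x in lborel. x \<notin> N" by (rule AE_not_in)
    then show "AE x in lborel. x \<in> F \<longrightarrow> x \<in> \<Union>P"
    proof eventually_elim
      case (elim x)
      show ?case
      proof
        assume x: "x \<in> F"
        then have "x \<in> \<Union>(snd ` p)" using c division_ofD(6)[OF div] by auto
        then obtain k where k: "k \<in> snd ` p" "x \<in> k" by blast
        then have "closed k" using boxes[of k] closed_cbox by metis
        with k elim have "x \<in> interior k" by (auto simp: N_def frontier_def)
        with k x show "x \<in> \<Union>P" unfolding P_def by blast
      qed
    qed
  qed
qed

text \<open>
  Compactness away from the boundary. Cover \<open>F\<close> by disjoint boxes so small that the Poincare constant is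
  at most \<open>\<epsilon>\<close>, and let \<open>\<Phi>\<close> consist of one test function close to the indicator of each box.
\<close>

lemma compact_subset_estimate:
  fixes F D :: "(real^2) set"
  assumes F: "compact F" "F \<subseteq> D" and D: "open D" and \<epsilon>: "\<epsilon> > 0"
  shows "\<exists>\<Phi>. finite \<Phi> \<and> (\<forall>\<phi>\<in>\<Phi>. test_function D \<phi>) \<and>
    (\<forall>U G. sq_int U \<longrightarrow> sq_int G \<longrightarrow> distr_gradient D U G \<longrightarrow> (\<forall>\<phi>\<in>\<Phi>. (LINT x|lborel. U x * \<phi> x) = 0) \<longrightarrow>
       sq_norm_on F U \<le> \<epsilon> * (sq_norm_on D U + sq_norm_on D G))"
proof -
  define d where "d = sqrt (\<epsilon> / 2)"
  have d: "d > 0" "2 * d\<^sup>2 = \<epsilon>" using \<epsilon> by (auto simp: d_def)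
  obtain P where P: "finite P"
    "\<And>Q. Q \<in> P \<Longrightarrow> \<exists>a b. Q = box a b \<and> Q \<noteq> {} \<and> Q \<subseteq> D \<and> norm (b - a) \<le> d"
    "disjoint P" "AE x in lborel. x \<in> F \<longrightarrow> x \<in> \<Union>P"
    by (rule compact_small_box_cover[OF F D d(1)]) (blast intro: that)
  have Qs: "Q \<in> sets borel" "emeasure lborel Q < \<infinity>" "open Q" if "Q \<in> P" for Q
    using P(2)[OF that] by (auto intro: emeasure_bounded_finite[unfolded infinity_ennreal_def])
  have Qpos: "measure lborel Q > 0" if "Q \<in> P" for Q
    using P(2)[OF that] box_measure_pos by blast
  \<comment> \<open>The errors from all boxes together must not exceed \<open>\<epsilon>\<close> times the squared norm of \<open>U\<close>.\<close>
  define \<tau> where "\<tau> Q = \<epsilon> * measure lborel Q / (1 + real (card P))" for Q :: "(real^2) set"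
  have "\<forall>Q\<in>P. \<exists>\<phi>. test_function D \<phi> \<and> (LINT x|lborel. (norm (\<phi> x - indicator Q x))\<^sup>2) < \<tau> Q"
  proof
    fix Q assume Q: "Q \<in> P"
    have "\<tau> Q > 0" using Qpos[OF Q] \<epsilon> by (simp add: \<tau>_def)
    have "\<exists>\<phi>. test_function D \<phi> \<and> (LINT x|lborel. (norm (\<phi> x - indicator Q x))\<^sup>2) < \<tau> Q"
      using P(2)[OF Q] by (intro sq_int_test_approx D sq_int_indicator_const Qs Q \<open>\<tau> Q > 0\<close>) auto
    then show "\<exists>\<phi>. test_function D \<phi> \<and> (LINT x|lborel. (norm (\<phi> x - indicator Q x))\<^sup>2) < \<tau> Q" .
  qed
  then obtain \<phi> where \<phi>: "\<And>Q. Q \<in> P \<Longrightarrow> test_function D (\<phi> Q)"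
    "\<And>Q. Q \<in> P \<Longrightarrow> (LINT x|lborel. (norm (\<phi> Q x - indicator Q x))\<^sup>2) < \<tau> Q" by metis
  show ?thesis
  proof (intro exI[of _ "\<phi> ` P"] conjI allI impI)
    show "finite (\<phi> ` P)" "\<forall>\<psi>\<in>\<phi> ` P. test_function D \<psi>" using P(1) \<phi>(1) by auto
    fix U :: "real^2 \<Rightarrow> complex" and G :: "real^2 \<Rightarrow> complex^2"
    assume U: "sq_int U" and G: "sq_int G" and grad: "distr_gradient D U G"
      and zero: "\<forall>\<psi>\<in>\<phi> ` P. (LINT x|lborel. U x * \<psi> x) = 0"
    define N where "N = sq_norm_on D U"
    have N: "N \<ge> 0" unfolding N_def by (rule sq_norm_on_nonneg)
    have Ds: "D \<in> sets borel" "F \<in> sets borel"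
      using D borel_closed[OF compact_imp_closed[OF F(1)]] by auto
    have each: "sq_norm_on Q U \<le> \<epsilon> * sq_norm_on Q G + \<epsilon> / (1 + real (card P)) * N" if Q: "Q \<in> P" for Q
    proof -
      obtain a b where ab: "Q = box a b" "Q \<noteq> {}" "Q \<subseteq> D" "norm (b - a) \<le> d" using P(2)[OF Q] by blast
      have "sq_norm_on Q U \<le> 2 * (norm (b - a))\<^sup>2 * sq_norm_on Q G
         + (norm (LINT x|lborel. U x * indicator Q x))\<^sup>2 / measure lborel Q"
        using box_Poincare[of a b, OF _ U G] ab distr_gradient_mono[OF grad] by blast
      also have "\<dots> \<le> \<epsilon> * sq_norm_on Q G + (N * \<tau> Q) / measure lborel Q"
      proof (intro add_mono mult_right_mono divide_right_mono sq_norm_on_nonneg)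
        have "(norm (b - a))\<^sup>2 \<le> d\<^sup>2" by (intro power_mono ab) simp
        then show "2 * (norm (b - a))\<^sup>2 \<le> \<epsilon>" using d(2) by simp
        have "(norm (LINT x|lborel. U x * indicator Q x))\<^sup>2 \<le> N * (LINT x|lborel. (norm (\<phi> Q x - indicator Q x))\<^sup>2)"
          unfolding N_def using zero Q
          by (intro sq_int_indicator_diff_pairing U Qs Q ab Ds \<phi>) auto
        also have "\<dots> \<le> N * \<tau> Q" using \<phi>(2)[OF Q] N by (intro mult_left_mono) auto
        finally show "(norm (LINT x|lborel. U x * indicator Q x))\<^sup>2 \<le> N * \<tau> Q" .
      qed simp
      also have "(N * \<tau> Q) / measure lborel Q = \<epsilon> / (1 + real (card P)) * N"
        using Qpos[OF Q] by (simp add: \<tau>_def)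
      finally show ?thesis .
    qed
    have "sq_norm_on F U \<le> (LINT x|lborel. (\<Sum>Q\<in>P. indicator Q x * (norm (U x))\<^sup>2))"
    proof (rule integral_mono_AE)
      show "AE x in lborel. indicator F x * (norm (U x))\<^sup>2 \<le> (\<Sum>Q\<in>P. indicator Q x * (norm (U x))\<^sup>2)"
        using P(4)
      proof eventually_elim
        case (elim x)
        show ?case
        proof (cases "x \<in> F")
          case True
          then obtain Q where "Q \<in> P" "x \<in> Q" using elim by blast
          then have "indicator F x * (norm (U x))\<^sup>2 = indicator Q x * (norm (U x))\<^sup>2" using True by simp
          also have "\<dots> \<le> (\<Sum>Q\<in>P. indicator Q x * (norm (U x))\<^sup>2)"
            using \<open>Q \<in> P\<close> P(1) by (intro member_le_sum) auto
          finally show ?thesis .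
        qed (simp add: sum_nonneg)
      qed
    qed (use U Ds Qs in \<open>auto intro!: sq_norm_on_integrable\<close>)
    also have "\<dots> = (\<Sum>Q\<in>P. sq_norm_on Q U)"
      by (rule Bochner_Integration.integral_sum) (intro sq_norm_on_integrable U Qs)
    also have "\<dots> \<le> (\<Sum>Q\<in>P. \<epsilon> * sq_norm_on Q G + \<epsilon> / (1 + real (card P)) * N)"
      by (rule sum_mono) (rule each)
    also have "\<dots> = \<epsilon> * (\<Sum>Q\<in>P. sq_norm_on Q G) + real (card P) * (\<epsilon> / (1 + real (card P)) * N)"
      by (simp add: sum.distrib sum_distrib_left)
    also have "(\<Sum>Q\<in>P. sq_norm_on Q G) = (LINT x|lborel. (\<Sum>Q\<in>P. indicator Q x * (norm (G x))\<^sup>2))"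
      by (rule Bochner_Integration.integral_sum[symmetric]) (intro sq_norm_on_integrable G Qs)
    also have "\<dots> \<le> sq_norm_on D G"
    proof (rule integral_mono)
      fix x
      have "(\<Sum>Q\<in>P. indicator Q x) = (indicator (\<Union>P) x :: real)"
        using P(1,3) by (simp add: indicator_UN_disjoint[of P "\<lambda>Q. Q", simplified] disjoint_family_on_disjoint_image disjoint_def disjoint_family_on_def)
      also have "\<dots> \<le> indicator D x" using P(2) by (fastforce simp: indicator_def)
      finally show "(\<Sum>Q\<in>P. indicator Q x * (norm (G x))\<^sup>2) \<le> indicator D x * (norm (G x))\<^sup>2"
        unfolding sum_distrib_right[symmetric] by (intro mult_right_mono) auto
    qed (use G Ds Qs in \<open>auto intro!: sq_norm_on_integrable\<close>)
    also have "real (card P) * (\<epsilon> / (1 + real (card P)) * N) \<le> \<epsilon> * N"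
    proof -
      have "real (card P) / (1 + real (card P)) \<le> 1" by simp
      from mult_right_mono[OF this, of "\<epsilon> * N"] show ?thesis using \<epsilon> N by simp
    qed
    finally show "sq_norm_on F U \<le> \<epsilon> * (sq_norm_on D U + sq_norm_on D G)"
      using \<epsilon> by (simp add: N_def distrib_left)
  qed
qed

lemma real_analytic_on_continuous:
  assumes "real_analytic_on f S" "s \<in> S"
  shows "isCont f s"
proof -
  obtain a \<epsilon> where e: "\<epsilon> > 0" "\<And>t. \<bar>t - s\<bar> < \<epsilon> \<Longrightarrow> (\<lambda>n. a n * (t - s) ^ n) sums f t"
    using assms unfolding real_analytic_on_def by metis
  have "summable (\<lambda>n. a n * (\<epsilon> / 2) ^ n)" using e(2)[of "s + \<epsilon> / 2"] e(1) by (auto simp: sums_iff)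
  then have "isCont (\<lambda>x. \<Sum>n. a n * x ^ n) 0" using e(1) by (intro isCont_powser[of a "\<epsilon> / 2"]) auto
  then have "isCont (\<lambda>x. \<Sum>n. a n * x ^ n) (s - s)" by simp
  then have "isCont (\<lambda>t. \<Sum>n. a n * (t - s) ^ n) s"
    by (rule isCont_o2[rotated]) (intro continuous_intros)
  moreover have "eventually (\<lambda>t. f t = (\<Sum>n. a n * (t - s) ^ n)) (nhds s)"
    unfolding eventually_nhds_metric using e by (auto simp: sums_iff dist_real_def)
  ultimately show ?thesis by (simp add: isCont_cong)
qed

text \<open>
  A point of the closure of \<open>D\<close> near a boundary point lies on or above the graph that describes the
  boundary, by continuity of the graph function. Moving it in the normal direction of the chart lifts
  it strictly above the graph. At interior points the direction \<open>0\<close> will do.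
\<close>

lemma analytic_boundary_inward_direction:
  assumes D: "open D" and an: "analytic_boundary D" and p: "p \<in> closure D"
  shows "\<exists>\<rho>>0. \<exists>T>0. \<exists>n. norm n \<le> 1 \<and>
    (\<forall>t x. 0 < t \<longrightarrow> t \<le> T \<longrightarrow> x \<in> closure (D \<inter> ball p \<rho>) \<longrightarrow> x + t *\<^sub>R n \<in> D)"
proof (cases "p \<in> D")
  case True
  then obtain \<rho> where \<rho>: "\<rho> > 0" "cball p \<rho> \<subseteq> D" using D open_contains_cball by metis
  have "closure (D \<inter> ball p \<rho>) \<subseteq> cball p \<rho>" by (rule closure_minimal) auto
  with \<rho> show ?thesis by (intro exI[of _ \<rho>] conjI exI[of _ 1] exI[of _ 0]) auto
next
  case False
  then have "p \<in> frontier D" using p D by (simp add: frontier_def interior_open)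
  then obtain r e n \<gamma> where r: "r > 0" "norm e = 1" "norm n = 1" "e \<bullet> n = 0" "real_analytic_on \<gamma> {-r<..<r}"
     "D \<inter> ball p r = {x \<in> ball p r. \<gamma> ((x - p) \<bullet> e) < (x - p) \<bullet> n}"
    using bspec[OF an[unfolded analytic_boundary_def]] by blast
  have "x + t *\<^sub>R n \<in> D" if t: "0 < t" "t \<le> r / 4" and x: "x \<in> closure (D \<inter> ball p (r / 2))" for t x
  proof -
    have small: "\<bar>(y - p) \<bullet> e\<bar> \<le> norm (y - p)" for y
      using Cauchy_Schwarz_ineq2[of "y - p" e] r(2) by simp
    have "closure (D \<inter> ball p (r / 2)) \<subseteq> cball p (r / 2)" by (rule closure_minimal) auto
    with x have xr: "norm (x - p) \<le> r / 2" by (auto simp: dist_norm norm_minus_commute)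
    obtain X where X: "\<And>i. X i \<in> D \<inter> ball p (r / 2)" "X \<longlonglongrightarrow> x" using x closure_sequential by metis
    have "(x - p) \<bullet> e \<in> {-r<..<r}" using small[of x] xr r(1) by auto
    then have "isCont \<gamma> ((x - p) \<bullet> e)" by (rule real_analytic_on_continuous[OF r(5)])
    then have "(\<lambda>i. \<gamma> ((X i - p) \<bullet> e)) \<longlonglongrightarrow> \<gamma> ((x - p) \<bullet> e)"
      by (rule isCont_tendsto_compose) (intro tendsto_intros X)
    moreover have "(\<lambda>i. (X i - p) \<bullet> n) \<longlonglongrightarrow> (x - p) \<bullet> n" by (intro tendsto_intros X)
    moreover have "\<gamma> ((X i - p) \<bullet> e) \<le> (X i - p) \<bullet> n" for i
    proof -
      have "X i \<in> D \<inter> ball p r" using X(1)[of i] r(1) by auto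
      then show ?thesis unfolding r(6) by simp
    qed
    ultimately have le: "\<gamma> ((x - p) \<bullet> e) \<le> (x - p) \<bullet> n" by (intro LIMSEQ_le) auto
    have eq: "(x + t *\<^sub>R n - p) \<bullet> e = (x - p) \<bullet> e" "(x + t *\<^sub>R n - p) \<bullet> n = (x - p) \<bullet> n + t"
      using r(3,4) by (auto simp: inner_add_left inner_diff_left inner_commute[of n e] dot_square_norm)
    have "norm (x + t *\<^sub>R n - p) \<le> norm (x - p) + norm (t *\<^sub>R n)" using norm_triangle_ineq[of "x - p" "t *\<^sub>R n"] by (simp add: algebra_simps)
    also have "\<dots> < r" using xr t r by simp
    finally have "x + t *\<^sub>R n \<in> ball p r" by (simp add: dist_norm norm_minus_commute)
    moreover have "\<gamma> ((x + t *\<^sub>R n - p) \<bullet> e) < (x + t *\<^sub>R n - p) \<bullet> n" unfolding eq using le t by simp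
    ultimately have "x + t *\<^sub>R n \<in> D \<inter> ball p r" unfolding r(6) by blast
    then show ?thesis by blast
  qed
  moreover have "r / 2 > 0" "r / 4 > 0" "norm n \<le> 1" using r by auto
  ultimately show ?thesis by blast
qed

text \<open>
  A quantitative form of the compactness of the embedding of \<open>H\<^sup>1(D)\<close> into \<open>L\<^sup>2(D)\<close>: on a subspace of finite
  codimension, the \<open>L\<^sup>2\<close> norm is a small fraction of the \<open>H\<^sup>1\<close> norm. Finitely many pieces \<open>K p\<close> of \<open>D\<close> are
  translated by \<open>\<tau>\<close> times an inward direction into a common compact subset \<open>F\<close> of \<open>D\<close>. By the translation
  estimate this changes \<open>U\<close> by at most \<open>\<tau>\<close> times the norm of its gradient, and on \<open>F\<close> the previous estimate
  applies. The number of pieces does not depend on \<open>\<tau>\<close>, which can therefore be chosen last.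
\<close>

proposition compactness_inequality:
  assumes D: "open D" and bd: "bounded D" and an: "analytic_boundary D" and \<epsilon>: "\<epsilon> > 0"
  obtains \<Phi> where "finite \<Phi>" "\<And>\<phi>. \<phi> \<in> \<Phi> \<Longrightarrow> test_function D \<phi>"
    "\<And>U G. sq_int U \<Longrightarrow> sq_int G \<Longrightarrow> distr_gradient D U G \<Longrightarrow>
      (\<And>\<phi>. \<phi> \<in> \<Phi> \<Longrightarrow> (LINT x|lborel. U x * \<phi> x) = 0) \<Longrightarrow>
      sq_norm_on D U \<le> \<epsilon> * (sq_norm_on D U + sq_norm_on D G)"
proof -
  obtain \<rho> :: "real^2 \<Rightarrow> real" and T :: "real^2 \<Rightarrow> real" and n :: "real^2 \<Rightarrow> real^2" where
    \<rho>: "\<And>p. p \<in> closure D \<Longrightarrow> \<rho> p > 0" and T: "\<And>p. p \<in> closure D \<Longrightarrow> T p > 0"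
    and n: "\<And>p. p \<in> closure D \<Longrightarrow> norm (n p) \<le> 1"
    and push: "\<And>p t x. p \<in> closure D \<Longrightarrow> 0 < t \<Longrightarrow> t \<le> T p \<Longrightarrow> x \<in> closure (D \<inter> ball p (\<rho> p)) \<Longrightarrow> x + t *\<^sub>R n p \<in> D"
    using analytic_boundary_inward_direction[OF D an] by metis
  have cD: "compact (closure D)" using bd by (simp add: compact_closure)
  obtain P where P: "P \<subseteq> closure D" "finite P" "closure D \<subseteq> (\<Union>p\<in>P. ball p (\<rho> p))"
  proof (rule compactE_image[OF cD, of "closure D" "\<lambda>p. ball p (\<rho> p)"])
    show "closure D \<subseteq> (\<Union>p\<in>closure D. ball p (\<rho> p))" using \<rho> by force
  qed auto
  define N where "N = 1 + real (card P)"
  have N: "N \<ge> 1" by (simp add: N_def)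
  \<comment> \<open>The bound by the square root makes the translation errors of all pieces add up to at most \<open>\<epsilon> / 2\<close>.\<close>
  define \<tau> where "\<tau> = Min (insert (sqrt (\<epsilon> / (4 * N))) (T ` P))"
  have \<tau>: "\<tau> > 0" "\<tau> \<le> sqrt (\<epsilon> / (4 * N))" "\<And>p. p \<in> P \<Longrightarrow> \<tau> \<le> T p"
    unfolding \<tau>_def using P T \<epsilon> N by auto
  have \<tau>2: "\<tau>\<^sup>2 \<le> \<epsilon> / (4 * N)"
  proof -
    have "\<tau>\<^sup>2 \<le> (sqrt (\<epsilon> / (4 * N)))\<^sup>2" using \<tau> by (intro power_mono) auto
    then show ?thesis using \<epsilon> N by simp
  qed
  define F where "F = (\<Union>p\<in>P. (\<lambda>x. x + \<tau> *\<^sub>R n p) ` closure (D \<inter> ball p (\<rho> p)))"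
  have F: "compact F" "F \<subseteq> D"
  proof -
    have "compact (closure (D \<inter> ball p (\<rho> p)))" for p using bounded_subset[OF bd Int_lower1] by (simp add: compact_closure)
    then show "compact F" unfolding F_def using P(2)
      by (intro compact_UN compact_continuous_image continuous_intros) auto
    show "F \<subseteq> D" unfolding F_def using push P(1) \<tau>(1,3) by blast
  qed
  define \<epsilon>' where "\<epsilon>' = \<epsilon> / (4 * N)"
  have "\<epsilon>' > 0" using \<epsilon> N by (simp add: \<epsilon>'_def)
  from compact_subset_estimate[OF F D this] obtain \<Phi> where \<Phi>: "finite \<Phi>" "\<forall>\<phi>\<in>\<Phi>. test_function D \<phi>"
    "\<And>U G. sq_int U \<Longrightarrow> sq_int G \<Longrightarrow> distr_gradient D U G \<Longrightarrow> (\<forall>\<phi>\<in>\<Phi>. (LINT x|lborel. U x * \<phi> x) = 0) \<Longrightarrow>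
       sq_norm_on F U \<le> \<epsilon>' * (sq_norm_on D U + sq_norm_on D G)"
    by (elim exE conjE) (blast intro: that)
  show ?thesis
  proof
    show "finite \<Phi>" "\<And>\<phi>. \<phi> \<in> \<Phi> \<Longrightarrow> test_function D \<phi>" using \<Phi> by auto
    fix U :: "real^2 \<Rightarrow> complex" and G :: "real^2 \<Rightarrow> complex^2"
    assume U: "sq_int U" and G: "sq_int G" and grad: "distr_gradient D U G"
      and zero: "\<And>\<phi>. \<phi> \<in> \<Phi> \<Longrightarrow> (LINT x|lborel. U x * \<phi> x) = 0"
    define A where "A = sq_norm_on D U"
    define E where "E = sq_norm_on D G"
    have AE: "A \<ge> 0" "E \<ge> 0" unfolding A_def E_def by (rule sq_norm_on_nonneg)+
    have Ds: "D \<in> sets borel" "F \<in> sets borel"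
      using D borel_closed[OF compact_imp_closed[OF F(1)]] by auto
    note [measurable] = Ds sq_int_measurable[OF U]
    have FU: "sq_norm_on F U \<le> \<epsilon>' * (A + E)" unfolding A_def E_def using \<Phi>(3)[OF U G grad] zero by blast
    define K where "K p = D \<inter> ball p (\<rho> p)" for p
    have Ko: "open (K p)" "K p \<in> sets borel" for p unfolding K_def using D by auto
    have each: "sq_norm_on (K p) U \<le> 2 * \<epsilon>' * (A + E) + 2 * (\<tau>\<^sup>2 * E)" if p: "p \<in> P" for p
    proof -
      have pc: "p \<in> closure D" using p P by blast
      define h where "h = \<tau> *\<^sub>R n p"
      have inF: "x + h \<in> F" if "x \<in> K p" for x
        using that p closure_subset[of "K p"] unfolding F_def h_def K_def by blast
      have iT: "integrable lborel (\<lambda>x. indicator (K p) x * (norm (U (x + h) - U x))\<^sup>2)"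
        by (intro sq_norm_on_integrable sq_integrable_diff sq_int_translate U Ko)
      have iF: "integrable lborel (\<lambda>x. indicator F (x + h) * (norm (U (x + h)))\<^sup>2)"
        by (rule lborel_integrable_translate[of "\<lambda>x. indicator F x * (norm (U x))\<^sup>2"])
           (use Ds in \<open>auto intro!: sq_norm_on_integrable U\<close>)
      have "sq_norm_on (K p) U \<le> (LINT x|lborel. 2 * (indicator F (x + h) * (norm (U (x + h)))\<^sup>2)
          + 2 * (indicator (K p) x * (norm (U (x + h) - U x))\<^sup>2))"
      proof (rule integral_mono)
        show "integrable lborel (\<lambda>x. indicator (K p) x * (norm (U x))\<^sup>2)" by (intro sq_norm_on_integrable U Ko)
        show "integrable lborel (\<lambda>x. 2 * (indicator F (x + h) * (norm (U (x + h)))\<^sup>2)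
          + 2 * (indicator (K p) x * (norm (U (x + h) - U x))\<^sup>2))" using iT iF by simp
        fix x
        show "indicator (K p) x * (norm (U x))\<^sup>2 \<le> 2 * (indicator F (x + h) * (norm (U (x + h)))\<^sup>2)
          + 2 * (indicator (K p) x * (norm (U (x + h) - U x))\<^sup>2)"
        proof (cases "x \<in> K p")
          case True
          then show ?thesis using inF[OF True] norm_add_sq_le[of "U (x + h)" "U x - U (x + h)"]
            by (simp add: norm_minus_commute)
        qed simp
      qed
      also have "\<dots> = 2 * (LINT x|lborel. indicator F (x + h) * (norm (U (x + h)))\<^sup>2)
          + 2 * (LINT x|lborel. indicator (K p) x * (norm (U (x + h) - U x))\<^sup>2)"
        using iT iF by simp
      also have "(LINT x|lborel. indicator F (x + h) * (norm (U (x + h)))\<^sup>2) = sq_norm_on F U"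
        by (rule lborel_integral_translate[of "\<lambda>x. indicator F x * (norm (U x))\<^sup>2"]) measurable
      also have "(LINT x|lborel. indicator (K p) x * (norm (U (x + h) - U x))\<^sup>2) \<le> (norm h)\<^sup>2 * E"
        unfolding E_def
      proof (rule translation_estimate[OF Ko(1) D U G grad])
        fix x t assume x: "x \<in> K p" and t: "0 \<le> (t::real)" "t \<le> 1"
        show "x + t *\<^sub>R h \<in> D"
        proof (cases "t = 0")
          case True then show ?thesis using x by (simp add: K_def)
        next
          case False
          have "t * \<tau> \<le> 1 * T p" using t \<tau>(1) \<tau>(3)[OF p] by (intro mult_mono) auto
          then have "x + (t * \<tau>) *\<^sub>R n p \<in> D"
            using False t \<tau>(1) x closure_subset[of "K p"] unfolding K_def
            by (intro push[OF pc]) auto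
          then show ?thesis by (simp add: h_def)
        qed
      qed
      also have "(norm h)\<^sup>2 * E \<le> \<tau>\<^sup>2 * E"
      proof -
        have "norm h \<le> \<tau>" unfolding h_def using n[OF pc] \<tau>(1) by (simp add: mult_left_le)
        then show ?thesis using AE by (intro mult_right_mono power_mono) auto
      qed
      finally show ?thesis using FU by simp
    qed
    have "A \<le> (LINT x|lborel. (\<Sum>p\<in>P. indicator (K p) x * (norm (U x))\<^sup>2))"
      unfolding A_def
    proof (rule integral_mono)
      fix x
      show "indicator D x * (norm (U x))\<^sup>2 \<le> (\<Sum>p\<in>P. indicator (K p) x * (norm (U x))\<^sup>2)"
      proof (cases "x \<in> D")
        case True
        then obtain p where p: "p \<in> P" "x \<in> ball p (\<rho> p)" using P(3) closure_subset by blast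
        then have "indicator D x * (norm (U x))\<^sup>2 = indicator (K p) x * (norm (U x))\<^sup>2" using True by (simp add: K_def)
        also have "\<dots> \<le> (\<Sum>p\<in>P. indicator (K p) x * (norm (U x))\<^sup>2)"
          using p P(2) by (intro member_le_sum) auto
        finally show ?thesis .
      qed (simp add: sum_nonneg)
    qed (use U Ds Ko in \<open>auto intro!: sq_norm_on_integrable\<close>)
    also have "\<dots> = (\<Sum>p\<in>P. sq_norm_on (K p) U)"
      by (rule Bochner_Integration.integral_sum) (intro sq_norm_on_integrable U Ko)
    also have "\<dots> \<le> (\<Sum>p\<in>P. 2 * \<epsilon>' * (A + E) + 2 * (\<tau>\<^sup>2 * E))"
      by (rule sum_mono) (rule each)
    also have "\<dots> = real (card P) * (2 * \<epsilon>' * (A + E) + 2 * (\<tau>\<^sup>2 * E))" by simp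
    also have "\<dots> \<le> N * (2 * \<epsilon>' * (A + E) + 2 * (\<epsilon>' * (A + E)))"
    proof (rule mult_mono)
      have "\<tau>\<^sup>2 * E \<le> \<epsilon>' * (A + E)" using \<tau>2 AE \<open>\<epsilon>' > 0\<close> unfolding \<epsilon>'_def by (intro mult_mono) auto
      then show "2 * \<epsilon>' * (A + E) + 2 * (\<tau>\<^sup>2 * E) \<le> 2 * \<epsilon>' * (A + E) + 2 * (\<epsilon>' * (A + E))" by simp
      show "real (card P) \<le> N" "0 \<le> N" using N by (auto simp: N_def)
      show "0 \<le> 2 * \<epsilon>' * (A + E) + 2 * (\<tau>\<^sup>2 * E)" using AE \<open>\<epsilon>' > 0\<close> by simp
    qed
    also have "\<dots> = \<epsilon> * (A + E)" using N by (simp add: \<epsilon>'_def field_simps)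
    finally show "sq_norm_on D U \<le> \<epsilon> * (sq_norm_on D U + sq_norm_on D G)" unfolding A_def E_def .
  qed
qed

section \<open>Borel representatives and uniqueness of weak derivatives\<close>

lemma L2_iff: "L2 \<Omega> u \<longleftrightarrow> sq_integrable (lebesgue_on \<Omega>) u"
  by (simp add: L2_def sq_integrable_def)

lemma lebesgue_borel_representative:
  fixes f :: "'a::euclidean_space \<Rightarrow> 'b::euclidean_space"
  assumes f: "f \<in> borel_measurable lebesgue"
  shows "\<exists>g\<in>borel_measurable borel. AE x in lebesgue. f x = g x"
proof -
  have "\<exists>g\<in>borel_measurable borel. AE x in lebesgue. f x \<bullet> i = (g x :: real)" for i
  proof -
    have "(\<lambda>x. f x \<bullet> i) \<in> borel_measurable lebesgue" using f by measurable
    from completion_ex_borel_measurable_real[OF this] obtain g where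
      g: "g \<in> borel_measurable lborel" "AE x in lborel. f x \<bullet> i = g x" by blast
    then show ?thesis using AE_completion[OF g(2)] by auto
  qed
  then obtain g where g: "\<And>i. g i \<in> borel_measurable borel" "\<And>i. AE x in lebesgue. f x \<bullet> i = (g i x :: real)"
    by metis
  show ?thesis
  proof (rule bexI[of _ "\<lambda>x. \<Sum>i\<in>Basis. g i x *\<^sub>R i"])
    have "AE x in lebesgue. \<forall>i\<in>Basis. f x \<bullet> i = g i x" using g(2) by (intro AE_finite_allI) auto
    then show "AE x in lebesgue. f x = (\<Sum>i\<in>Basis. g i x *\<^sub>R i)"
    proof eventually_elim
      case (elim x)
      have "f x = (\<Sum>i\<in>Basis. (f x \<bullet> i) *\<^sub>R i)" by (simp add: euclidean_representation)
      also have "\<dots> = (\<Sum>i\<in>Basis. g i x *\<^sub>R i)" using elim by (intro sum.cong) auto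
      finally show ?case .
    qed
  qed (use g(1) in measurable)
qed

text \<open>
  Translations and iterated integrals are convenient for Borel functions on the plane, whereas the
  spaces over \<open>\<Omega>\<close> consist of Lebesgue measurable functions. The representative vanishes outside \<open>\<Omega>\<close>, so that
  integrals over \<open>\<Omega>\<close> become integrals over the plane.
\<close>

definition borel_rep :: "(real^2) set \<Rightarrow> (real^2 \<Rightarrow> 'b::euclidean_space) \<Rightarrow> (real^2 \<Rightarrow> 'b) \<Rightarrow> bool" where
  "borel_rep \<Omega> u U \<longleftrightarrow> U \<in> borel_measurable borel \<and> (\<forall>x. x \<notin> \<Omega> \<longrightarrow> U x = 0) \<and>
     (AE x in lebesgue. indicator \<Omega> x *\<^sub>R u x = U x)"

lemma lebesgue_on_measurable_iff:
  fixes f :: "real^2 \<Rightarrow> 'b::euclidean_space"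
  assumes "open \<Omega>"
  shows "f \<in> borel_measurable (lebesgue_on \<Omega>) \<longleftrightarrow> (\<lambda>x. indicator \<Omega> x *\<^sub>R f x) \<in> borel_measurable lebesgue"
  using assms by (intro borel_measurable_restrict_space_iff) auto

lemma borel_rep_exists:
  fixes u :: "real^2 \<Rightarrow> 'b::euclidean_space"
  assumes \<Omega>: "open \<Omega>" and u: "u \<in> borel_measurable (lebesgue_on \<Omega>)"
  shows "\<exists>U. borel_rep \<Omega> u U"
proof -
  obtain g where g: "g \<in> borel_measurable borel" "AE x in lebesgue. indicator \<Omega> x *\<^sub>R u x = g x"
    using lebesgue_borel_representative u lebesgue_on_measurable_iff[OF \<Omega>, of u] by blast
  have [measurable]: "\<Omega> \<in> sets borel" using \<Omega> by simp
  note [measurable] = g(1)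
  have "AE x in lebesgue. indicator \<Omega> x *\<^sub>R u x = indicator \<Omega> x *\<^sub>R g x"
    using g(2) by eventually_elim (auto simp: indicator_def)
  then have "borel_rep \<Omega> u (\<lambda>x. indicator \<Omega> x *\<^sub>R g x)"
    unfolding borel_rep_def by auto
  then show ?thesis by (intro exI[of _ "\<lambda>x. indicator \<Omega> x *\<^sub>R g x"])
qed

lemma AE_lebesgue_on_iff:
  "open \<Omega> \<Longrightarrow> (AE x in lebesgue_on \<Omega>. P x) \<longleftrightarrow> (AE x in (lebesgue :: (real^2) measure). x \<in> \<Omega> \<longrightarrow> P x)"
  by (intro AE_restrict_space_iff) auto

lemma integral_lebesgue_on_rep:
  fixes f :: "real^2 \<Rightarrow> 'b::euclidean_space"
  assumes \<Omega>: "open \<Omega>" and f: "f \<in> borel_measurable (lebesgue_on \<Omega>)" and F: "borel_rep \<Omega> f F"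
  shows "(LINT x|lebesgue_on \<Omega>. f x) = (LINT x|lborel. F x)"
proof -
  have Fm: "F \<in> borel_measurable lborel" using F by (simp add: borel_rep_def)
  have "(LINT x|lebesgue_on \<Omega>. f x) = (LINT x|lebesgue. indicator \<Omega> x *\<^sub>R f x)"
    using \<Omega> by (intro integral_restrict_space) auto
  also have "\<dots> = (LINT x|lebesgue. F x)"
    using F by (intro integral_cong_AE lebesgue_on_measurable_iff[OF \<Omega>, THEN iffD1, OF f] measurable_completion[OF Fm])
      (simp add: borel_rep_def)
  also have "\<dots> = (LINT x|lborel. F x)" by (rule integral_completion[OF Fm])
  finally show ?thesis .
qed

lemma integrable_lebesgue_on_rep:
  fixes f :: "real^2 \<Rightarrow> 'b::euclidean_space"
  assumes \<Omega>: "open \<Omega>" and f: "integrable (lebesgue_on \<Omega>) f" and F: "borel_rep \<Omega> f F"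
  shows "integrable lborel F"
proof -
  have Fm: "F \<in> borel_measurable lborel" using F by (simp add: borel_rep_def)
  have "integrable lebesgue (\<lambda>x. indicator \<Omega> x *\<^sub>R f x)"
    using \<Omega> f by (subst (asm) integrable_restrict_space) auto
  then have "integrable lebesgue F"
    by (rule integrable_cong_AE_imp[OF _ measurable_completion[OF Fm]]) (use F in \<open>simp add: borel_rep_def\<close>)
  then show ?thesis by (simp add: integrable_completion[OF Fm])
qed

lemma borel_rep_norm_sq: "borel_rep \<Omega> u U \<Longrightarrow> borel_rep \<Omega> (\<lambda>x. (norm (u x))\<^sup>2) (\<lambda>x. (norm (U x))\<^sup>2)"
  unfolding borel_rep_def
  by (auto elim!: eventually_mono simp: indicator_def split: if_splits)

lemma borel_rep_mult:
  fixes u :: "real^2 \<Rightarrow> complex"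
  shows "borel_rep \<Omega> u U \<Longrightarrow> \<phi> \<in> borel_measurable borel \<Longrightarrow> borel_rep \<Omega> (\<lambda>x. u x * \<phi> x) (\<lambda>x. U x * \<phi> x)"
  unfolding borel_rep_def
  by (auto elim!: eventually_mono simp: indicator_def split: if_splits)

lemma borel_rep_component:
  fixes u :: "real^2 \<Rightarrow> complex^2"
  shows "borel_rep \<Omega> u U \<Longrightarrow> borel_rep \<Omega> (\<lambda>x. u x $ i) (\<lambda>x. U x $ i)"
  unfolding borel_rep_def
  by (auto elim!: eventually_mono intro: measurable_compose[OF _ borel_measurable_vec_nth]
      simp: indicator_def split: if_splits)

lemma L2_rep:
  assumes \<Omega>: "open \<Omega>" and u: "L2 \<Omega> u"
  obtains U where "sq_int U" "borel_rep \<Omega> u U"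
    "sq_norm (lebesgue_on \<Omega>) u = sq_norm_on \<Omega> U"
proof -
  obtain U where U: "borel_rep \<Omega> u U" using borel_rep_exists[OF \<Omega>] u by (auto simp: L2_def)
  have "integrable lborel (\<lambda>x. (norm (U x))\<^sup>2)"
    using integrable_lebesgue_on_rep[OF \<Omega> _ borel_rep_norm_sq[OF U]] u by (simp add: L2_def)
  moreover have "sq_norm (lebesgue_on \<Omega>) u = sq_norm lborel U"
    using u by (intro integral_lebesgue_on_rep[OF \<Omega> _ borel_rep_norm_sq[OF U]]) (auto simp: L2_def)
  moreover have "sq_norm lborel U = sq_norm_on \<Omega> U"
    using U by (intro Bochner_Integration.integral_cong refl) (auto simp: borel_rep_def indicator_def)
  ultimately show ?thesis using U by (intro that[of U]) (auto simp: sq_int_iff borel_rep_def)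
qed

lemma borel_measurable_lebesgue_on:
  "f \<in> borel_measurable borel \<Longrightarrow> f \<in> borel_measurable (lebesgue_on \<Omega>)"
  by (intro measurable_restrict_space1 measurable_completion) simp

lemma L2_pairing_rep:
  fixes u :: "real^2 \<Rightarrow> complex"
  assumes "open \<Omega>" "u \<in> borel_measurable (lebesgue_on \<Omega>)" "borel_rep \<Omega> u U" "\<phi> \<in> borel_measurable borel"
  shows "(LINT x|lebesgue_on \<Omega>. u x * \<phi> x) = (LINT x|lborel. U x * \<phi> x)"
  by (rule integral_lebesgue_on_rep[OF assms(1) borel_measurable_times borel_rep_mult[OF assms(3,4)]])
     (intro assms(2) borel_measurable_lebesgue_on[OF assms(4)])+

lemma L2_component: "L2 \<Omega> (g :: real^2 \<Rightarrow> complex^2) \<Longrightarrow> L2 \<Omega> (\<lambda>x. g x $ i)"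
  by (simp add: L2_iff sq_integrable_component)

lemma L2_measurable: "L2 \<Omega> u \<Longrightarrow> u \<in> borel_measurable (lebesgue_on \<Omega>)"
  by (simp add: L2_def)

corollary H1_compactness_inequality:
  assumes D: "open D" and bd: "bounded D" and an: "analytic_boundary D" and \<epsilon>: "\<epsilon> > 0"
  obtains \<Phi> where "finite \<Phi>" "\<And>\<phi>. \<phi> \<in> \<Phi> \<Longrightarrow> test_function D \<phi>"
    "\<And>u g. L2 D u \<Longrightarrow> L2 D g \<Longrightarrow> has_weak_gradient D u g \<Longrightarrow>
      (\<And>\<phi>. \<phi> \<in> \<Phi> \<Longrightarrow> (LINT x|lebesgue_on D. u x * \<phi> x) = 0) \<Longrightarrow>
      sq_norm (lebesgue_on D) u
        \<le> \<epsilon> * (sq_norm (lebesgue_on D) u + sq_norm (lebesgue_on D) g)"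
proof (rule compactness_inequality[OF assms])
  fix \<Phi> assume fin: "finite \<Phi>" and test: "\<And>\<phi>. \<phi> \<in> \<Phi> \<Longrightarrow> test_function D \<phi>"
    and ineq: "\<And>U G. sq_int U \<Longrightarrow> sq_int G \<Longrightarrow> distr_gradient D U G \<Longrightarrow>
      (\<And>\<phi>. \<phi> \<in> \<Phi> \<Longrightarrow> (LINT x|lborel. U x * \<phi> x) = 0) \<Longrightarrow>
      sq_norm_on D U \<le> \<epsilon> * (sq_norm_on D U + sq_norm_on D G)"
  show ?thesis
  proof (rule that[OF fin test])
    fix u g assume u: "L2 D u" and g: "L2 D g" and grad: "has_weak_gradient D u g"
      and zero: "\<And>\<phi>. \<phi> \<in> \<Phi> \<Longrightarrow> (LINT x|lebesgue_on D. u x * \<phi> x) = 0"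
    obtain U where U: "sq_int U" "borel_rep D u U" "sq_norm (lebesgue_on D) u = sq_norm_on D U"
      using L2_rep[OF D u] by blast
    obtain G where G: "sq_int G" "borel_rep D g G" "sq_norm (lebesgue_on D) g = sq_norm_on D G"
      using L2_rep[OF D g] by blast
    have "distr_gradient D U G" unfolding distr_gradient_def
    proof (intro allI impI)
      fix \<phi> i assume \<phi>: "test_function D \<phi>"
      have "(LINT x|lborel. U x * partial_deriv i \<phi> x) = (LINT x|lebesgue_on D. u x * partial_deriv i \<phi> x)"
        by (rule L2_pairing_rep[symmetric, OF D L2_measurable[OF u] U(2)
              test_function_measurable[OF test_function_partial_deriv[OF \<phi>]]])
      also have "\<dots> = - (LINT x|lebesgue_on D. g x $ i * \<phi> x)"
        using grad \<phi> by (simp add: has_weak_gradient_def)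
      also have "(LINT x|lebesgue_on D. g x $ i * \<phi> x) = (LINT x|lborel. G x $ i * \<phi> x)"
        by (rule L2_pairing_rep[OF D L2_measurable[OF L2_component[OF g]] borel_rep_component[OF G(2)]
              test_function_measurable[OF \<phi>]])
      finally show "(LINT x|lborel. U x * partial_deriv i \<phi> x) = - (LINT x|lborel. G x $ i * \<phi> x)" .
    qed
    moreover have "(LINT x|lborel. U x * \<phi> x) = 0" if "\<phi> \<in> \<Phi>" for \<phi>
      using L2_pairing_rep[OF D L2_measurable[OF u] U(2) test_function_measurable[OF test[OF that]]] zero[OF that]
      by simp
    ultimately show "sq_norm (lebesgue_on D) u
        \<le> \<epsilon> * (sq_norm (lebesgue_on D) u + sq_norm (lebesgue_on D) g)"
      unfolding U(3) G(3) by (intro ineq U(1) G(1))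
  qed
qed

lemma L2_eq_0_if_orthogonal_to_test_functions:
  fixes f :: "real^2 \<Rightarrow> complex"
  assumes \<Omega>: "open \<Omega>" and f: "L2 \<Omega> f"
    and zero: "\<And>\<phi>. test_function \<Omega> \<phi> \<Longrightarrow> (LINT x|lebesgue_on \<Omega>. f x * \<phi> x) = 0"
  shows "AE x in lebesgue_on \<Omega>. f x = 0"
proof -
  obtain F where F: "sq_int F" "borel_rep \<Omega> f F" using L2_rep[OF \<Omega> f] by blast
  have "sq_norm lborel F \<le> 0"
  proof (rule test_function_duality[OF \<Omega> F(1)])
    show "F x = 0" if "x \<notin> \<Omega>" for x using F(2) that by (simp add: borel_rep_def)
    fix \<phi> assume \<phi>: "test_function \<Omega> \<phi>"
    have "(LINT x|lborel. F x * \<phi> x) = 0"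
      using L2_pairing_rep[OF \<Omega> L2_measurable[OF f] F(2) test_function_measurable[OF \<phi>]] zero[OF \<phi>] by simp
    then show "2 * Re (LINT x|lborel. F x * \<phi> x) \<le> 0 + sq_norm lborel \<phi>" by simp
  qed
  then have "sq_norm lborel F = 0" by (intro antisym) auto
  then have "AE x in lborel. (norm (F x))\<^sup>2 = 0"
    using sq_integrable_norm_sq[OF F(1)] by (subst (asm) integral_nonneg_eq_0_iff_AE) auto
  then have "AE x in lebesgue. (norm (F x))\<^sup>2 = 0" by (rule AE_completion)
  moreover have "AE x in lebesgue. indicator \<Omega> x *\<^sub>R f x = F x" using F(2) by (simp add: borel_rep_def)
  ultimately have "AE x in lebesgue. x \<in> \<Omega> \<longrightarrow> f x = 0"
    by eventually_elim auto
  then show ?thesis by (simp add: AE_lebesgue_on_iff[OF \<Omega>])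
qed

lemma test_function_sq_integrable:
  assumes "test_function A \<phi>" and "open \<Omega>"
  shows "sq_integrable (lebesgue_on \<Omega>) \<phi>"
proof -
  have [measurable]: "\<phi> \<in> borel_measurable borel" by (rule test_function_measurable[OF assms(1)])
  have "integrable lborel (\<lambda>x. (norm (\<phi> x))\<^sup>2)"
    by (rule sq_integrable_norm_sq[OF test_function_sq_int[OF assms(1)]])
  then have "integrable lebesgue (\<lambda>x. (norm (\<phi> x))\<^sup>2)" by (subst integrable_completion) auto
  then have "integrable lebesgue (\<lambda>x. indicator \<Omega> x *\<^sub>R (norm (\<phi> x))\<^sup>2)"
    using assms(2) by (intro integrable_mult_indicator) auto
  then have "integrable (lebesgue_on \<Omega>) (\<lambda>x. (norm (\<phi> x))\<^sup>2)"
    using assms(2) by (subst integrable_restrict_space) auto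
  then show ?thesis unfolding sq_integrable_def
    by (intro conjI borel_measurable_lebesgue_on) auto
qed

lemma L2_eq_if_same_pairings:
  fixes f g :: "real^2 \<Rightarrow> complex"
  assumes \<Omega>: "open \<Omega>" and f: "L2 \<Omega> f" and g: "L2 \<Omega> g"
    and eq: "\<And>\<phi>. test_function \<Omega> \<phi> \<Longrightarrow> (LINT x|lebesgue_on \<Omega>. f x * \<phi> x) = (LINT x|lebesgue_on \<Omega>. g x * \<phi> x)"
  shows "AE x in lebesgue_on \<Omega>. f x = g x"
proof -
  let ?M = "lebesgue_on \<Omega>"
  have "AE x in ?M. f x - g x = 0"
  proof (rule L2_eq_0_if_orthogonal_to_test_functions[OF \<Omega>])
    show "L2 \<Omega> (\<lambda>x. f x - g x)" using f g by (simp add: L2_iff sq_integrable_diff)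
    fix \<phi> assume \<phi>: "test_function \<Omega> \<phi>"
    have "(LINT x|?M. f x * \<phi> x - g x * \<phi> x)
       = (LINT x|?M. f x * \<phi> x) - (LINT x|?M. g x * \<phi> x)"
      using f g test_function_sq_integrable[OF \<phi> \<Omega>]
      by (intro Bochner_Integration.integral_diff sq_integrable_mult) (auto simp: L2_iff)
    then show "(LINT x|?M. (f x - g x) * \<phi> x) = 0"
      using eq[OF \<phi>] by (simp add: left_diff_distrib)
  qed
  then show ?thesis by eventually_elim simp
qed

text \<open>
  Uniqueness justifies the choice in \<^const>\<open>weak_grad\<close>: any weak gradient that is found by other means agrees
  with the chosen one almost everywhere.
\<close>

lemma weak_gradient_unique:
  assumes \<Omega>: "open \<Omega>" and "L2 \<Omega> g" "L2 \<Omega> h" "has_weak_gradient \<Omega> u g" "has_weak_gradient \<Omega> u h"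
  shows "AE x in lebesgue_on \<Omega>. g x = h x"
proof -
  have "AE x in lebesgue_on \<Omega>. g x $ i = h x $ i" for i
  proof (rule L2_eq_if_same_pairings[OF \<Omega> L2_component[OF assms(2)] L2_component[OF assms(3)]])
    fix \<phi> assume "test_function \<Omega> \<phi>"
    then show "(LINT x|lebesgue_on \<Omega>. g x $ i * \<phi> x) = (LINT x|lebesgue_on \<Omega>. h x $ i * \<phi> x)"
      using assms(4)[unfolded has_weak_gradient_def, rule_format, of \<phi> i]
        assms(5)[unfolded has_weak_gradient_def, rule_format, of \<phi> i] by simp
  qed
  then have "AE x in lebesgue_on \<Omega>. \<forall>i\<in>UNIV. g x $ i = h x $ i" by (intro AE_finite_allI) auto
  then show ?thesis by eventually_elim (simp add: vec_eq_iff)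
qed

lemma weak_grad_works:
  assumes "H1 \<Omega> u"
  shows "L2 \<Omega> (weak_grad \<Omega> u)" "has_weak_gradient \<Omega> u (weak_grad \<Omega> u)"
proof -
  have "\<exists>g. L2 \<Omega> g \<and> has_weak_gradient \<Omega> u g" using assms by (simp add: H1_def)
  from someI_ex[OF this] show "L2 \<Omega> (weak_grad \<Omega> u)" "has_weak_gradient \<Omega> u (weak_grad \<Omega> u)"
    by (simp_all add: weak_grad_def)
qed

section \<open>Complex conjugation of weak gradients and traces\<close>

text \<open>
  The Hermitian forms below require conjugated functions, and on the exterior of \<open>D\<close> also a change of
  sign; \<open>c\<close> will be \<open>1\<close> or \<open>-1\<close>.
\<close>

definition vec_cnj :: "complex \<Rightarrow> complex^2 \<Rightarrow> complex^2" where
  "vec_cnj c z = (\<chi> i. c * cnj (z $ i))"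

lemma norm_vec_cnj: "norm c = 1 \<Longrightarrow> norm (vec_cnj c z) = norm z"
  by (simp add: vec_cnj_def norm_vec_def norm_mult)

lemma L2_vec_cnj:
  assumes "norm c = 1" "L2 \<Omega> g"
  shows "L2 \<Omega> (\<lambda>x. vec_cnj c (g x))"
proof -
  have "continuous_on UNIV (vec_cnj c)" unfolding vec_cnj_def by (intro continuous_intros)
  then show ?thesis using assms unfolding L2_def norm_vec_cnj[OF assms(1)]
    by (auto intro: measurable_compose[OF _ borel_measurable_continuous_onI])
qed

lemma L2_scale_cnj: "L2 \<Omega> u \<Longrightarrow> L2 \<Omega> (\<lambda>x. c * cnj (u x))"
  by (simp add: L2_iff sq_integrable_scale sq_integrable_cnj)

lemma has_weak_gradient_scale_cnj:
  assumes "has_weak_gradient \<Omega> u g"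
  shows "has_weak_gradient \<Omega> (\<lambda>x. c * cnj (u x)) (\<lambda>x. vec_cnj c (g x))"
  unfolding has_weak_gradient_def
proof (intro allI impI)
  let ?M = "lebesgue_on \<Omega>"
  fix \<phi> i assume \<phi>: "test_function \<Omega> \<phi>"
  have pc: "cnj (partial_deriv i \<phi> x) = partial_deriv i (\<lambda>x. cnj (\<phi> x)) x" for x
    by (rule partial_deriv_cnj[OF test_function_differentiable[OF \<phi>], symmetric])
  have "(LINT x|?M. c * cnj (u x) * partial_deriv i \<phi> x)
     = (LINT x|?M. c * cnj (u x * partial_deriv i (\<lambda>x. cnj (\<phi> x)) x))"
    by (simp add: pc[symmetric] mult.assoc)
  also have "\<dots> = c * cnj (LINT x|?M. u x * partial_deriv i (\<lambda>x. cnj (\<phi> x)) x)"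
    by (simp only: integral_mult_right_zero Bochner_Integration.integral_cnj)
  also have "\<dots> = - (c * cnj (LINT x|?M. g x $ i * cnj (\<phi> x)))"
    using assms test_function_cnj[OF \<phi>] by (simp add: has_weak_gradient_def)
  also have "c * cnj (LINT x|?M. g x $ i * cnj (\<phi> x)) = (LINT x|?M. c * cnj (g x $ i * cnj (\<phi> x)))"
    by (simp only: integral_mult_right_zero Bochner_Integration.integral_cnj)
  also have "\<dots> = (LINT x|?M. vec_cnj c (g x) $ i * \<phi> x)"
    by (simp add: vec_cnj_def mult.assoc)
  finally show "(LINT x|?M. c * cnj (u x) * partial_deriv i \<phi> x)
     = - (LINT x|?M. vec_cnj c (g x) $ i * \<phi> x)" .
qed

lemma H1_scale_cnj: "norm c = 1 \<Longrightarrow> H1 \<Omega> u \<Longrightarrow> H1 \<Omega> (\<lambda>x. c * cnj (u x))"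
  unfolding H1_def using L2_scale_cnj L2_vec_cnj has_weak_gradient_scale_cnj by blast

lemma weak_grad_scale_cnj:
  assumes "open \<Omega>" "norm c = 1" "H1 \<Omega> u"
  shows "AE x in lebesgue_on \<Omega>. weak_grad \<Omega> (\<lambda>x. c * cnj (u x)) x = vec_cnj c (weak_grad \<Omega> u x)"
  using H1_scale_cnj[OF assms(2,3)]
  by (intro weak_gradient_unique[OF assms(1) weak_grad_works(1) L2_vec_cnj[OF assms(2)] weak_grad_works(2)]
      weak_grad_works(1) has_weak_gradient_scale_cnj weak_grad_works(2) assms(3)) auto

text \<open>
  If \<open>u\<close> has no weak gradient, then neither has its conjugate, and \<^const>\<open>weak_grad\<close> picks the same arbitrary
  element for both. So the identity may be applied to the differences in the definition of traces without
  knowing that they lie in \<open>H\<^sup>1\<close>.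
\<close>

lemma H1_norm_scale_cnj:
  assumes \<Omega>: "open \<Omega>" and c: "norm c = 1"
  shows "H1_norm \<Omega> (\<lambda>x. c * cnj (u x)) = H1_norm \<Omega> u"
proof -
  let ?M = "lebesgue_on \<Omega>"
  let ?E = "\<lambda>u. \<exists>g. L2 \<Omega> g \<and> has_weak_gradient \<Omega> u g"
  have "(LINT x|?M. (norm (weak_grad \<Omega> (\<lambda>x. c * cnj (u x)) x))\<^sup>2)
      = (LINT x|?M. (norm (weak_grad \<Omega> u x))\<^sup>2)"
  proof (cases "?E u")
    case True
    then have g: "L2 \<Omega> (weak_grad \<Omega> u)" "has_weak_gradient \<Omega> u (weak_grad \<Omega> u)"
      using someI_ex[of "\<lambda>g. L2 \<Omega> g \<and> has_weak_gradient \<Omega> u g"] by (auto simp: weak_grad_def)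
    have "?E (\<lambda>x. c * cnj (u x))"
      using L2_vec_cnj[OF c g(1)] has_weak_gradient_scale_cnj[OF g(2), of c] by blast
    then have h: "L2 \<Omega> (weak_grad \<Omega> (\<lambda>x. c * cnj (u x)))"
       "has_weak_gradient \<Omega> (\<lambda>x. c * cnj (u x)) (weak_grad \<Omega> (\<lambda>x. c * cnj (u x)))"
      using someI_ex[of "\<lambda>g. L2 \<Omega> g \<and> has_weak_gradient \<Omega> (\<lambda>x. c * cnj (u x)) g"] by (auto simp: weak_grad_def)
    have "AE x in ?M. weak_grad \<Omega> (\<lambda>x. c * cnj (u x)) x = vec_cnj c (weak_grad \<Omega> u x)"
      by (intro weak_gradient_unique[OF \<Omega> h(1) L2_vec_cnj[OF c g(1)] h(2)] has_weak_gradient_scale_cnj g)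
    then have "AE x in ?M. (norm (weak_grad \<Omega> (\<lambda>x. c * cnj (u x)) x))\<^sup>2 = (norm (weak_grad \<Omega> u x))\<^sup>2"
      by eventually_elim (simp add: norm_vec_cnj[OF c])
    then show ?thesis using h(1) g(1) by (intro integral_cong_AE) (auto simp: L2_def)
  next
    case False
    have "c * cnj c = 1" using c complex_norm_square[of c] by simp
    then have eq: "c * cnj (c * cnj z) = z" for z
      by (simp flip: mult.assoc)
    have "\<not> ?E (\<lambda>x. c * cnj (u x))"
      using False L2_vec_cnj[OF c] has_weak_gradient_scale_cnj[of \<Omega> "\<lambda>x. c * cnj (u x)" _ c]
      unfolding eq by blast
    with False have "(\<lambda>g. L2 \<Omega> g \<and> has_weak_gradient \<Omega> (\<lambda>x. c * cnj (u x)) g)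
        = (\<lambda>g. L2 \<Omega> g \<and> has_weak_gradient \<Omega> u g)"
      by (intro ext) blast
    then have "weak_grad \<Omega> (\<lambda>x. c * cnj (u x)) = weak_grad \<Omega> u"
      unfolding weak_grad_def by (rule arg_cong)
    then show ?thesis by simp
  qed
  then show ?thesis using c by (simp add: H1_norm_def norm_mult)
qed

lemma has_trace_scale_cnj:
  assumes \<Omega>: "open \<Omega>" and c: "norm c = 1" and tr: "has_trace \<Gamma> \<Omega> u g"
  shows "has_trace \<Gamma> \<Omega> (\<lambda>x. c * cnj (u x)) (\<lambda>x. c * cnj (g x))"
proof -
  obtain \<phi> where \<phi>: "\<And>n. test_function UNIV (\<phi> n)"
    "(\<lambda>n. H1_norm \<Omega> (\<lambda>x. \<phi> n x - u x)) \<longlonglongrightarrow> 0"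
    "(\<lambda>n. \<integral>\<^sup>+ x. ennreal ((norm (\<phi> n x - g x))\<^sup>2) \<partial>arc_length_on \<Gamma>) \<longlonglongrightarrow> 0"
    and g: "g \<in> borel_measurable (arc_length_on \<Gamma>)" and u: "H1 \<Omega> u"
    using tr unfolding has_trace_def by blast
  have "H1_norm \<Omega> (\<lambda>x. c * cnj (\<phi> n x) - c * cnj (u x)) = H1_norm \<Omega> (\<lambda>x. \<phi> n x - u x)" for n
    using H1_norm_scale_cnj[OF \<Omega> c, of "\<lambda>x. \<phi> n x - u x"] by (simp add: right_diff_distrib)
  moreover have "norm (c * cnj (\<phi> n x) - c * cnj (g x)) = norm (\<phi> n x - g x)" for n x
  proof -
    have "c * cnj (\<phi> n x) - c * cnj (g x) = c * cnj (\<phi> n x - g x)" by (simp add: right_diff_distrib)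
    then show ?thesis using c by (simp only: norm_mult complex_mod_cnj)
  qed
  moreover have "(\<lambda>x. c * cnj (g x)) \<in> borel_measurable (arc_length_on \<Gamma>)"
    by (rule measurable_compose[OF g borel_measurable_continuous_onI[of "\<lambda>z. c * cnj z"]]) (intro continuous_intros)
  ultimately show ?thesis unfolding has_trace_def
    using \<phi> H1_scale_cnj[OF c u] test_function_scale[OF test_function_cnj[OF \<phi>(1)], of c]
    by (auto intro!: exI[of _ "\<lambda>n x. c * cnj (\<phi> n x)"])
qed

lemma has_trace_cong_AE:
  assumes tr: "has_trace \<Gamma> \<Omega> u g" and h: "h \<in> borel_measurable (arc_length_on \<Gamma>)"
    and eq: "AE x in arc_length_on \<Gamma>. g x = h x"
  shows "has_trace \<Gamma> \<Omega> u h"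
proof -
  have "(\<integral>\<^sup>+ x. ennreal ((norm (\<phi> x - g x))\<^sup>2) \<partial>arc_length_on \<Gamma>)
     = (\<integral>\<^sup>+ x. ennreal ((norm (\<phi> x - h x))\<^sup>2) \<partial>arc_length_on \<Gamma>)" for \<phi>
    using eq by (intro nn_integral_cong_AE) (auto elim!: eventually_mono)
  with tr h show ?thesis unfolding has_trace_def by simp
qed

section \<open>Hermitian forms and linear combinations\<close>

definition ip :: "'a measure \<Rightarrow> ('a \<Rightarrow> complex) \<Rightarrow> ('a \<Rightarrow> complex) \<Rightarrow> complex" where
  "ip M u v = (LINT x|M. u x * cnj (v x))"

definition vec_ip :: "'a measure \<Rightarrow> ('a \<Rightarrow> complex^2) \<Rightarrow> ('a \<Rightarrow> complex^2) \<Rightarrow> complex" where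
  "vec_ip M p q = (\<Sum>i\<in>UNIV. ip M (\<lambda>x. p x $ i) (\<lambda>x. q x $ i))"

lemma ip_commute: "ip M v u = cnj (ip M u v)"
  unfolding ip_def Bochner_Integration.integral_cnj[symmetric] by (simp add: mult.commute)

lemma vec_ip_commute: "vec_ip M q p = cnj (vec_ip M p q)"
  unfolding vec_ip_def cnj_sum by (intro sum.cong refl ip_commute)

lemma ip_self: "ip M u u = of_real (sq_norm M u)"
  by (simp only: ip_def complex_norm_square[symmetric] integral_complex_of_real)

lemma norm_vec_sq: "(norm (z :: complex^2))\<^sup>2 = (\<Sum>i\<in>UNIV. (norm (z $ i))\<^sup>2)"
  unfolding norm_vec_def L2_set_def by (simp add: sum_nonneg)

lemma vec_ip_self:
  assumes "sq_integrable M p"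
  shows "vec_ip M p p = of_real (sq_norm M p)"
  unfolding vec_ip_def ip_self norm_vec_sq
  using sq_integrable_norm_sq[OF sq_integrable_component[OF assms]]
  by (simp add: Bochner_Integration.integral_sum)

lemma ip_linear_combination:
  assumes v: "\<And>k. k \<in> I \<Longrightarrow> sq_integrable M (v k)"
  shows "ip M (\<lambda>x. \<Sum>k\<in>I. c k * v k x) (\<lambda>x. \<Sum>k\<in>I. c k * v k x)
     = (\<Sum>k\<in>I. \<Sum>m\<in>I. c k * cnj (c m) * ip M (v k) (v m))"
proof -
  have int: "integrable M (\<lambda>x. c k * cnj (c m) * (v k x * cnj (v m x)))" if "k \<in> I" "m \<in> I" for k m
    using that by (intro integrable_mult_right sq_integrable_mult sq_integrable_cnj v)
  have "ip M (\<lambda>x. \<Sum>k\<in>I. c k * v k x) (\<lambda>x. \<Sum>k\<in>I. c k * v k x)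
    = (LINT x|M. (\<Sum>k\<in>I. \<Sum>m\<in>I. c k * cnj (c m) * (v k x * cnj (v m x))))"
    by (simp add: ip_def cnj_sum sum_product mult_ac)
  also have "\<dots> = (\<Sum>k\<in>I. LINT x|M. (\<Sum>m\<in>I. c k * cnj (c m) * (v k x * cnj (v m x))))"
    by (rule Bochner_Integration.integral_sum) (intro Bochner_Integration.integrable_sum int)
  also have "\<dots> = (\<Sum>k\<in>I. \<Sum>m\<in>I. LINT x|M. c k * cnj (c m) * (v k x * cnj (v m x)))"
    by (intro sum.cong refl Bochner_Integration.integral_sum int)
  also have "\<dots> = (\<Sum>k\<in>I. \<Sum>m\<in>I. c k * cnj (c m) * ip M (v k) (v m))"
    by (simp add: ip_def)
  finally show ?thesis .
qed

lemma vec_ip_linear_combination: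
  assumes "\<And>k. k \<in> I \<Longrightarrow> sq_integrable M (p k)"
  shows "vec_ip M (\<lambda>x. \<chi> i. \<Sum>k\<in>I. c k * p k x $ i) (\<lambda>x. \<chi> i. \<Sum>k\<in>I. c k * p k x $ i)
     = (\<Sum>k\<in>I. \<Sum>m\<in>I. c k * cnj (c m) * vec_ip M (p k) (p m))"
proof -
  have "vec_ip M (\<lambda>x. \<chi> i. \<Sum>k\<in>I. c k * p k x $ i) (\<lambda>x. \<chi> i. \<Sum>k\<in>I. c k * p k x $ i)
    = (\<Sum>i\<in>UNIV. \<Sum>k\<in>I. \<Sum>m\<in>I. c k * cnj (c m) * ip M (\<lambda>x. p k x $ i) (\<lambda>x. p m x $ i))"
    unfolding vec_ip_def vec_lambda_beta
    by (intro sum.cong refl ip_linear_combination sq_integrable_component assms)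
  also have "\<dots> = (\<Sum>k\<in>I. \<Sum>i\<in>UNIV. \<Sum>m\<in>I. c k * cnj (c m) * ip M (\<lambda>x. p k x $ i) (\<lambda>x. p m x $ i))"
    by (rule sum.swap)
  also have "\<dots> = (\<Sum>k\<in>I. \<Sum>m\<in>I. \<Sum>i\<in>UNIV. c k * cnj (c m) * ip M (\<lambda>x. p k x $ i) (\<lambda>x. p m x $ i))"
    by (intro sum.cong refl sum.swap)
  also have "\<dots> = (\<Sum>k\<in>I. \<Sum>m\<in>I. c k * cnj (c m) * vec_ip M (p k) (p m))"
    by (simp add: vec_ip_def sum_distrib_left)
  finally show ?thesis .
qed

lemma sq_integrable_vec:
  fixes g :: "'a \<Rightarrow> complex^2"
  assumes "\<And>i. sq_integrable M (\<lambda>x. g x $ i)"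
  shows "sq_integrable M g"
  unfolding sq_integrable_def norm_vec_sq
proof
  have "(\<lambda>x. g x \<bullet> b) \<in> borel_measurable M" if "b \<in> Basis" for b
  proof -
    obtain i d where "b = axis i d" using \<open>b \<in> Basis\<close> by (auto simp: Basis_vec_def)
    then have "(\<lambda>x. g x \<bullet> b) = (\<lambda>x. g x $ i \<bullet> d)" by (simp add: inner_axis)
    then show ?thesis using assms[of i] by (auto simp: sq_integrable_def)
  qed
  then show "g \<in> borel_measurable M" by (subst borel_measurable_euclidean_space) auto
  show "integrable M (\<lambda>x. \<Sum>i\<in>UNIV. (norm (g x $ i))\<^sup>2)"
    using sq_integrable_norm_sq[OF assms] by (intro Bochner_Integration.integrable_sum)
qed

lemma has_weak_gradient_linear_combination:
  assumes \<Omega>: "open \<Omega>" and v: "\<And>k. k \<in> I \<Longrightarrow> L2 \<Omega> (v k)" and p: "\<And>k. k \<in> I \<Longrightarrow> L2 \<Omega> (p k)"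
    and grad: "\<And>k. k \<in> I \<Longrightarrow> has_weak_gradient \<Omega> (v k) (p k)"
  shows "has_weak_gradient \<Omega> (\<lambda>x. \<Sum>k\<in>I. c k * v k x) (\<lambda>x. \<chi> i. \<Sum>k\<in>I. c k * p k x $ i)"
  unfolding has_weak_gradient_def vec_lambda_beta
proof (intro allI impI)
  let ?M = "lebesgue_on \<Omega>"
  fix \<phi> i assume \<phi>: "test_function \<Omega> \<phi>"
  have pull: "(LINT x|?M. (\<Sum>k\<in>I. c k * u k x) * \<psi> x)
     = (\<Sum>k\<in>I. c k * (LINT x|?M. u k x * \<psi> x))"
    if "\<And>k. k \<in> I \<Longrightarrow> L2 \<Omega> (u k)" "test_function \<Omega> \<psi>" for u \<psi>
  proof -
    have "(LINT x|?M. (\<Sum>k\<in>I. c k * u k x) * \<psi> x) = (LINT x|?M. (\<Sum>k\<in>I. c k * (u k x * \<psi> x)))"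
      by (simp add: sum_distrib_right mult.assoc)
    also have "\<dots> = (\<Sum>k\<in>I. LINT x|?M. c k * (u k x * \<psi> x))"
      using that test_function_sq_integrable[OF that(2) \<Omega>]
      by (intro Bochner_Integration.integral_sum integrable_mult_right sq_integrable_mult) (auto simp: L2_iff)
    finally show ?thesis by simp
  qed
  have "(LINT x|?M. (\<Sum>k\<in>I. c k * v k x) * partial_deriv i \<phi> x)
      = (\<Sum>k\<in>I. c k * - (LINT x|?M. p k x $ i * \<phi> x))"
  proof (rule trans[OF pull[OF v test_function_partial_deriv[OF \<phi>]]])
    show "(\<Sum>k\<in>I. c k * (LINT x|?M. v k x * partial_deriv i \<phi> x))
        = (\<Sum>k\<in>I. c k * - (LINT x|?M. p k x $ i * \<phi> x))"
      using grad \<phi> by (intro sum.cong refl arg_cong2[where f = "(*)"]) (simp add: has_weak_gradient_def)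
  qed
  also have "\<dots> = - (LINT x|?M. (\<Sum>k\<in>I. c k * p k x $ i) * \<phi> x)"
    by (subst pull[OF L2_component[OF p] \<phi>]) (simp_all add: sum_negf)
  finally show "(LINT x|?M. (\<Sum>k\<in>I. c k * v k x) * partial_deriv i \<phi> x)
      = - (LINT x|?M. (\<Sum>k\<in>I. c k * p k x $ i) * \<phi> x)" .
qed

text \<open>
  Gaussian elimination: one equation and one unknown are removed in each step.
\<close>

lemma homogeneous_system_nontrivial_solution:
  fixes M :: "'i \<Rightarrow> 'e \<Rightarrow> 'f::field"
  assumes "finite \<Phi>" "finite I" "card \<Phi> < card I"
  shows "\<exists>c. (\<exists>k\<in>I. c k \<noteq> 0) \<and> (\<forall>\<phi>\<in>\<Phi>. (\<Sum>k\<in>I. c k * M k \<phi>) = 0)"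
  using assms
proof (induction \<Phi> arbitrary: I M rule: finite_induct)
  case empty
  then obtain k where "k \<in> I" by fastforce
  then show ?case by (intro exI[of _ "\<lambda>_. 1"]) auto
next
  case (insert \<psi> \<Phi>)
  show ?case
  proof (cases "\<forall>k\<in>I. M k \<psi> = 0")
    case True
    have "card \<Phi> < card I" using insert by simp
    from insert.IH[OF insert.prems(1) this, of M] True show ?thesis by auto
  next
    case False
    then obtain j where j: "j \<in> I" "M j \<psi> \<noteq> 0" by blast
    define J where "J = I - {j}"
    have J: "finite J" "card \<Phi> < card J" "I = insert j J" "j \<notin> J"
      using insert j by (auto simp: J_def)
    from insert.IH[OF J(1,2), of "\<lambda>k \<phi>. M k \<phi> - M k \<psi> / M j \<psi> * M j \<phi>"]
    obtain c where c: "\<exists>k\<in>J. c k \<noteq> 0"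
      "\<And>\<phi>. \<phi> \<in> \<Phi> \<Longrightarrow> (\<Sum>k\<in>J. c k * (M k \<phi> - M k \<psi> / M j \<psi> * M j \<phi>)) = 0" by blast
    \<comment> \<open>The coefficient of the pivot \<open>j\<close> is determined by the equation \<open>\<psi>\<close>.\<close>
    define d where "d = (\<lambda>k. if k = j then - (\<Sum>k\<in>J. c k * M k \<psi>) / M j \<psi> else c k)"
    have dJ: "(\<Sum>k\<in>J. d k * M k \<phi>) = (\<Sum>k\<in>J. c k * M k \<phi>)" for \<phi>
      using J(4) by (intro sum.cong) (auto simp: d_def)
    have total: "(\<Sum>k\<in>I. d k * M k \<phi>) = - (\<Sum>k\<in>J. c k * M k \<psi>) / M j \<psi> * M j \<phi> + (\<Sum>k\<in>J. c k * M k \<phi>)" for \<phi>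
      using J by (simp add: dJ) (simp add: d_def)
    have "(\<Sum>k\<in>I. d k * M k \<phi>) = 0" if "\<phi> \<in> insert \<psi> \<Phi>" for \<phi>
    proof (cases "\<phi> = \<psi>")
      case True then show ?thesis using j by (simp add: total)
    next
      case False
      then have "0 = (\<Sum>k\<in>J. c k * (M k \<phi> - M k \<psi> / M j \<psi> * M j \<phi>))" using c(2) that by auto
      also have "\<dots> = (\<Sum>k\<in>J. c k * M k \<phi>) - (\<Sum>k\<in>J. c k * M k \<psi>) / M j \<psi> * M j \<phi>"
        by (simp add: right_diff_distrib sum_subtractf sum_distrib_right sum_divide_distrib mult.assoc)
      finally show ?thesis by (simp add: total)
    qed
    moreover have "\<exists>k\<in>I. d k \<noteq> 0" using c(1) J by (auto simp: d_def)
    ultimately show ?thesis by blast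
  qed
qed

section \<open>Green's formula for pairs of eigenmodes\<close>

lemma has_weak_laplacian_unique:
  assumes \<Omega>: "open \<Omega>" and "has_weak_laplacian \<Omega> u f" "has_weak_laplacian \<Omega> u g"
  shows "AE x in lebesgue_on \<Omega>. f x = g x"
proof (rule L2_eq_if_same_pairings[OF \<Omega>])
  fix \<phi> assume "test_function \<Omega> \<phi>"
  then have "- (LINT x|lebesgue_on \<Omega>. f x * \<phi> x) = - (LINT x|lebesgue_on \<Omega>. g x * \<phi> x)"
    using assms(2,3) unfolding has_weak_laplacian_def by simp
  then show "(LINT x|lebesgue_on \<Omega>. f x * \<phi> x) = (LINT x|lebesgue_on \<Omega>. g x * \<phi> x)" by simp
qed (use assms in \<open>auto simp: has_weak_laplacian_def\<close>)

text \<open>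
  The functional of the normal derivative is bilinear in \<open>u\<close> and its argument. Evaluated at the trace of
  a conjugated function it yields the Hermitian forms; here the uniqueness of the weak Laplacian and of
  weak gradients enters.
\<close>

lemma normal_derivative_at_conjugate:
  assumes \<Omega>: "open \<Omega>" and lap: "has_weak_laplacian \<Omega> u f" and nd: "has_normal_derivative \<Gamma> \<Omega> u l"
    and c: "norm c = 1" and \<psi>: "H1 \<Omega> \<psi>" and tr: "has_trace \<Gamma> \<Omega> (\<lambda>x. c * cnj (\<psi> x)) g"
  shows "l g = c * (vec_ip (lebesgue_on \<Omega>) (weak_grad \<Omega> u) (weak_grad \<Omega> \<psi>) + ip (lebesgue_on \<Omega>) f \<psi>)"
proof -
  obtain f' where f': "has_weak_laplacian \<Omega> u f'"
    "\<And>\<psi> g. has_trace \<Gamma> \<Omega> \<psi> g \<Longrightarrow>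
        l g = (LINT x|lebesgue_on \<Omega>. (\<Sum>i\<in>UNIV. weak_grad \<Omega> u x $ i * weak_grad \<Omega> \<psi> x $ i))
              + (LINT x|lebesgue_on \<Omega>. f' x * \<psi> x)"
    using nd unfolding has_normal_derivative_def by blast
  let ?M = "lebesgue_on \<Omega>"
  define p where "p = weak_grad \<Omega> u"
  define q where "q = weak_grad \<Omega> \<psi>"
  define r where "r = weak_grad \<Omega> (\<lambda>x. c * cnj (\<psi> x))"
  have p: "sq_integrable ?M p" and q: "sq_integrable ?M q" and r: "sq_integrable ?M r"
    and L\<psi>: "sq_integrable ?M \<psi>" and ff: "sq_integrable ?M f" "sq_integrable ?M f'"
    using lap f'(1) \<psi> weak_grad_works(1)[OF \<psi>] weak_grad_works(1)[OF H1_scale_cnj[OF c \<psi>]] weak_grad_works(1)[of \<Omega> u]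
    by (auto simp: has_weak_laplacian_def L2_iff H1_def p_def q_def r_def)
  note comp = sq_integrable_component
  have int: "integrable ?M (\<lambda>x. c * (p x $ i * cnj (q x $ i)))" "integrable ?M (\<lambda>x. p x $ i * r x $ i)" for i
    by (intro integrable_mult_right sq_integrable_mult sq_integrable_cnj comp p q r)+
  have "(LINT x|?M. (\<Sum>i\<in>UNIV. p x $ i * r x $ i)) = (LINT x|?M. (\<Sum>i\<in>UNIV. c * (p x $ i * cnj (q x $ i))))"
  proof (rule integral_cong_AE)
    show "AE x in ?M. (\<Sum>i\<in>UNIV. p x $ i * r x $ i) = (\<Sum>i\<in>UNIV. c * (p x $ i * cnj (q x $ i)))"
      using weak_grad_scale_cnj[OF \<Omega> c \<psi>] unfolding q_def r_def
      by eventually_elim (simp add: vec_cnj_def mult_ac)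
  qed (intro borel_measurable_integrable Bochner_Integration.integrable_sum int)+
  also have "\<dots> = (\<Sum>i\<in>UNIV. LINT x|?M. c * (p x $ i * cnj (q x $ i)))"
    by (intro Bochner_Integration.integral_sum int)
  also have "\<dots> = c * vec_ip ?M p q"
    by (simp add: vec_ip_def ip_def sum_distrib_left)
  finally have 1: "(LINT x|?M. (\<Sum>i\<in>UNIV. p x $ i * r x $ i)) = c * vec_ip ?M p q" .
  have "(LINT x|?M. f' x * (c * cnj (\<psi> x))) = (LINT x|?M. c * (f x * cnj (\<psi> x)))"
  proof (rule integral_cong_AE)
    show "AE x in ?M. f' x * (c * cnj (\<psi> x)) = c * (f x * cnj (\<psi> x))"
      using has_weak_laplacian_unique[OF \<Omega> lap f'(1)] by eventually_elim (simp add: mult_ac)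
  qed (use sq_integrable_cnj[OF L\<psi>] ff in \<open>auto simp: sq_integrable_def intro!: borel_measurable_times\<close>)
  also have "\<dots> = c * ip ?M f \<psi>" by (simp add: ip_def)
  finally show ?thesis using f'(2)[OF tr] 1 by (simp add: distrib_left p_def q_def r_def)
qed

text \<open>
  The data of a transmission eigenvalue that enter Green's formula.
\<close>

definition eigenmode :: "(real^2) set \<Rightarrow> complex \<Rightarrow> (real^2 \<Rightarrow> complex) \<Rightarrow> (real^2 \<Rightarrow> complex) \<Rightarrow> bool" where
  "eigenmode D k v w \<longleftrightarrow> (v, w) \<in> X_space D \<and>
     \<not> ((AE x in lebesgue_on D. v x = 0) \<and> (AE x in lebesgue_on (- closure D). w x = 0)) \<and>
     has_weak_laplacian D v (\<lambda>x. - k\<^sup>2 * v x) \<and>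
     has_weak_laplacian (- closure D) w (\<lambda>x. k\<^sup>2 * w x) \<and>
     normal_derivs_cancel D v w"

abbreviation grad_form :: "(real^2) set \<Rightarrow> (real^2 \<Rightarrow> complex) \<times> (real^2 \<Rightarrow> complex) \<Rightarrow>
    (real^2 \<Rightarrow> complex) \<times> (real^2 \<Rightarrow> complex) \<Rightarrow> complex" where
  "grad_form D z z' \<equiv>
     vec_ip (lebesgue_on D) (weak_grad D (fst z)) (weak_grad D (fst z'))
     + vec_ip (lebesgue_on (- closure D)) (weak_grad (- closure D) (snd z)) (weak_grad (- closure D) (snd z'))"

abbreviation mass_form :: "(real^2) set \<Rightarrow> (real^2 \<Rightarrow> complex) \<times> (real^2 \<Rightarrow> complex) \<Rightarrow>
    (real^2 \<Rightarrow> complex) \<times> (real^2 \<Rightarrow> complex) \<Rightarrow> complex" where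
  "mass_form D z z' \<equiv>
     ip (lebesgue_on D) (fst z) (fst z') - ip (lebesgue_on (- closure D)) (snd z) (snd z')"

lemma ip_scale_left: "ip M (\<lambda>x. c * u x) v = c * ip M u v"
  by (simp add: ip_def mult.assoc)

text \<open>
  Both normal derivatives are evaluated at the trace \<open>g'\<close> of \<open>cnj v'\<close> from inside. Because \<open>v' + w' = 0\<close> on the
  boundary, \<open>g'\<close> is also the trace of \<open>- cnj w'\<close> from outside. As the normal derivatives of \<open>v\<close> and \<open>w\<close> cancel,
  the two boundary terms drop out, and the volume terms combine to the weak formulation of the
  eigenvalue problem.
\<close>

lemma eigenmode_Green:
  assumes D: "open D" and z: "eigenmode D k v w" and z': "eigenmode D k' v' w'"
  shows "grad_form D (v, w) (v', w') = k\<^sup>2 * mass_form D (v, w) (v', w')"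
proof -
  let ?E = "- closure D"
  have E: "open ?E" by (simp add: open_Compl)
  have lv: "has_weak_laplacian D v (\<lambda>x. - k\<^sup>2 * v x)" and lw: "has_weak_laplacian ?E w (\<lambda>x. k\<^sup>2 * w x)"
    and cancel: "normal_derivs_cancel D v w"
    using z by (auto simp: eigenmode_def)
  obtain l m where l: "has_normal_derivative (frontier D) D v l" and m: "has_normal_derivative (frontier D) ?E w m"
    and lm: "\<And>\<psi> g. has_trace (frontier D) D \<psi> g \<Longrightarrow> l g + (- m g) = 0"
    using cancel unfolding normal_derivs_cancel_def by blast
  obtain g h where g: "has_trace (frontier D) D v' g" and h: "has_trace (frontier D) ?E w' h"
    and gh: "AE x in arc_length_on (frontier D). g x + h x = 0"
    using z' unfolding eigenmode_def X_space_def by blast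
  have H: "H1 D v'" "H1 ?E w'" using g h by (auto simp: has_trace_def)
  define g' where "g' x = 1 * cnj (g x)" for x
  have tg: "has_trace (frontier D) D (\<lambda>x. 1 * cnj (v' x)) g'"
    unfolding g'_def by (rule has_trace_scale_cnj[OF D _ g]) simp
  have th: "has_trace (frontier D) ?E (\<lambda>x. - 1 * cnj (w' x)) g'"
  proof (rule has_trace_cong_AE[OF has_trace_scale_cnj[OF E _ h]])
    show "AE x in arc_length_on (frontier D). - 1 * cnj (h x) = g' x"
      using gh
    proof eventually_elim
      case (elim x)
      then have "g x = - h x" by (simp add: eq_neg_iff_add_eq_0)
      then show ?case by (simp add: g'_def)
    qed
    show "g' \<in> borel_measurable (arc_length_on (frontier D))" using tg by (simp add: has_trace_def)
  qed simp
  have "l g' = 1 * (vec_ip (lebesgue_on D) (weak_grad D v) (weak_grad D v') + ip (lebesgue_on D) (\<lambda>x. - k\<^sup>2 * v x) v')"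
    by (rule normal_derivative_at_conjugate[OF D lv l _ H(1) tg]) simp
  moreover have "m g' = - 1 * (vec_ip (lebesgue_on ?E) (weak_grad ?E w) (weak_grad ?E w') + ip (lebesgue_on ?E) (\<lambda>x. k\<^sup>2 * w x) w')"
    by (rule normal_derivative_at_conjugate[OF E lw m _ H(2) th]) simp
  ultimately show ?thesis
    using lm[OF tg] unfolding ip_scale_left fst_conv snd_conv by algebra
qed

section \<open>Reality and discreteness of the eigenvalues\<close>

lemma weak_laplacian_zero_gradient:
  assumes \<Omega>: "open \<Omega>" and lap: "has_weak_laplacian \<Omega> u (\<lambda>x. \<mu> * u x)" and \<mu>: "\<mu> \<noteq> 0"
    and zero: "sq_norm (lebesgue_on \<Omega>) (weak_grad \<Omega> u) = 0"
  shows "AE x in lebesgue_on \<Omega>. u x = 0"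
proof -
  have g: "L2 \<Omega> (weak_grad \<Omega> u)" using lap weak_grad_works(1) by (auto simp: has_weak_laplacian_def)
  then have "AE x in lebesgue_on \<Omega>. (norm (weak_grad \<Omega> u x))\<^sup>2 = 0"
    using zero by (subst (asm) integral_nonneg_eq_0_iff_AE) (auto simp: L2_def)
  then have g0: "AE x in lebesgue_on \<Omega>. weak_grad \<Omega> u x = 0" by eventually_elim simp
  have "AE x in lebesgue_on \<Omega>. \<mu> * u x = 0"
  proof (rule L2_eq_0_if_orthogonal_to_test_functions[OF \<Omega>])
    show "L2 \<Omega> (\<lambda>x. \<mu> * u x)" using lap by (simp add: has_weak_laplacian_def)
    fix \<phi> assume \<phi>: "test_function \<Omega> \<phi>"
    have "(LINT x|lebesgue_on \<Omega>. (\<Sum>i\<in>UNIV. weak_grad \<Omega> u x $ i * partial_deriv i \<phi> x)) = 0"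
      by (rule integral_eq_zero_AE) (use g0 in \<open>eventually_elim, simp\<close>)
    then show "(LINT x|lebesgue_on \<Omega>. \<mu> * u x * \<phi> x) = 0"
      using lap \<phi> by (simp add: has_weak_laplacian_def)
  qed
  then show ?thesis using \<mu> by simp
qed

lemma eigenmode_L2:
  assumes "eigenmode D k v w"
  shows "sq_integrable (lebesgue_on D) v" "sq_integrable (lebesgue_on D) (weak_grad D v)"
    "sq_integrable (lebesgue_on (- closure D)) w"
    "sq_integrable (lebesgue_on (- closure D)) (weak_grad (- closure D) w)"
    "has_weak_gradient D v (weak_grad D v)"
  using assms weak_grad_works[of D v] weak_grad_works[of "- closure D" w]
  by (auto simp: eigenmode_def X_space_def L2_iff[symmetric] H1_def)

text \<open>
  Taking the mode itself in Green's formula shows that \<open>k\<^sup>2\<close> times the real number \<open>\<beta>\<close>, the value of the mass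
  form, is the Dirichlet energy of the mode. The energy is positive, since a mode without gradient would
  vanish by its own equation. So \<open>k\<^sup>2\<close> is real, and in the given sector \<open>k\<close> is real and \<open>\<beta>\<close> is positive.
\<close>

lemma eigenmode_real:
  assumes D: "open D" and z: "eigenmode D k v w" and k: "k \<in> C_plus"
  shows "k \<in> \<real>" "\<exists>\<beta>>0. mass_form D (v, w) (v, w) = complex_of_real \<beta>"
proof -
  let ?E = "- closure D"
  define A1 where "A1 = sq_norm (lebesgue_on D) (weak_grad D v)"
  define A2 where "A2 = sq_norm (lebesgue_on ?E) (weak_grad ?E w)"
  define \<beta> where "\<beta> = sq_norm (lebesgue_on D) v - sq_norm (lebesgue_on ?E) w"
  have k0: "k \<noteq> 0" "Re k > 0" "Re (k\<^sup>2) > 0" using k by (auto simp: C_plus_def)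
  have b: "mass_form D (v, w) (v, w) = complex_of_real \<beta>"
    by (simp add: ip_self \<beta>_def)
  have "grad_form D (v, w) (v, w) = complex_of_real (A1 + A2)"
    by (simp add: vec_ip_self eigenmode_L2[OF z] A1_def A2_def)
  with eigenmode_Green[OF D z z] b have eq: "complex_of_real (A1 + A2) = k\<^sup>2 * complex_of_real \<beta>" by simp
  have A: "A1 \<ge> 0" "A2 \<ge> 0" by (auto simp: A1_def A2_def)
  have "A1 + A2 \<noteq> 0"
  proof
    assume "A1 + A2 = 0"
    then have "A1 = 0" "A2 = 0" using A by auto
    then have "AE x in lebesgue_on D. v x = 0" "AE x in lebesgue_on ?E. w x = 0"
      using z k0(1) unfolding A1_def A2_def eigenmode_def
      by (auto intro!: weak_laplacian_zero_gradient[OF D, of v "- k\<^sup>2"] weak_laplacian_zero_gradient[of ?E w "k\<^sup>2"])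
    then show False using z by (auto simp: eigenmode_def)
  qed
  then have pos: "A1 + A2 > 0" using A by linarith
  have "A1 + A2 = Re (k\<^sup>2) * \<beta>" "0 = Im (k\<^sup>2) * \<beta>"
    using arg_cong[OF eq, of Re] arg_cong[OF eq, of Im] by auto
  with pos k0(3) have \<beta>: "\<beta> > 0" "Im (k\<^sup>2) = 0" by (auto simp: zero_less_mult_iff)
  then have "Im k = 0" using k0(2) by (auto simp: power2_eq_square)
  then show "k \<in> \<real>" by (simp add: complex_is_Real_iff)
  show "\<exists>\<beta>>0. mass_form D (v, w) (v, w) = complex_of_real \<beta>" using b \<beta>(1) by blast
qed

text \<open>
  Exchanging the modes in Green's formula and conjugating gives the mass form once with the factor \<open>k\<^sup>2\<close>
  and once with \<open>k'\<^sup>2\<close>, as the eigenvalues are real.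
\<close>

lemma eigenmodes_orthogonal:
  assumes D: "open D" and z: "eigenmode D k v w" "k \<in> C_plus" and z': "eigenmode D k' v' w'" "k' \<in> C_plus"
    and ne: "k \<noteq> k'"
  shows "mass_form D (v, w) (v', w') = 0" "grad_form D (v, w) (v', w') = 0"
proof -
  have real: "k \<in> \<real>" "k' \<in> \<real>" using eigenmode_real(1)[OF D] z z' by blast+
  have pos: "Re k > 0" "Re k' > 0" using z z' by (auto simp: C_plus_def)
  have "grad_form D (v, w) (v', w') = cnj (grad_form D (v', w') (v, w))"
    by (simp add: vec_ip_commute[of _ "weak_grad D v'"] vec_ip_commute[of _ "weak_grad (- closure D) w'"])
  also have "\<dots> = cnj (k'\<^sup>2 * mass_form D (v', w') (v, w))" by (simp only: eigenmode_Green[OF D z'(1) z(1)])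
  also have "\<dots> = k'\<^sup>2 * mass_form D (v, w) (v', w')"
    using real(2) by (simp add: ip_commute[of _ v'] ip_commute[of _ w'] Reals_cnj_iff)
  finally have "(k\<^sup>2 - k'\<^sup>2) * mass_form D (v, w) (v', w') = 0"
    unfolding eigenmode_Green[OF D z(1) z'(1)] by (simp only: left_diff_distrib) simp
  moreover have "k\<^sup>2 - k'\<^sup>2 \<noteq> 0"
  proof
    assume "k\<^sup>2 - k'\<^sup>2 = 0"
    then have "k = k' \<or> k = - k'" by (simp add: power2_eq_iff)
    then show False using ne pos by auto
  qed
  ultimately show m: "mass_form D (v, w) (v', w') = 0" by simp
  show "grad_form D (v, w) (v', w') = 0" unfolding eigenmode_Green[OF D z(1) z'(1)] m by simp
qed

lemma transmission_eigenvalue_eigenmode: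
  "transmission_eigenvalue D k \<Longrightarrow> k \<in> C_plus \<and> (\<exists>v w. eigenmode D k v w)"
  unfolding transmission_eigenvalue_def eigenmode_def by blast

lemma sum_diagonal:
  assumes "finite I" "\<And>k m. k \<in> I \<Longrightarrow> m \<in> I \<Longrightarrow> k \<noteq> m \<Longrightarrow> f k m = (0 :: complex)"
  shows "(\<Sum>k\<in>I. \<Sum>m\<in>I. c k * cnj (c m) * f k m) = (\<Sum>k\<in>I. of_real ((norm (c k))\<^sup>2) * f k k)"
proof (rule sum.cong[OF refl])
  fix k assume k: "k \<in> I"
  have "(\<Sum>m\<in>I. c k * cnj (c m) * f k m) = (\<Sum>m\<in>I. if m = k then c k * cnj (c k) * f k k else 0)"
    using assms(2) k by (intro sum.cong) auto
  then show "(\<Sum>m\<in>I. c k * cnj (c m) * f k m) = of_real ((norm (c k))\<^sup>2) * f k k"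
    using assms(1) k by (simp add: complex_norm_square[symmetric] del: of_real_power)
qed

text \<open>
  Take one more eigenvalue than the compactness inequality has test functions. Some nontrivial
  combination \<open>(U, W)\<close> of the modes then has an interior part orthogonal to all of them. By orthogonality
  of the modes, the mass form of \<open>(U, W)\<close> is a positive combination of the mass forms of the modes, and its
  energy is at most \<open>R\<^sup>2\<close> times that mass form, hence at most \<open>R\<^sup>2\<close> times the squared norm of \<open>U\<close>. For
  small \<open>\<epsilon>\<close> the compactness inequality therefore forces \<open>U = 0\<close>; but then the mass form of \<open>(U, W)\<close>
  cannot be positive.
\<close>

theorem finitely_many_bounded_eigenvalues:
  assumes D: "open D" "bounded D" "analytic_boundary D"
  shows "finite {k. transmission_eigenvalue D k \<and> norm k \<le> R}"
proof (rule ccontr)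
  assume inf: "infinite {k. transmission_eigenvalue D k \<and> norm k \<le> R}"
  let ?E = "- closure D"
  \<comment> \<open>With this \<open>\<epsilon>\<close>, energy at most \<open>R\<^sup>2\<close> times \<open>nU\<close> turns the compactness inequality into \<open>nU \<le> nU / 2\<close>.\<close>
  define \<epsilon> where "\<epsilon> = 1 / (2 * (1 + R\<^sup>2))"
  have R2: "1 + R\<^sup>2 > 0" by (simp add: add_pos_nonneg)
  then have \<epsilon>: "\<epsilon> > 0" by (simp add: \<epsilon>_def)
  obtain \<Phi> where \<Phi>: "finite \<Phi>" "\<And>\<phi>. \<phi> \<in> \<Phi> \<Longrightarrow> test_function D \<phi>"
    and ineq: "\<And>u g. L2 D u \<Longrightarrow> L2 D g \<Longrightarrow> has_weak_gradient D u g \<Longrightarrow>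
      (\<And>\<phi>. \<phi> \<in> \<Phi> \<Longrightarrow> (LINT x|lebesgue_on D. u x * \<phi> x) = 0) \<Longrightarrow>
      sq_norm (lebesgue_on D) u
        \<le> \<epsilon> * (sq_norm (lebesgue_on D) u + sq_norm (lebesgue_on D) g)"
    by (rule H1_compactness_inequality[OF D \<epsilon>]) (blast intro: that)
  obtain I where I: "finite I" "card I = Suc (card \<Phi>)" "I \<subseteq> {k. transmission_eigenvalue D k \<and> norm k \<le> R}"
    using infinite_arbitrarily_large[OF inf, of "Suc (card \<Phi>)"] by blast
  have "\<forall>k\<in>I. \<exists>v w. eigenmode D k v w" using I(3) transmission_eigenvalue_eigenmode by blast
  then obtain v w where vw: "\<And>k. k \<in> I \<Longrightarrow> eigenmode D k (v k) (w k)" by metis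
  have Cp: "k \<in> C_plus" if "k \<in> I" for k using I(3) that transmission_eigenvalue_eigenmode by blast
  obtain c where c: "\<exists>k\<in>I. c k \<noteq> 0"
    "\<And>\<phi>. \<phi> \<in> \<Phi> \<Longrightarrow> (\<Sum>k\<in>I. c k * (LINT x|lebesgue_on D. v k x * \<phi> x)) = 0"
    using homogeneous_system_nontrivial_solution[OF \<Phi>(1) I(1), of "\<lambda>k \<phi>. LINT x|lebesgue_on D. v k x * \<phi> x"]
    by (auto simp: I(2))
  define U where "U x = (\<Sum>k\<in>I. c k * v k x)" for x
  define W where "W x = (\<Sum>k\<in>I. c k * w k x)" for x
  define G where "G x = (\<chi> i. \<Sum>k\<in>I. c k * weak_grad D (v k) x $ i)" for x
  define Q where "Q x = (\<chi> i. \<Sum>k\<in>I. c k * weak_grad ?E (w k) x $ i)" for x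
  note L2s = eigenmode_L2[OF vw]
  have sqU: "sq_integrable (lebesgue_on D) U"
    unfolding U_def by (intro sq_integrable_sum sq_integrable_scale L2s)
  have sqG: "sq_integrable (lebesgue_on D) G"
    by (rule sq_integrable_vec)
       (auto simp: G_def intro!: sq_integrable_sum sq_integrable_scale sq_integrable_component L2s)
  have sqQ: "sq_integrable (lebesgue_on ?E) Q"
    by (rule sq_integrable_vec)
       (auto simp: Q_def intro!: sq_integrable_sum sq_integrable_scale sq_integrable_component L2s)
  have grad: "has_weak_gradient D U G" unfolding U_def[abs_def] G_def[abs_def]
    by (rule has_weak_gradient_linear_combination[OF D(1)]) (auto simp: L2_iff intro: L2s)
  have zero: "(LINT x|lebesgue_on D. U x * \<phi> x) = 0" if \<phi>: "\<phi> \<in> \<Phi>" for \<phi>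
  proof -
    have "(LINT x|lebesgue_on D. U x * \<phi> x) = (LINT x|lebesgue_on D. (\<Sum>k\<in>I. c k * (v k x * \<phi> x)))"
      by (simp add: U_def sum_distrib_right mult.assoc)
    also have "\<dots> = (\<Sum>k\<in>I. LINT x|lebesgue_on D. c k * (v k x * \<phi> x))"
      by (intro Bochner_Integration.integral_sum integrable_mult_right sq_integrable_mult L2s
          test_function_sq_integrable[OF \<Phi>(2)[OF \<phi>] D(1)])
    finally show ?thesis using c(2)[OF \<phi>] by simp
  qed
  define nU where "nU = sq_norm (lebesgue_on D) U"
  define nW where "nW = sq_norm (lebesgue_on ?E) W"
  define nG where "nG = sq_norm (lebesgue_on D) G"
  define nQ where "nQ = sq_norm (lebesgue_on ?E) Q"
  have nonneg: "nU \<ge> 0" "nW \<ge> 0" "nG \<ge> 0" "nQ \<ge> 0" by (auto simp: nU_def nW_def nG_def nQ_def)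
  have key: "nU \<le> \<epsilon> * (nU + nG)" unfolding nU_def nG_def
    by (rule ineq) (use sqU sqG grad zero in \<open>auto simp: L2_iff\<close>)
  have "\<forall>k\<in>I. \<exists>\<beta>>0. mass_form D (v k, w k) (v k, w k) = complex_of_real \<beta>"
    using eigenmode_real(2)[OF D(1) vw Cp] by blast
  then obtain \<beta> where \<beta>: "\<And>k. k \<in> I \<Longrightarrow> \<beta> k > 0"
    "\<And>k. k \<in> I \<Longrightarrow> mass_form D (v k, w k) (v k, w k) = complex_of_real (\<beta> k)" by metis
  have kreal: "k = of_real (Re k)" "\<bar>Re k\<bar> \<le> R" if "k \<in> I" for k
  proof -
    show "k = of_real (Re k)" using eigenmode_real(1)[OF D(1) vw[OF that] Cp[OF that]] by (simp add: of_real_Re)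
    show "\<bar>Re k\<bar> \<le> R" using I(3) that abs_Re_le_cmod[of k] by auto
  qed
  have "complex_of_real (nU - nW) = ip (lebesgue_on D) U U - ip (lebesgue_on ?E) W W"
    by (simp add: ip_self nU_def nW_def)
  also have "\<dots> = (\<Sum>k\<in>I. \<Sum>m\<in>I. c k * cnj (c m) * mass_form D (v k, w k) (v m, w m))"
    unfolding U_def[abs_def] W_def[abs_def]
    by (simp add: ip_linear_combination L2s right_diff_distrib sum_subtractf)
  also have "\<dots> = (\<Sum>k\<in>I. of_real ((norm (c k))\<^sup>2) * mass_form D (v k, w k) (v k, w k))"
    by (intro sum_diagonal I(1) eigenmodes_orthogonal(1)[OF D(1) vw Cp vw Cp])
  also have "\<dots> = of_real (\<Sum>k\<in>I. (norm (c k))\<^sup>2 * \<beta> k)"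
    unfolding of_real_sum of_real_mult by (intro sum.cong refl) (simp only: \<beta>(2))
  finally have mass: "nU - nW = (\<Sum>k\<in>I. (norm (c k))\<^sup>2 * \<beta> k)" by (simp only: of_real_eq_iff)
  have "complex_of_real (nG + nQ) = vec_ip (lebesgue_on D) G G + vec_ip (lebesgue_on ?E) Q Q"
    by (simp add: vec_ip_self sqG sqQ nG_def nQ_def)
  also have "\<dots> = (\<Sum>k\<in>I. \<Sum>m\<in>I. c k * cnj (c m) * grad_form D (v k, w k) (v m, w m))"
    unfolding G_def[abs_def] Q_def[abs_def]
    by (simp add: vec_ip_linear_combination L2s distrib_left sum.distrib)
  also have "\<dots> = (\<Sum>k\<in>I. of_real ((norm (c k))\<^sup>2) * grad_form D (v k, w k) (v k, w k))"
    by (intro sum_diagonal I(1) eigenmodes_orthogonal(2)[OF D(1) vw Cp vw Cp])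
  also have "\<dots> = of_real (\<Sum>k\<in>I. (norm (c k))\<^sup>2 * ((Re k)\<^sup>2 * \<beta> k))"
    unfolding of_real_sum of_real_mult
  proof (intro sum.cong refl arg_cong2[where f = "(*)"])
    fix k assume k: "k \<in> I"
    have "k\<^sup>2 = complex_of_real ((Re k)\<^sup>2)" using kreal(1)[OF k] by (metis of_real_power)
    then show "grad_form D (v k, w k) (v k, w k) = complex_of_real ((Re k)\<^sup>2) * complex_of_real (\<beta> k)"
      using eigenmode_Green[OF D(1) vw[OF k] vw[OF k]] \<beta>(2)[OF k] by simp
  qed
  finally have "nG + nQ = (\<Sum>k\<in>I. (norm (c k))\<^sup>2 * ((Re k)\<^sup>2 * \<beta> k))" by (simp only: of_real_eq_iff)
  also have "\<dots> \<le> (\<Sum>k\<in>I. (norm (c k))\<^sup>2 * (R\<^sup>2 * \<beta> k))"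
  proof (intro sum_mono mult_left_mono mult_right_mono)
    fix k assume "k \<in> I"
    then show "(Re k)\<^sup>2 \<le> R\<^sup>2" using kreal(2)[of k] by (simp add: abs_le_square_iff[symmetric])
  qed (use \<beta>(1) in \<open>auto simp: less_imp_le\<close>)
  also have "\<dots> = R\<^sup>2 * (nU - nW)" unfolding mass by (simp add: sum_distrib_left mult_ac)
  also have "\<dots> \<le> R\<^sup>2 * nU" using nonneg by (intro mult_left_mono) auto
  finally have "nG \<le> R\<^sup>2 * nU" using nonneg by simp
  then have "\<epsilon> * (nU + nG) \<le> \<epsilon> * ((1 + R\<^sup>2) * nU)" using \<epsilon> by (intro mult_left_mono) (auto simp: algebra_simps)
  also have "\<dots> = (\<epsilon> * (1 + R\<^sup>2)) * nU" by simp
  also have "\<epsilon> * (1 + R\<^sup>2) = 1 / 2" using R2 by (simp add: \<epsilon>_def field_simps)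
  finally have "nU \<le> 0" using key by simp
  then have "(\<Sum>k\<in>I. (norm (c k))\<^sup>2 * \<beta> k) \<le> 0" using mass nonneg by simp
  moreover have "(\<Sum>k\<in>I. (norm (c k))\<^sup>2 * \<beta> k) > 0"
  proof -
    obtain j where j: "j \<in> I" "c j \<noteq> 0" using c(1) by blast
    then have "0 < (norm (c j))\<^sup>2 * \<beta> j" using \<beta>(1) by simp
    also have "\<dots> \<le> (\<Sum>k\<in>I. (norm (c k))\<^sup>2 * \<beta> k)"
      using j I(1) \<beta>(1) by (intro member_le_sum) (auto simp: less_imp_le)
    finally show ?thesis .
  qed
  ultimately show False by simp
qed

theorem theorem3p1:
  fixes D :: "(real^2) set"
  assumes "open D" and "connected D" and "D \<noteq> {}" and "bounded D"
    and "analytic_boundary D"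
  shows "{k. transmission_eigenvalue D k} \<subseteq> \<real> \<and>
         (\<forall>z\<in>C_plus. \<not> z islimpt {k. transmission_eigenvalue D k})"
proof (intro conjI ballI notI)
  show "{k. transmission_eigenvalue D k} \<subseteq> \<real>"
    using transmission_eigenvalue_eigenmode eigenmode_real(1)[OF assms(1)] by blast
  fix z assume "z islimpt {k. transmission_eigenvalue D k}"
  then have "infinite ({k. transmission_eigenvalue D k} \<inter> ball z 1)"
    unfolding islimpt_eq_infinite_ball by simp
  moreover have "{k. transmission_eigenvalue D k} \<inter> ball z 1
      \<subseteq> {k. transmission_eigenvalue D k \<and> norm k \<le> norm z + 1}"
  proof
    fix k assume k: "k \<in> {k. transmission_eigenvalue D k} \<inter> ball z 1"
    then have "norm (k - z) \<le> 1" by (simp add: dist_norm norm_minus_commute)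
    with norm_triangle_ineq[of z "k - z"] have "norm k \<le> norm z + 1" by simp
    with k show "k \<in> {k. transmission_eigenvalue D k \<and> norm k \<le> norm z + 1}" by simp
  qed
  then have "finite ({k. transmission_eigenvalue D k} \<inter> ball z 1)"
    by (rule finite_subset) (rule finitely_many_bounded_eigenvalues[OF assms(1,4,5)])
  ultimately show False by contradiction
qed

end
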